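(* Let $\bar a=(a_1,\ldots,a_m)$ and $\bar b=(b_1,\ldots,b_l)$ be two compositions of a positive integer $n$, let $\mathfrak q=\mathfrak q(\bar a|\bar b)\subset\mathfrak{gl}_n(\mathbb C)$ be the corresponding seaweed subalgebra and $\Gamma(\bar a|\bar b)$ the corresponding meander graph. To every maximal cycle $X$ of $\Gamma(\bar a|\bar b)$ of dimension $r$ (where a maximal segment is regarded as a maximal cycle of dimension $1$) attach the subgroup $GL_r\subset GL_n(\mathbb C)$ described in the context. Then the product of these subgroups $GL_r$ over all maximal cycles in $\Gamma(\bar a|\bar b)$ is a maximal reductive stabiliser for $\mathfrak q$.
   Context: Everything is over $\mathbb C$. General notions. Let $Q$ be a connected linear algebraic group with Lie algebra $\mathfrak q$ and centre $Z$. For $\gamma\in\mathfrak q^*$ let $Q_\gamma$, $\mathfrak q_\gamma$ be the stabilisers for the coadjoint action. $\gamma$ is of reductive type if $Q_\gamma/Z$ is a reductive subgroup of $GL(\mathfrak q)$, and of nilpotent type if $\gamma(\mathfrak q_\gamma)=0$. $\mathfrak q$ is quasi-reductive if it has a linear form of reductive type, and strongly quasi-reductive if in addition $\mathrm{Lie}\,Z$ consists of semisimple elements. If $\mathfrak q$ is strongly quasi-reductive, the linear forms that are both of reductive and of nilpotent type form one single coadjoint orbit $Q\gamma$, and $Q_\gamma$ (defined up to conjugation in $Q$) is called a maximal reductive stabiliser (MRS) of $\mathfrak q$. (All seaweed subalgebras of $\mathfrak{gl}_n$ are known to be strongly quasi-reductive.) Seaweeds. Each composition of $n$ divides $\{1,\ldots,n\}$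 into consecutive intervals (blocks) whose lengths are its parts. $\mathfrak q(\bar a|\bar b)$ is the set of matrices $(x_{ij})\in\mathfrak{gl}_n$ with $x_{ij}=0$ whenever $i>j$ and $i,j$ lie in different $\bar a$-blocks, and $x_{ij}=0$ whenever $i<j$ and $i,j$ lie in different $\bar b$-blocks. $Q\subset GL_n$ is the connected subgroup with Lie algebra $\mathfrak q$. Meander graph. $\Gamma(\bar a|\bar b)$ has vertices $1,\ldots,n$. For each $\bar a$-block $\{c+1,\ldots,c+a\}$ and each $1\le i<(a+1)/2$, there is an ($\bar a$-)edge joining $c+i$ and $c+a+1-i$; likewise for each $\bar b$-block there are $\bar b$-edges defined by the same rule. (An $\bar a$-edge and a $\bar b$-edge may join the same two vertices and then form a cycle with two vertices.) Each connected component is a simple cycle or a segment (a path, possibly a single isolated vertex). Let $Y$ be a cycle with vertices $y_1>\cdots>y_t$ and $X$ a connected component with vertices $x_1>\cdots>x_s$. $X$ lies inside $Y$ if $y_{2i}<x_1<y_{2i-1}$ for some $i$. $X$ is maximal if it does not lie inside any cycle. The dimension of a cycle is $2\cdot\#(\text{cycles lying inside it})+\#(\text{segments lying inside it})+2$. A segment has dimension $1$; a maximal segment is considered as a maximal cycle of dimension $1$. Attached subgroups. Let $X$ be a maximal cycle of dimension $r$ with vertices $x_1>\cdots>x_t$. If $X$ is a segment, the attached $GL_1$ consists of the diagonal matrices with the same $c\in\mathbb C^\times$ at the places $x_1,\ldots,x_t$ and $1$ at all other places. If $X$ is not a segment, then $t$ is even and $x_{2i-1}-x_{2i}=r-1$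 for all $i$, and the attached $GL_r$ is the diagonal subgroup of the product of the $t/2$ copies of $GL_r$ corresponding to the row and column intervals $[x_{2i},x_{2i-1}]$, $1\le i\le t/2$ (i.e. the same matrix $g\in GL_r$ is put in each of these diagonal blocks, and the identity elsewhere). *)

theory Defs
  imports
    "HOL.Complex"
    "HOL-Algebra.Bij"
    "HOL-Algebra.Coset"
    "HOL-Analysis.Abstract_Topology"
    "Jordan_Normal_Form.Matrix"
begin

section \<open>Zariski topology\<close>

inductive_set poly_funs :: "('a \<Rightarrow> complex) set \<Rightarrow> ('a \<Rightarrow> complex) set"
  for C :: "('a \<Rightarrow> complex) set" where
  coord: "f \<in> C \<Longrightarrow> f \<in> poly_funs C"
| const: "(\<lambda>x. c) \<in> poly_funs C"
| add: "f \<in> poly_funs C \<Longrightarrow> g \<in> poly_funs C \<Longrightarrow> (\<lambda>x. f x + g x) \<in> poly_funs C"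
| mult: "f \<in> poly_funs C \<Longrightarrow> g \<in> poly_funs C \<Longrightarrow> (\<lambda>x. f x * g x) \<in> poly_funs C"

text \<open>The principal open sets are stable under binary intersection, so the closed sets are
  exactly the zero sets of families of polynomial functions in the coordinates \<open>C\<close>.\<close>

definition zariski :: "('a \<Rightarrow> complex) set \<Rightarrow> 'a topology" where
  "zariski C = topology_generated_by {{x. f x \<noteq> 0} | f. f \<in> poly_funs C}"

section \<open>Linear algebraic groups\<close>

definition GL :: "nat \<Rightarrow> complex mat monoid" where
  "GL n = units_of (ring_mat TYPE(complex) n ())"

definition mat_coords :: "nat \<Rightarrow> (complex mat \<Rightarrow> complex) set" where
  "mat_coords n = {(\<lambda>A. A $$ (i, j)) | i j. i < n \<and> j < n}"

definition linear_algebraic_group :: "nat \<Rightarrow> complex mat set \<Rightarrow> bool" where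
  "linear_algebraic_group n Q \<longleftrightarrow> subgroup Q (GL n) \<and>
     closedin (subtopology (zariski (mat_coords n)) (carrier (GL n))) Q"

definition connected_linear_algebraic_group :: "nat \<Rightarrow> complex mat set \<Rightarrow> bool" where
  "connected_linear_algebraic_group n Q \<longleftrightarrow>
     linear_algebraic_group n Q \<and> connectedin (zariski (mat_coords n)) Q"

definition mat_exp :: "nat \<Rightarrow> complex mat \<Rightarrow> complex mat" where
  "mat_exp n X = mat n n (\<lambda>(i, j). \<Sum>k. (X ^\<^sub>m k) $$ (i, j) / fact k)"

definition lie_algebra :: "nat \<Rightarrow> complex mat set \<Rightarrow> complex mat set" where
  "lie_algebra n Q = {X \<in> carrier_mat n n. \<forall>t. mat_exp n (t \<cdot>\<^sub>m X) \<in> Q}"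

definition centre :: "complex mat set \<Rightarrow> complex mat set" where
  "centre Q = {z \<in> Q. \<forall>g \<in> Q. z * g = g * z}"

definition semisimple_mat :: "complex mat \<Rightarrow> bool" where
  "semisimple_mat A \<longleftrightarrow> (\<exists>D. diagonal_mat D \<and> similar_mat A D)"

section \<open>Reductive subgroups of \<open>GL(V)\<close>, for a linear subspace \<open>V\<close> of the n by n matrices\<close>

definition linear_form :: "complex mat set \<Rightarrow> (complex mat \<Rightarrow> complex) \<Rightarrow> bool" where
  "linear_form V \<gamma> \<longleftrightarrow> (\<forall>X\<in>V. \<forall>Y\<in>V. \<gamma> (X + Y) = \<gamma> X + \<gamma> Y) \<and> (\<forall>c. \<forall>X\<in>V. \<gamma> (c \<cdot>\<^sub>m X) = c * \<gamma> X)"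

definition linear_bij :: "complex mat set \<Rightarrow> (complex mat \<Rightarrow> complex mat) set" where
  "linear_bij V = {T \<in> Bij V. (\<forall>X\<in>V. \<forall>Y\<in>V. T (X + Y) = T X + T Y) \<and>
     (\<forall>c. \<forall>X\<in>V. T (c \<cdot>\<^sub>m X) = c \<cdot>\<^sub>m T X)}"

definition GL_of :: "complex mat set \<Rightarrow> (complex mat \<Rightarrow> complex mat) monoid" where
  "GL_of V = BijGroup V \<lparr>carrier := linear_bij V\<rparr>"

definition end_coords :: "complex mat set \<Rightarrow> ((complex mat \<Rightarrow> complex mat) \<Rightarrow> complex) set" where
  "end_coords V = {(\<lambda>T. l (T X)) | l X. linear_form V l \<and> X \<in> V}"

definition algebraic_subgroup ::
  "complex mat set \<Rightarrow> (complex mat \<Rightarrow> complex mat) set \<Rightarrow> bool" where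
  "algebraic_subgroup V G \<longleftrightarrow> subgroup G (GL_of V) \<and>
     closedin (subtopology (zariski (end_coords V)) (carrier (GL_of V))) G"

definition unipotent :: "nat \<Rightarrow> complex mat set \<Rightarrow> (complex mat \<Rightarrow> complex mat) \<Rightarrow> bool" where
  "unipotent n V T \<longleftrightarrow> (\<exists>k. \<forall>X\<in>V. ((\<lambda>Y. T Y - Y) ^^ k) X = 0\<^sub>m n n)"

text \<open>Reductive means trivial unipotent radical; the group itself need not be connected.\<close>

definition reductive_subgroup ::
  "nat \<Rightarrow> complex mat set \<Rightarrow> (complex mat \<Rightarrow> complex mat) set \<Rightarrow> bool" where
  "reductive_subgroup n V G \<longleftrightarrow> algebraic_subgroup V G \<and>
     (\<forall>U. algebraic_subgroup V U \<and> U \<lhd> (GL_of V \<lparr>carrier := G\<rparr>) \<and>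
          connectedin (zariski (end_coords V)) U \<and> (\<forall>T\<in>U. unipotent n V T)
        \<longrightarrow> U = {\<one>\<^bsub>GL_of V\<^esub>})"

section \<open>Coadjoint action and maximal reductive stabilisers\<close>

definition conj_mat :: "nat \<Rightarrow> complex mat \<Rightarrow> complex mat \<Rightarrow> complex mat" where
  "conj_mat n g X = g * X * inv\<^bsub>GL n\<^esub> g"

definition Ad :: "nat \<Rightarrow> complex mat set \<Rightarrow> complex mat \<Rightarrow> (complex mat \<Rightarrow> complex mat)" where
  "Ad n Q g = (\<lambda>X \<in> lie_algebra n Q. conj_mat n g X)"

definition coadjoint :: "nat \<Rightarrow> complex mat \<Rightarrow> (complex mat \<Rightarrow> complex) \<Rightarrow> (complex mat \<Rightarrow> complex)" where
  "coadjoint n g \<gamma> = (\<lambda>X. \<gamma> (conj_mat n (inv\<^bsub>GL n\<^esub> g) X))"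

text \<open>Linear forms on the Lie algebra are represented by functions on all matrices, of which only
  the values on the Lie algebra matter.\<close>

definition group_stabiliser ::
  "nat \<Rightarrow> complex mat set \<Rightarrow> (complex mat \<Rightarrow> complex) \<Rightarrow> complex mat set" where
  "group_stabiliser n Q \<gamma> = {g \<in> Q. \<forall>X \<in> lie_algebra n Q. coadjoint n g \<gamma> X = \<gamma> X}"

definition lie_stabiliser ::
  "nat \<Rightarrow> complex mat set \<Rightarrow> (complex mat \<Rightarrow> complex) \<Rightarrow> complex mat set" where
  "lie_stabiliser n Q \<gamma> =
     {X \<in> lie_algebra n Q. \<forall>Y \<in> lie_algebra n Q. \<gamma> (X * Y - Y * X) = 0}"

text \<open>For connected \<open>Q\<close> the kernel of \<open>Ad\<close> is the centre \<open>Z\<close> of \<open>Q\<close>, and the stabiliser of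
  \<open>\<gamma>\<close> modulo \<open>Z\<close>, as a subgroup of the general linear group of the Lie algebra, is the image of
  the stabiliser under \<open>Ad\<close>.\<close>

definition reductive_type :: "nat \<Rightarrow> complex mat set \<Rightarrow> (complex mat \<Rightarrow> complex) \<Rightarrow> bool" where
  "reductive_type n Q \<gamma> \<longleftrightarrow>
     reductive_subgroup n (lie_algebra n Q) (Ad n Q ` group_stabiliser n Q \<gamma>)"

definition nilpotent_type :: "nat \<Rightarrow> complex mat set \<Rightarrow> (complex mat \<Rightarrow> complex) \<Rightarrow> bool" where
  "nilpotent_type n Q \<gamma> \<longleftrightarrow> (\<forall>X \<in> lie_stabiliser n Q \<gamma>. \<gamma> X = 0)"

definition quasi_reductive :: "nat \<Rightarrow> complex mat set \<Rightarrow> bool" where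
  "quasi_reductive n Q \<longleftrightarrow> (\<exists>\<gamma>. linear_form (lie_algebra n Q) \<gamma> \<and> reductive_type n Q \<gamma>)"

definition strongly_quasi_reductive :: "nat \<Rightarrow> complex mat set \<Rightarrow> bool" where
  "strongly_quasi_reductive n Q \<longleftrightarrow> quasi_reductive n Q \<and>
     (\<forall>X \<in> lie_algebra n (centre Q). semisimple_mat X)"

definition maximal_reductive_stabiliser :: "nat \<Rightarrow> complex mat set \<Rightarrow> complex mat set \<Rightarrow> bool" where
  "maximal_reductive_stabiliser n Q H \<longleftrightarrow> strongly_quasi_reductive n Q \<and>
     (\<exists>\<gamma>. linear_form (lie_algebra n Q) \<gamma> \<and> reductive_type n Q \<gamma> \<and> nilpotent_type n Q \<gamma> \<and>
          H = group_stabiliser n Q \<gamma>)"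

section \<open>Seaweed algebras\<close>

text \<open>Rows, columns and meander vertices are numbered from 0 to n - 1.\<close>

definition composition :: "nat \<Rightarrow> nat list \<Rightarrow> bool" where
  "composition n as \<longleftrightarrow> (\<forall>a \<in> set as. a > 0) \<and> sum_list as = n"

definition block_start :: "nat list \<Rightarrow> nat \<Rightarrow> nat" where
  "block_start as k = sum_list (take k as)"

definition block :: "nat list \<Rightarrow> nat \<Rightarrow> nat set" where
  "block as k = {block_start as k ..< block_start as k + as ! k}"

definition same_block :: "nat list \<Rightarrow> nat \<Rightarrow> nat \<Rightarrow> bool" where
  "same_block as i j \<longleftrightarrow> (\<exists>k < length as. i \<in> block as k \<and> j \<in> block as k)"

definition seaweed :: "nat \<Rightarrow> nat list \<Rightarrow> nat list \<Rightarrow> complex mat set" where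
  "seaweed n as bs = {A \<in> carrier_mat n n. \<forall>i<n. \<forall>j<n.
     (i > j \<and> \<not> same_block as i j \<longrightarrow> A $$ (i, j) = 0) \<and>
     (i < j \<and> \<not> same_block bs i j \<longrightarrow> A $$ (i, j) = 0)}"

section \<open>Meander graphs\<close>

definition arcs :: "nat list \<Rightarrow> nat set set" where
  "arcs as = {{block_start as k + i, block_start as k + (as ! k - 1 - i)} | k i.
     k < length as \<and> 2 * i + 1 < as ! k}"

text \<open>The meander graph is a multigraph: the disjoint sum keeps an edge of the first composition
  apart from an edge of the second one with the same ends.\<close>

definition meander_edges :: "nat list \<Rightarrow> nat list \<Rightarrow> (nat set + nat set) set" where
  "meander_edges as bs = arcs as <+> arcs bs"

definition ends :: "nat set + nat set \<Rightarrow> nat set" where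
  "ends e = case_sum id id e"

definition adjacency :: "nat list \<Rightarrow> nat list \<Rightarrow> nat rel" where
  "adjacency as bs = {(u, v). \<exists>e \<in> meander_edges as bs. ends e = {u, v}}"

definition meander_components :: "nat \<Rightarrow> nat list \<Rightarrow> nat list \<Rightarrow> nat set set" where
  "meander_components n as bs = {..<n} // ((adjacency as bs)\<^sup>* \<inter> {..<n} \<times> {..<n})"

definition spans_cycle :: "nat list \<Rightarrow> nat list \<Rightarrow> nat set \<Rightarrow> bool" where
  "spans_cycle as bs X \<longleftrightarrow> (\<exists>vs es. length vs \<ge> 2 \<and> length es = length vs \<and>
     distinct vs \<and> distinct es \<and> set vs = X \<and> set es \<subseteq> meander_edges as bs \<and>
     (\<forall>i < length vs. ends (es ! i) = {vs ! i, vs ! (Suc i mod length vs)}))"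

definition cycles :: "nat \<Rightarrow> nat list \<Rightarrow> nat list \<Rightarrow> nat set set" where
  "cycles n as bs = {X \<in> meander_components n as bs. spans_cycle as bs X}"

definition segments :: "nat \<Rightarrow> nat list \<Rightarrow> nat list \<Rightarrow> nat set set" where
  "segments n as bs = meander_components n as bs - cycles n as bs"

definition descending :: "nat set \<Rightarrow> nat list" where
  "descending X = rev (sorted_list_of_set X)"

definition lies_inside :: "nat set \<Rightarrow> nat set \<Rightarrow> bool" where
  "lies_inside X Y \<longleftrightarrow> (\<exists>i. 2 * i + 1 < card Y \<and>
     descending Y ! (2 * i + 1) < Max X \<and> Max X < descending Y ! (2 * i))"

definition maximal_components :: "nat \<Rightarrow> nat list \<Rightarrow> nat list \<Rightarrow> nat set set" where
  "maximal_components n as bs =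
     {X \<in> meander_components n as bs. \<not> (\<exists>Y \<in> cycles n as bs. lies_inside X Y)}"

definition dimension :: "nat \<Rightarrow> nat list \<Rightarrow> nat list \<Rightarrow> nat set \<Rightarrow> nat" where
  "dimension n as bs X =
     (if X \<in> cycles n as bs
      then 2 * card {Y \<in> cycles n as bs. lies_inside Y X}
         + card {Y \<in> segments n as bs. lies_inside Y X} + 2
      else 1)"

section \<open>The attached subgroups and their product\<close>

definition segment_group :: "nat \<Rightarrow> nat set \<Rightarrow> complex mat set" where
  "segment_group n X =
     {mat n n (\<lambda>(p, q). if p = q then if p \<in> X then c else 1 else 0) | c. c \<noteq> 0}"

definition cycle_group :: "nat \<Rightarrow> nat \<Rightarrow> nat set \<Rightarrow> complex mat set" where
  "cycle_group n r X =
     {A \<in> carrier_mat n n. \<exists>g \<in> carrier (GL r).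
        (\<forall>i. 2 * i + 1 < card X \<longrightarrow> (\<forall>p<r. \<forall>q<r.
           A $$ (descending X ! (2 * i + 1) + p, descending X ! (2 * i + 1) + q) = g $$ (p, q))) \<and>
        (\<forall>p<n. \<forall>q<n.
           \<not> (\<exists>i. 2 * i + 1 < card X \<and>
                {p, q} \<subseteq> {descending X ! (2 * i + 1) .. descending X ! (2 * i)})
           \<longrightarrow> A $$ (p, q) = (if p = q then 1 else 0))}"

definition attached_group :: "nat \<Rightarrow> nat list \<Rightarrow> nat list \<Rightarrow> nat set \<Rightarrow> complex mat set" where
  "attached_group n as bs X =
     (if X \<in> cycles n as bs then cycle_group n (dimension n as bs X) X else segment_group n X)"

text \<open>All orders of the factors are allowed; the attached subgroups commute with each other, so
  the order is immaterial.\<close>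

definition meander_group :: "nat \<Rightarrow> nat list \<Rightarrow> nat list \<Rightarrow> complex mat set" where
  "meander_group n as bs =
     {foldr (*) (map h Xs) (1\<^sub>m n) | h Xs. distinct Xs \<and> set Xs = maximal_components n as bs \<and>
        (\<forall>X \<in> set Xs. h X \<in> attached_group n as bs X)}"

end

theory Submission
  imports Defs "Jordan_Normal_Form.Char_Poly"
begin

text \<open>
  The seaweed algebra is the incidence algebra of a preorder on the vertices, hence an associative
  algebra, and the connected group with this Lie algebra is its group of units. So the stabiliser
  of a linear form \<open>\<gamma>\<close> consists of the units of the associative algebra
  \<open>{X. \<gamma> (X Y) = \<gamma> (Y X) for all Y}\<close>, and everything reduces to linear equations.

  The intervals \<open>[x\<^sub>2\<^sub>i, x\<^sub>2\<^sub>i\<^sub>-\<^sub>1]\<close> of the maximal cycles, together with the single vertices of the maximal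
  segments, partition the vertices, and the reflections in the blocks permute these fat
  intervals. Contracting them turns the meander graph into a disjoint union of paths. For \<open>\<gamma>\<close> take the
  sum of the matrix entries that pair equal offsets in the two fat intervals joined by an edge. A matrix
  entry violating the expected block form could be moved along edges for ever, which is
  impossible on a path; so the stabiliser consists of the block diagonal
  matrices with equal blocks along each path.
  It is reductive since every normal subgroup of it that acts by unipotent elements is central: the
  commutator of a non-diagonal element with a suitable transvection has the
  eigenvalues 2 and 1/2.
\<close>

section \<open>The linear equations of the stabiliser\<close>

text \<open>Two obstacles shape the proof. The fat intervals and the path structure of the
  contracted graph must be derived from the reflections alone. Most of this rests on one parity
  count: a reflection pairs up the vertices of a cycle that lie between two mirror-image thresholds.
  It shows that being surrounded by a cycle is constant on components, that reflections permute the
  intervals, and that on a maximal cycle some interval is mirrored to itself, which is the end of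
  the contracted path.

  Secondly, reductivity demands that the image of the stabiliser under \<open>Ad\<close> be Zariski
  closed in the linear group of the Lie algebra. An element implementing a given linear bijection is
  determined only up to one scalar for each connected class of the preorder. The linear system for
  it is therefore solved class by class, and closedness becomes the vanishing of Gram determinants.

  Positions \<open>c\<close> may coincide: the same axioms serve vertices with
  \<open>c = int\<close>, fat intervals with \<open>c\<close> the doubled centre, and both with
  negated positions, which lets the two compositions trade roles.\<close>

locale reflection_blocks =
  fixes n :: nat and c :: "nat \<Rightarrow> int" and f :: "nat \<Rightarrow> nat" and r :: "nat \<Rightarrow> nat \<Rightarrow> bool"
  assumes f_less: "x < n \<Longrightarrow> f x < n"
    and f_f: "x < n \<Longrightarrow> f (f x) = x"
    and r_f: "x < n \<Longrightarrow> r x (f x)"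
    and r_refl: "x < n \<Longrightarrow> r x x"
    and r_sym: "x < n \<Longrightarrow> y < n \<Longrightarrow> r x y \<Longrightarrow> r y x"
    and r_trans: "x < n \<Longrightarrow> y < n \<Longrightarrow> z < n \<Longrightarrow> r x y \<Longrightarrow> r y z \<Longrightarrow> r x z"
    and c_f: "x < n \<Longrightarrow> y < n \<Longrightarrow> r x y \<Longrightarrow> c (f x) + c x = c (f y) + c y"
    and f_fixed: "x < n \<Longrightarrow> c (f x) = c x \<Longrightarrow> f x = x"
    and r_convex: "x < n \<Longrightarrow> y < n \<Longrightarrow> z < n \<Longrightarrow> r x z \<Longrightarrow> c x \<le> c y \<Longrightarrow> c y \<le> c z \<Longrightarrow> r x y"
begin

lemma r_same: "x < n \<Longrightarrow> y < n \<Longrightarrow> c x = c y \<Longrightarrow> r x y"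
  using r_convex[of x y x] r_refl by simp

lemma c_f_same: "x < n \<Longrightarrow> y < n \<Longrightarrow> c x = c y \<Longrightarrow> c (f x) = c (f y)"
  using c_f[of x y] r_same[of x y] by simp

end

lemma reflection_blocks_uminus:
  assumes "reflection_blocks n c f r"
  shows "reflection_blocks n (\<lambda>x. - c x) f r"
proof -
  interpret reflection_blocks n c f r by fact
  show ?thesis
  proof (unfold_locales, goal_cases)
    case (7 x y)
    then show ?case using c_f[of x y] by simp
  next
    case (9 x y z)
    then have "r z y" using r_convex[of z y x] r_sym[of x z] by simp
    then show ?case using 9 r_trans[of x z y] by simp
  qed (simp_all add: f_less f_f r_f r_refl f_fixed, (metis r_sym), (metis r_trans))
qed

text \<open>\<open>acyclic\<close> says without graphs that every component of the contracted graph
  is a path: a component is a set stable under \<open>f\<close> and \<open>g\<close>, and an end of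
  a path lacks an edge of one kind, hence is a fixed point.\<close>

locale fat_meander = A: reflection_blocks n c f ra + B: reflection_blocks n c g rb
  for n c f g ra rb +
  assumes acyclic: "\<lbrakk>S \<noteq> {}; S \<subseteq> {..<n}; f ` S \<subseteq> S; g ` S \<subseteq> S\<rbrakk> \<Longrightarrow> \<exists>x\<in>S. f x = x \<or> g x = x"
begin

text \<open>The support relation of the algebra, with intervals in place of vertices: the order of
  the positions decides which composition is responsible, and entries within one interval are always
  allowed.\<close>

definition rel :: "nat \<Rightarrow> nat \<Rightarrow> bool" where
  "rel i j \<longleftrightarrow> c i = c j \<or> (c j < c i \<and> ra i j) \<or> (c i < c j \<and> rb i j)"

lemma fat_meander_swap: "fat_meander n (\<lambda>x. - c x) g f rb ra"
proof (intro fat_meander.intro fat_meander_axioms.intro)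
  show "reflection_blocks n (\<lambda>x. - c x) g rb" "reflection_blocks n (\<lambda>x. - c x) f ra"
    using reflection_blocks_uminus A.reflection_blocks_axioms B.reflection_blocks_axioms by auto
qed (use acyclic in blast)

lemma rel_alt: "i < n \<Longrightarrow> j < n \<Longrightarrow> rel i j \<longleftrightarrow> (c j \<le> c i \<and> ra i j) \<or> (c i \<le> c j \<and> rb i j)"
  using A.r_same[of i j] by (auto simp: rel_def)

text \<open>The mixed cases need convexity: if \<open>i\<close> and \<open>k\<close> lie on the same
  side of \<open>j\<close>, the nearer of the two belongs to the block that joins \<open>j\<close>
  to the farther one. Thus matrices supported on \<open>rel\<close> are closed under
  products.\<close>

lemma rel_trans:
  assumes lt: "i < n" "j < n" "k < n" and "rel i j" "rel j k"
  shows "rel i k"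
proof -
  have rel: "c k \<le> c i \<and> ra i k \<or> c i \<le> c k \<and> rb i k \<Longrightarrow> ?thesis" using rel_alt lt by blast
  have "c j \<le> c i \<and> ra i j \<or> c i \<le> c j \<and> rb i j" "c k \<le> c j \<and> ra j k \<or> c j \<le> c k \<and> rb j k"
    using assms rel_alt by blast+
  then consider "c j \<le> c i" "ra i j" "c k \<le> c j" "ra j k" | "c i \<le> c j" "rb i j" "c j \<le> c k" "rb j k"
    | "c j \<le> c i" "ra i j" "c j \<le> c k" "rb j k" | "c i \<le> c j" "rb i j" "c k \<le> c j" "ra j k" by blast
  then show ?thesis
  proof cases
    case 1
    then show ?thesis using rel A.r_trans[of i j k] lt by simp
  next
    case 2
    then show ?thesis using rel B.r_trans[of i j k] lt by simp
  next
    case 3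
    show ?thesis
    proof (cases "c k \<le> c i")
      case True
      then have "ra j k" using A.r_convex[of j k i] A.r_sym[of i j] 3 lt by blast
      then show ?thesis using True rel A.r_trans[of i j k] 3 lt by blast
    next
      case False
      then have "rb j i" using B.r_convex[of j i k] 3 lt by simp
      then show ?thesis using False rel B.r_trans[of i j k] B.r_sym[of j i] 3 lt by simp
    qed
  next
    case 4
    show ?thesis
    proof (cases "c i \<le> c k")
      case True
      then show ?thesis using rel B.r_convex[of i k j] 4 lt by blast
    next
      case False
      then have "ra k i" using A.r_convex[of k i j] A.r_sym[of j k] 4 lt by simp
      then show ?thesis using False rel A.r_sym[of k i] lt by simp
    qed
  qed
qed

text \<open>A walk that alternates between \<open>f\<close> and \<open>g\<close> and never meets a fixed point would be a cycle.\<close>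

lemma no_endless_walk:
  assumes "S \<subseteq> {..<n}" and walk: "\<And>x. x \<in> S \<Longrightarrow> g x \<noteq> x \<and> f (g x) \<noteq> g x \<and> f (g x) \<in> S"
  shows "S = {}"
proof (rule ccontr)
  assume "S \<noteq> {}"
  have lt: "x < n" if "x \<in> S" for x using that assms(1) by auto
  have inj: "inj_on (\<lambda>x. f (g x)) S"
  proof (rule inj_onI)
    fix x y assume "x \<in> S" "y \<in> S" "f (g x) = f (g y)"
    moreover from this have "x < n" "y < n" using lt by blast+
    ultimately show "x = y"
      using A.f_f[of "g x"] A.f_f[of "g y"] B.f_less B.f_f[of x] B.f_f[of y] by metis
  qed
  have sub: "(\<lambda>x. f (g x)) ` S \<subseteq> S" using walk by blast
  have "finite S" using assms(1) finite_subset by auto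
  with inj sub have surj: "(\<lambda>x. f (g x)) ` S = S" by (simp add: endo_inj_surj)
  \<comment> \<open>An injective self-map of a finite set is onto, so every \<open>f x\<close> with
    \<open>x\<close> in \<open>S\<close> has the form \<open>g y\<close> with \<open>y\<close> in
    \<open>S\<close>. Hence \<open>?O\<close> is stable under both reflections.\<close>
  let ?O = "S \<union> g ` S"
  have fS: "\<exists>y\<in>S. f x = g y \<and> x = f (g y)" if "x \<in> S" for x
  proof -
    obtain y where "y \<in> S" "x = f (g y)" using surj \<open>x \<in> S\<close> by blast
    then show ?thesis using A.f_f[of "g y"] B.f_less[of y] lt[of y] by blast
  qed
  have "f ` ?O \<subseteq> ?O" using fS walk by blast
  moreover have "g ` ?O \<subseteq> ?O" using B.f_f lt by force
  moreover have "?O \<subseteq> {..<n}" using lt B.f_less by auto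
  ultimately obtain x where x: "x \<in> ?O" "f x = x \<or> g x = x"
    using acyclic[of ?O] \<open>S \<noteq> {}\<close> by blast
  show False
  proof (cases "x \<in> S")
    case True
    then have "f x = x" using x walk by blast
    then show False using fS[OF True] walk by metis
  next
    case False
    then obtain y where "y \<in> S" "x = g y" using x by auto
    then show False using x walk[of y] B.f_f[of y] lt[of y] by auto
  qed
qed

end

text \<open>The coefficient of \<open>Y p q\<close> in the value of the linear form on the
  commutator of \<open>X\<close> and \<open>Y\<close>, as far as it comes from the arcs of one
  reflection. Negated positions give the share of the other composition, whose arcs live in the
  opposite triangle.\<close>

definition a_term :: "(nat \<Rightarrow> int) \<Rightarrow> (nat \<Rightarrow> nat) \<Rightarrow> (nat \<Rightarrow> nat \<Rightarrow> complex) \<Rightarrow> nat \<Rightarrow> nat \<Rightarrow> complex" where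
  "a_term c f X p q =
     (if c q < c (f q) then X (f q) p else 0) - (if c (f p) < c p then X q (f p) else 0)"

locale stabiliser_equations = fat_meander +
  fixes X :: "nat \<Rightarrow> nat \<Rightarrow> complex"
  assumes supp: "i < n \<Longrightarrow> j < n \<Longrightarrow> \<not> rel i j \<Longrightarrow> X i j = 0"
    and eqn: "p < n \<Longrightarrow> q < n \<Longrightarrow> rel p q \<Longrightarrow> a_term c f X p q + a_term (\<lambda>x. - c x) g X p q = 0"
begin

lemma stabiliser_equations_swap: "stabiliser_equations n (\<lambda>x. - c x) g f rb ra X"
proof (intro stabiliser_equations.intro stabiliser_equations_axioms.intro fat_meander_swap)
  interpret S: fat_meander n "\<lambda>x. - c x" g f rb ra by (rule fat_meander_swap)
  have rel: "S.rel = rel" by (intro ext) (auto simp: S.rel_def rel_def)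
  show "X i j = 0" if "i < n" "j < n" "\<not> S.rel i j" for i j using that supp by (simp add: rel)
  show "a_term (\<lambda>x. - c x) g X p q + a_term (\<lambda>x. - (- c x)) f X p q = 0"
    if "p < n" "q < n" "S.rel p q" for p q using eqn[of p q] that by (simp add: rel add.commute)
qed

abbreviation "ta \<equiv> a_term c f X"
abbreviation "tb \<equiv> a_term (\<lambda>x. - c x) g X"

text \<open>For \<open>c q \<le> c p\<close> only upper entries of \<open>X\<close> contribute to
  \<open>tb\<close>, so \<open>p\<close> and \<open>q\<close> share a block of the second
  composition. Since \<open>c p + c (g p) = c q + c (g q)\<close>, the inequality says that both lie
  strictly on the same side of the centre of that block.\<close>

lemma tb_nonzero:
  assumes "p < n" "q < n" "c q \<le> c p" "tb p q \<noteq> 0"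
  shows "rb p q \<and> \<bar>c p - c q\<bar> < \<bar>c (g p) - c q\<bar>"
proof -
  have "(c (g q) < c q \<and> X (g q) p \<noteq> 0) \<or> (c p < c (g p) \<and> X q (g p) \<noteq> 0)"
    using assms(4) by (auto simp: a_term_def split: if_splits)
  then show ?thesis
  proof
    assume *: "c (g q) < c q \<and> X (g q) p \<noteq> 0"
    then have "rel (g q) p" using supp assms B.f_less by blast
    then have "rb (g q) p" using * assms(3) by (auto simp: rel_def)
    then have "rb p q" using B.r_f B.r_sym B.r_trans assms B.f_less by meson
    with B.c_f[of p q] * assms show ?thesis by auto
  next
    assume *: "c p < c (g p) \<and> X q (g p) \<noteq> 0"
    then have "rel q (g p)" using supp assms B.f_less by blast
    then have "rb q (g p)" using * assms(3) by (auto simp: rel_def)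
    then have "rb p q" using B.r_f B.r_sym B.r_trans assms B.f_less by meson
    with B.c_f[of p q] * assms show ?thesis by auto
  qed
qed

text \<open>On one side of the centre exactly one of the two conditionals of \<open>tb\<close>
  holds. Reflecting both indices makes the other one hold, with the same entry of \<open>X\<close>
  and the opposite sign.\<close>

lemma tb_mirror:
  assumes "p < n" "q < n" "rb p q" "\<bar>c p - c q\<bar> < \<bar>c (g p) - c q\<bar>"
  shows "tb (g p) (g q) = - tb p q" "g p \<noteq> p"
  using B.c_f[OF assms(1-3)] B.f_f[of p] B.f_f[of q] assms
  by (auto simp: a_term_def split: if_splits)

end

context stabiliser_equations
begin

interpretation swap: stabiliser_equations n "\<lambda>x. - c x" g f rb ra X
  rewrites "\<And>x. - (- c x) = c x"
  by (rule stabiliser_equations_swap) simp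

text \<open>By the equation a nonzero \<open>ta p q\<close> forces \<open>tb p q\<close> to be
  nonzero. This survives reflection by \<open>g\<close>, which leads to the upper triangle; there
  the same reasoning with swapped roles carries it on by \<open>f\<close> and back to the lower
  triangle, without fixed points on the way.\<close>

lemma ta_zero_lower:
  assumes "p < n" "q < n" "c q \<le> c p" "rel p q"
  shows "ta p q = 0"
proof -
  define S where "S = {p. \<exists>q. p < n \<and> q < n \<and> c q \<le> c p \<and> rel p q \<and> ta p q \<noteq> 0}"
  have "S = {}"
  proof (rule no_endless_walk)
    show "S \<subseteq> {..<n}" by (auto simp: S_def)
    fix p assume "p \<in> S"
    then obtain q where q: "p < n" "q < n" "c q \<le> c p" "rel p q" "ta p q \<noteq> 0"
      by (auto simp: S_def)
    let ?p = "g p" and ?q = "g q"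
    have "tb p q \<noteq> 0" using eqn[of p q] q by auto
    with q have b: "rb p q" "\<bar>c p - c q\<bar> < \<bar>c (g p) - c q\<bar>" using tb_nonzero by auto
    then have m: "tb ?p ?q \<noteq> 0" "g p \<noteq> p" using tb_mirror[of p q] q \<open>tb p q \<noteq> 0\<close> by auto
    have lt: "?p < n" "?q < n" using q B.f_less by auto
    have ord: "c ?p \<le> c ?q" using B.c_f[of p q] b q by auto
    have "rb ?p ?q" using b q lt B.r_f B.r_sym B.r_trans by meson
    then have "rel ?p ?q" using ord by (auto simp: rel_def)
    then have ta: "ta ?p ?q \<noteq> 0" using eqn[of ?p ?q] lt m by auto
    then have a: "ra ?p ?q" "\<bar>c ?p - c ?q\<bar> < \<bar>c (f ?p) - c ?q\<bar>"
      using swap.tb_nonzero[of ?p ?q] lt ord by auto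
    then have m': "ta (f ?p) (f ?q) \<noteq> 0" "f ?p \<noteq> ?p"
      using swap.tb_mirror[of ?p ?q] lt ta by auto
    have lt': "f ?p < n" "f ?q < n" using lt A.f_less by auto
    have "ra (f ?p) (f ?q)" using a lt lt' A.r_f A.r_sym A.r_trans by meson
    moreover have ord': "c (f ?q) \<le> c (f ?p)" using A.c_f[of ?p ?q] a lt ord by auto
    ultimately have "rel (f ?p) (f ?q)" by (auto simp: rel_def)
    then show "g p \<noteq> p \<and> f (g p) \<noteq> g p \<and> f (g p) \<in> S"
      using m m' lt' ord' by (auto simp: S_def)
  qed
  then show ?thesis using assms by (auto simp: S_def)
qed

text \<open>The vanishing of one \<open>a_term\<close> equates \<open>X i j\<close> with its mirror
  image. The two cases choose the index pair, \<open>(j, f i)\<close> or \<open>(f j, i)\<close>,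
  that lies in the lower triangle, where \<open>ta_zero_lower\<close> applies.\<close>

lemma lower_step:
  assumes "i < n" "j < n" "c j < c i" "X i j \<noteq> 0"
  shows "X (f i) (f j) \<noteq> 0 \<and> c (f i) < c (f j) \<and> f i \<noteq> i"
proof -
  have "ra i j" using supp[of i j] assms by (auto simp: rel_def)
  with assms have cf: "c (f i) + c i = c (f j) + c j" using A.c_f by blast
  note lt = A.f_less[OF assms(1)] A.f_less[OF assms(2)]
  note ff = A.f_f[OF assms(1)] A.f_f[OF assms(2)]
  show ?thesis
  proof (cases "c (f i) \<le> c j")
    case True
    have "ra j (f i)" using \<open>ra i j\<close> A.r_f A.r_sym A.r_trans assms lt by meson
    then have "rel j (f i)" using True by (auto simp: rel_def)
    then have "ta j (f i) = 0" using ta_zero_lower True assms lt by blast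
    then have "X i j = (if c (f j) < c j then X (f i) (f j) else 0)"
      using True assms(3) by (simp add: a_term_def ff)
    then show ?thesis using assms cf True by (auto split: if_splits)
  next
    case False
    have "ra (f j) i" using \<open>ra i j\<close> A.r_f A.r_sym A.r_trans assms lt by meson
    moreover have ord: "c i < c (f j)" using cf False by simp
    ultimately have "rel (f j) i" by (auto simp: rel_def)
    then have "ta (f j) i = 0" using ta_zero_lower ord assms lt by simp
    then have "X i j = (if c i < c (f i) then X (f i) (f j) else 0)"
      using ord assms(3) by (simp add: a_term_def ff split: if_splits)
    then show ?thesis using assms cf by (auto split: if_splits)
  qed
qed

lemma diag_step:
  assumes "i < n" "j < n" "c i = c j"
  shows "X (f i) (f j) = X i j"
proof -
  have *: "X (f i) (f j) = X i j" if "i < n" "j < n" "c i = c j" "c (f i) < c i" for i j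
  proof -
    have cf: "c (f i) = c (f j)" using that A.c_f_same by blast
    note lt = A.f_less[OF that(1)]
    have "ra j (f i)" using that lt A.r_same A.r_f A.r_trans by metis
    then have "rel j (f i)" using that by (auto simp: rel_def)
    then have "ta j (f i) = 0" using ta_zero_lower that lt by simp
    then show ?thesis using that cf A.f_f by (simp add: a_term_def)
  qed
  consider "c (f i) = c i" | "c (f i) < c i" | "c i < c (f i)" by linarith
  then show ?thesis
  proof cases
    case 1
    then show ?thesis using assms A.f_fixed A.c_f_same by metis
  next
    case 2
    then show ?thesis using * assms by simp
  next
    case 3
    have "X (f (f i)) (f (f j)) = X (f i) (f j)"
      using * 3 assms A.f_less A.f_f A.c_f_same by metis
    then show ?thesis using assms A.f_f by simp
  qed
qed

end

context stabiliser_equations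
begin

interpretation swap: stabiliser_equations n "\<lambda>x. - c x" g f rb ra X
  rewrites "\<And>x. - (- c x) = c x"
  by (rule stabiliser_equations_swap) simp

text \<open>\<open>lower_step\<close> and its swapped version move a nonzero entry back and forth
  between the two triangles, along \<open>g\<close> and then \<open>f\<close>, never meeting a fixed
  point.\<close>

lemma off_diagonal_zero_upper:
  assumes "i < n" "j < n" "c i < c j"
  shows "X i j = 0"
proof -
  define S where "S = {i. \<exists>j. i < n \<and> j < n \<and> c i < c j \<and> X i j \<noteq> 0}"
  have "S = {}"
  proof (rule no_endless_walk)
    show "S \<subseteq> {..<n}" by (auto simp: S_def)
    fix i assume "i \<in> S"
    then obtain j where j: "i < n" "j < n" "c i < c j" "X i j \<noteq> 0" by (auto simp: S_def)
    with swap.lower_step[of i j] have 1: "X (g i) (g j) \<noteq> 0" "c (g j) < c (g i)" "g i \<noteq> i" by auto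
    moreover note lt = B.f_less[OF j(1)] B.f_less[OF j(2)]
    ultimately show "g i \<noteq> i \<and> f (g i) \<noteq> g i \<and> f (g i) \<in> S"
      using lower_step[of "g i" "g j"] A.f_less by (auto simp: S_def)
  qed
  then show ?thesis using assms by (auto simp: S_def)
qed

end

context stabiliser_equations
begin

interpretation swap: stabiliser_equations n "\<lambda>x. - c x" g f rb ra X
  by (rule stabiliser_equations_swap)

lemma off_diagonal_zero: "i < n \<Longrightarrow> j < n \<Longrightarrow> c i \<noteq> c j \<Longrightarrow> X i j = 0"
  using off_diagonal_zero_upper[of i j] swap.off_diagonal_zero_upper[of i j] by force

lemma diagonal_invariant:
  "i < n \<Longrightarrow> j < n \<Longrightarrow> c i = c j \<Longrightarrow> X (f i) (f j) = X i j"
  "i < n \<Longrightarrow> j < n \<Longrightarrow> c i = c j \<Longrightarrow> X (g i) (g j) = X i j"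
  using diag_step[of i j] swap.diag_step[of i j] by simp_all

end

text \<open>For a block matrix each \<open>a_term\<close> is zero by itself: its two summands cancel
  if \<open>f q\<close> and \<open>p\<close> have equal positions, and both vanish
  otherwise.\<close>

lemma (in fat_meander) stabiliser_equationsI:
  assumes "\<And>i j. i < n \<Longrightarrow> j < n \<Longrightarrow> c i \<noteq> c j \<Longrightarrow> X i j = 0"
    and "\<And>i j. i < n \<Longrightarrow> j < n \<Longrightarrow> c i = c j \<Longrightarrow> X (f i) (f j) = X i j"
    and "\<And>i j. i < n \<Longrightarrow> j < n \<Longrightarrow> c i = c j \<Longrightarrow> X (g i) (g j) = X i j"
  shows "stabiliser_equations n c f g ra rb X"
proof
  show "X i j = 0" if "i < n" "j < n" "\<not> rel i j" for i j
    using that assms(1) by (auto simp: rel_def)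
  have z: "a_term d h X p q = 0" if pq: "p < n" "q < n" and R: "reflection_blocks n d h r"
    and d: "\<And>i j. d i = d j \<longleftrightarrow> c i = c j"
    and inv: "\<And>i j. i < n \<Longrightarrow> j < n \<Longrightarrow> c i = c j \<Longrightarrow> X (h i) (h j) = X i j" for p q d h r
  proof -
    interpret H: reflection_blocks n d h r by fact
    show ?thesis
    proof (cases "d (h q) = d p")
      case True
      then have "d q = d (h p)" using H.c_f_same[of "h q" p] H.f_f H.f_less pq by metis
      moreover have "X (h q) p = X q (h p)"
        using inv[of "h q" p] pq H.f_less H.f_f True d by metis
      ultimately show ?thesis using True by (simp add: a_term_def)
    next
      case False
      then have "d q \<noteq> d (h p)" using H.c_f_same[of q "h p"] H.f_f H.f_less pq by metis
      with False show ?thesis using assms(1) H.f_less pq d by (simp add: a_term_def)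
    qed
  qed
  show "a_term c f X p q + a_term (\<lambda>x. - c x) g X p q = 0" if "p < n" "q < n" for p q
    using z[OF that A.reflection_blocks_axioms] assms(2)
      z[OF that reflection_blocks_uminus[OF B.reflection_blocks_axioms]] assms(3) by simp
qed

section \<open>Blocks and their reflections\<close>

lemma block_start_Suc: "k < length as \<Longrightarrow> block_start as (Suc k) = block_start as k + as ! k"
  by (simp add: block_start_def take_Suc_conv_app_nth)

lemma block_start_mono: "k \<le> l \<Longrightarrow> block_start as k \<le> block_start as l"
proof -
  assume "k \<le> l"
  then have "take l as = take k as @ take (l - k) (drop k as)"
    by (metis le_add_diff_inverse take_add)
  then show ?thesis by (simp add: block_start_def)
qed

lemma block_unique:
  assumes "k < length as" "l < length as" "x \<in> block as k" "x \<in> block as l"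
  shows "k = l"
proof (rule ccontr)
  have *: False if "k < l" "k < length as" "x \<in> block as k" "x \<in> block as l" for k l
    using that block_start_mono[of "Suc k" l as] block_start_Suc[of k as] by (auto simp: block_def)
  assume "k \<noteq> l"
  then show False using * assms by (metis linorder_neqE_nat)
qed

lemma block_exists: "x < sum_list as \<Longrightarrow> \<exists>k < length as. x \<in> block as k"
proof -
  assume "x < sum_list as"
  then have ex: "x < block_start as (length as)" by (simp add: block_start_def)
  define m where "m = (LEAST k. x < block_start as k)"
  have m: "x < block_start as m" unfolding m_def using ex by (rule LeastI)
  have "m \<le> length as" unfolding m_def using ex by (rule Least_le)
  moreover have "m \<noteq> 0" using m by (auto simp: block_start_def intro: Nat.gr0I)
  moreover have "\<not> x < block_start as (m - 1)"
    using \<open>m \<noteq> 0\<close> not_less_Least[of "m - 1" "\<lambda>k. x < block_start as k"] by (simp add: m_def)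
  ultimately show ?thesis
    using m block_start_Suc[of "m - 1" as] by (intro exI[of _ "m - 1"]) (auto simp: block_def)
qed

lemma block_less:
  assumes "k < length as" "x \<in> block as k"
  shows "x < sum_list as"
proof -
  have "block_start as (Suc k) \<le> block_start as (length as)"
    using assms(1) by (intro block_start_mono) simp
  also have "\<dots> = sum_list as" by (simp add: block_start_def)
  finally show ?thesis using block_start_Suc[OF assms(1)] assms(2) by (simp add: block_def)
qed

text \<open>With vertices numbered from 0, the two ends of a block add up to twice its start plus
  its length minus 1; moving the 1 to the left avoids subtraction on \<open>nat\<close>.\<close>

definition reflect :: "nat list \<Rightarrow> nat \<Rightarrow> nat" where
  "reflect as x = (THE y. \<exists>l < length as. x \<in> block as l \<and> x + y + 1 = 2 * block_start as l + as ! l)"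

lemma reflect_eq:
  assumes "k < length as" "x \<in> block as k"
  shows "x + reflect as x + 1 = 2 * block_start as k + as ! k" "reflect as x \<in> block as k"
proof -
  have "reflect as x = 2 * block_start as k + as ! k - 1 - x"
    unfolding reflect_def
  proof (rule the_equality)
    show "\<exists>l<length as. x \<in> block as l \<and>
      x + (2 * block_start as k + as ! k - 1 - x) + 1 = 2 * block_start as l + as ! l"
      using assms by (intro exI[of _ k]) (auto simp: block_def)
  next
    fix y assume "\<exists>l<length as. x \<in> block as l \<and> x + y + 1 = 2 * block_start as l + as ! l"
    then show "y = 2 * block_start as k + as ! k - 1 - x"
      using block_unique[OF assms(1)] assms by fastforce
  qed
  then show "x + reflect as x + 1 = 2 * block_start as k + as ! k" "reflect as x \<in> block as k"
    using assms by (auto simp: block_def)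
qed

lemma reflection_blocks_reflect:
  assumes "composition n as"
  shows "reflection_blocks n int (reflect as) (same_block as)"
proof -
  have ex: "\<exists>k < length as. x \<in> block as k" if "x < n" for x
    using that assms block_exists by (auto simp: composition_def)
  have less: "x < n" if "k < length as" "x \<in> block as k" for x k
    using that assms block_less by (auto simp: composition_def)
  show ?thesis
  proof (unfold_locales, goal_cases)
    case (1 x) then show ?case using ex reflect_eq less by blast
  next
    case (2 x)
    then obtain k where k: "k < length as" "x \<in> block as k" using ex by blast
    with reflect_eq[OF k] reflect_eq(1)[of k as "reflect as x"] show ?case by simp
  next
    case (3 x) then show ?case using ex reflect_eq unfolding same_block_def by blast
  next
    case (4 x) then show ?case using ex unfolding same_block_def by blast
  next
    case (5 x y) then show ?case unfolding same_block_def by blast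
  next
    case (6 x y z) then show ?case unfolding same_block_def using block_unique by blast
  next
    case (7 x y)
    then obtain k where k: "k < length as" "x \<in> block as k" "y \<in> block as k"
      unfolding same_block_def by blast
    then show ?case using reflect_eq(1)[of k as x] reflect_eq(1)[of k as y] by simp
  next
    case (8 x) then show ?case by simp
  next
    case (9 x y z)
    then obtain k where k: "k < length as" "x \<in> block as k" "z \<in> block as k"
      unfolding same_block_def by blast
    then have "y \<in> block as k" using 9 by (auto simp: block_def)
    then show ?case using k unfolding same_block_def by blast
  qed
qed

lemma arcs_eq:
  assumes "composition n as"
  shows "arcs as = {{x, reflect as x} | x. x < n \<and> reflect as x \<noteq> x}"
proof (rule equalityI; rule subsetI)
  fix e assume "e \<in> arcs as"
  then obtain k i where k: "k < length as" "2 * i + 1 < as ! k"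
    and e: "e = {block_start as k + i, block_start as k + (as ! k - 1 - i)}"
    by (auto simp: arcs_def)
  let ?x = "block_start as k + i"
  have x: "?x \<in> block as k" using k by (auto simp: block_def)
  then have "?x + reflect as ?x + 1 = 2 * block_start as k + as ! k" using reflect_eq k by blast
  then have r: "reflect as ?x = block_start as k + (as ! k - 1 - i)" using k by simp
  moreover have "?x < n" using block_less[OF k(1) x] assms by (simp add: composition_def)
  ultimately show "e \<in> {{x, reflect as x} | x. x < n \<and> reflect as x \<noteq> x}"
    using e k by (intro CollectI exI[of _ ?x]) auto
next
  interpret reflection_blocks n int "reflect as" "same_block as"
    by (rule reflection_blocks_reflect[OF assms])
  have *: "{x, reflect as x} \<in> arcs as" if lt: "x < n" "x < reflect as x" for x
  proof -
    obtain k where k: "k < length as" "x \<in> block as k"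
      using lt assms block_exists[of x as] by (auto simp: composition_def)
    let ?i = "x - block_start as k"
    have "2 * ?i + 1 < as ! k" "x = block_start as k + ?i"
      "reflect as x = block_start as k + (as ! k - 1 - ?i)"
      using reflect_eq(1)[OF k] k lt by (auto simp: block_def)
    from this(1) arg_cong2[where f = "\<lambda>a b. {a, b}", OF this(2,3)] show ?thesis
      using k(1) unfolding arcs_def by blast
  qed
  fix e assume "e \<in> {{x, reflect as x} | x. x < n \<and> reflect as x \<noteq> x}"
  then obtain x where x: "x < n" "reflect as x \<noteq> x" "e = {x, reflect as x}" by blast
  show "e \<in> arcs as"
  proof (cases "x < reflect as x")
    case True
    then show ?thesis using * x by simp
  next
    case False
    then have "{reflect as x, reflect as (reflect as x)} \<in> arcs as"
      using * x f_f f_less by (metis linorder_neqE_nat)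
    then show ?thesis using x f_f by (simp add: insert_commute)
  qed
qed

section \<open>Parity of sets that a reflection pairs up\<close>

lemma even_card_involution:
  assumes "finite S" "\<And>x. x \<in> S \<Longrightarrow> h x \<in> S" "\<And>x. x \<in> S \<Longrightarrow> h (h x) = x" "\<And>x. x \<in> S \<Longrightarrow> h x \<noteq> x"
  shows "even (card S)"
  using assms
proof (induction "card S" arbitrary: S rule: less_induct)
  case less
  show ?case
  proof (cases "S = {}")
    case False
    then obtain x where x: "x \<in> S" by blast
    let ?T = "S - {x, h x}"
    have sub: "{x, h x} \<subseteq> S" using x less.prems by simp
    have "card {x, h x} = 2" using less.prems(4)[OF x] by (simp add: eq_commute)
    then have c: "card S = card ?T + 2"
      using card_Diff_subset[OF _ sub] card_mono[OF less.prems(1) sub] less.prems(1)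
      by simp
    have "even (card ?T)"
    proof (rule less.hyps)
      show "card ?T < card S" using c by simp
      fix y assume y: "y \<in> ?T"
      then have "h y \<noteq> x" "h y \<noteq> h x" using less.prems(3) x by (metis DiffE insertCI)+
      then show "h y \<in> ?T" "h (h y) = y" "h y \<noteq> y" using y less.prems by auto
    qed (use less.prems in auto)
    then show ?thesis using c by simp
  qed simp
qed

context reflection_blocks
begin

text \<open>The points strictly between two mirror-image thresholds are swapped in pairs.\<close>

lemma parity_between:
  assumes "H \<subseteq> {..<n}" "\<And>y. y \<in> H \<Longrightarrow> f y \<in> H" "\<And>y. y \<in> H \<Longrightarrow> f y \<noteq> y" and "x < n"
    and sum: "z + z' = c x + c (f x)"
    and block: "\<And>y. y \<in> H \<Longrightarrow> z < c y \<and> c y < z' \<or> z' < c y \<and> c y < z \<Longrightarrow> r x y"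
    and ne: "\<And>y. y \<in> H \<Longrightarrow> c y \<noteq> z \<and> c y \<noteq> z'"
  shows "even (card {y \<in> H. z < c y}) \<longleftrightarrow> even (card {y \<in> H. z' < c y})"
proof -
  have *: "even (card {y \<in> H. z < c y}) \<longleftrightarrow> even (card {y \<in> H. z' < c y})"
    if "z \<le> z'" and sum: "z + z' = c x + c (f x)"
    and block: "\<And>y. y \<in> H \<Longrightarrow> z < c y \<and> c y < z' \<Longrightarrow> r x y"
    and ne: "\<And>y. y \<in> H \<Longrightarrow> c y \<noteq> z \<and> c y \<noteq> z'" for z z'
  proof -
    have fin: "finite H" using assms(1) finite_subset by auto
    let ?M = "{y \<in> H. z < c y \<and> c y < z'}"
    have "even (card ?M)"
    proof (rule even_card_involution[where h = f])
      fix y assume y: "y \<in> ?M"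
      then have "r x y" "y < n" using block assms(1) by auto
      then have "c (f y) + c y = z + z'" using c_f[of x y] assms(4) sum by simp
      then show "f y \<in> ?M" using y assms(2) by auto
      show "f (f y) = y" "f y \<noteq> y" using y \<open>y < n\<close> f_f assms(3) by auto
    qed (use fin in auto)
    moreover have "{y \<in> H. z < c y} = ?M \<union> {y \<in> H. z' < c y}"
      using that(1) ne by (auto simp: not_less le_less)
    then have "card {y \<in> H. z < c y} = card ?M + card {y \<in> H. z' < c y}"
      using fin by (simp add: card_Un_disjoint disjoint_iff)
    ultimately show ?thesis by simp
  qed
  show ?thesis
  proof (cases "z \<le> z'")
    case True
    then show ?thesis using * sum block ne by blast
  next
    case False
    then have "even (card {y \<in> H. z' < c y}) \<longleftrightarrow> even (card {y \<in> H. z < c y})"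
      using *[of z' z] sum block ne by (simp add: add.commute)
    then show ?thesis by simp
  qed
qed

end

section \<open>Components of the meander graph\<close>

locale meander = A: reflection_blocks n int al ra + B: reflection_blocks n int be rb
  for n al be ra rb
begin

text \<open>Stands for either reflection together with its block relation, so that facts common to
  both compositions are proved once.\<close>

definition refl :: "(nat \<Rightarrow> nat) \<Rightarrow> (nat \<Rightarrow> nat \<Rightarrow> bool) \<Rightarrow> bool" where
  "refl h r \<longleftrightarrow> (h = al \<and> r = ra) \<or> (h = be \<and> r = rb)"

lemma refl_al: "refl al ra" and refl_be: "refl be rb"
  by (auto simp: refl_def)

lemma refl_blocks: "refl h r \<Longrightarrow> reflection_blocks n int h r"
  using A.reflection_blocks_axioms B.reflection_blocks_axioms by (auto simp: refl_def)

definition closed :: "nat set \<Rightarrow> bool" where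
  "closed S \<longleftrightarrow> S \<subseteq> {..<n} \<and> (\<forall>x\<in>S. al x \<in> S \<and> be x \<in> S)"

text \<open>The component as the smallest stable set: induction along paths is replaced by
  exhibiting a set stable under both reflections, as in \<open>comp_minimal\<close>.\<close>

definition comp :: "nat \<Rightarrow> nat set" where
  "comp x = {y. y < n \<and> (\<forall>S. closed S \<longrightarrow> x \<in> S \<longrightarrow> y \<in> S)}"

lemma comp_self: "x < n \<Longrightarrow> x \<in> comp x"
  by (auto simp: comp_def)

lemma comp_less: "y \<in> comp x \<Longrightarrow> y < n"
  by (auto simp: comp_def)

lemma comp_minimal: "closed S \<Longrightarrow> x \<in> S \<Longrightarrow> comp x \<subseteq> S"
  by (auto simp: comp_def)

lemma closed_comp: "closed (comp x)"
  using A.f_less B.f_less unfolding closed_def comp_def by blast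

lemma closed_refl: "closed S \<Longrightarrow> refl h r \<Longrightarrow> x \<in> S \<Longrightarrow> h x \<in> S"
  by (auto simp: closed_def refl_def)

lemma comp_eq:
  assumes "x < n" "y \<in> comp x"
  shows "comp y = comp x"
proof -
  have "x \<in> comp y"
  proof (rule ccontr)
    assume "x \<notin> comp y"
    then obtain S where S: "closed S" "y \<in> S" "x \<notin> S" using assms by (auto simp: comp_def)
    \<comment> \<open>Reflections are involutions, so the complement of a stable set is stable; this
      makes membership in components symmetric.\<close>
    have "al z \<notin> S \<and> be z \<notin> S" if "z < n" "z \<notin> S" for z
      using S(1) that A.f_f[of z] B.f_f[of z] unfolding closed_def by metis
    then have "closed ({..<n} - S)" unfolding closed_def using A.f_less B.f_less by auto
    then have "comp x \<subseteq> {..<n} - S" using comp_minimal S assms by blast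
    then show False using S assms by blast
  qed
  then show ?thesis using assms comp_minimal closed_comp by (metis subset_antisym)
qed

definition comps :: "nat set set" where "comps = comp ` {..<n}"

lemma comps_comp: "Y \<in> comps \<Longrightarrow> y \<in> Y \<Longrightarrow> Y = comp y \<and> y < n"
  using comp_less comp_eq unfolding comps_def by blast

lemma comps_closed: "Y \<in> comps \<Longrightarrow> closed Y"
  using closed_comp by (auto simp: comps_def)

lemma comps_finite: "Y \<in> comps \<Longrightarrow> finite Y"
  using comps_closed[of Y] finite_subset[of Y "{..<n}"] by (simp add: closed_def)

lemma comps_nonempty: "Y \<in> comps \<Longrightarrow> Y \<noteq> {}"
  using comp_self by (auto simp: comps_def)

lemma comps_disjoint: "Y \<in> comps \<Longrightarrow> Z \<in> comps \<Longrightarrow> x \<in> Y \<Longrightarrow> x \<in> Z \<Longrightarrow> Y = Z"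
  using comps_comp by metis

text \<open>A reflection fixes a vertex exactly when no edge of its kind ends there, so these
  components have degree 2 everywhere. \<open>cycles_eq\<close> confirms that they are the cycles of
  the graph.\<close>

definition cyc :: "nat set \<Rightarrow> bool" where
  "cyc Y \<longleftrightarrow> Y \<in> comps \<and> (\<forall>y\<in>Y. al y \<noteq> y \<and> be y \<noteq> y)"

lemma cycD:
  assumes "cyc Y"
  shows "Y \<in> comps" "finite Y" "Y \<subseteq> {..<n}"
    "refl h r \<Longrightarrow> y \<in> Y \<Longrightarrow> h y \<in> Y" "refl h r \<Longrightarrow> y \<in> Y \<Longrightarrow> h y \<noteq> y"
    "refl h r \<Longrightarrow> y \<in> Y \<Longrightarrow> h (h y) = y"
proof -
  show *: "Y \<in> comps" using assms by (simp add: cyc_def)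
  show "finite Y" "Y \<subseteq> {..<n}"
    using comps_finite[OF *] comps_closed[OF *] by (simp_all add: closed_def)
  show "refl h r \<Longrightarrow> y \<in> Y \<Longrightarrow> h y \<in> Y" using closed_refl comps_closed * by blast
  show "refl h r \<Longrightarrow> y \<in> Y \<Longrightarrow> h y \<noteq> y" using assms unfolding cyc_def refl_def by blast
  show "refl h r \<Longrightarrow> y \<in> Y \<Longrightarrow> h (h y) = y"
    using \<open>Y \<subseteq> {..<n}\<close> A.f_f[of y] B.f_f[of y] unfolding refl_def by blast
qed

lemma cyc_even: "cyc Y \<Longrightarrow> even (card Y)"
proof -
  assume c: "cyc Y"
  show ?thesis
    by (rule even_card_involution[of Y al]) (simp_all add: cycD(2)[OF c] cycD(4-6)[OF c refl_al])
qed

section \<open>Vertices surrounded by a cycle\<close>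

definition above :: "nat set \<Rightarrow> nat \<Rightarrow> nat" where
  "above Y x = card {y \<in> Y. x < y}"

text \<open>For vertices \<open>y_1 > y_2 > ...\<close> a point lies between some
  \<open>y_2i\<close> and \<open>y_(2i-1)\<close> exactly when an odd number of them is above
  it.\<close>

definition inside :: "nat set \<Rightarrow> nat \<Rightarrow> bool" where
  "inside Y x \<longleftrightarrow> x \<notin> Y \<and> odd (above Y x)"

lemma refl_convex:
  assumes "refl h r" "x < n" "y < n" "x \<le> y \<and> y \<le> h x \<or> h x \<le> y \<and> y \<le> x"
  shows "r x y"
proof -
  interpret reflection_blocks n int h r by (rule refl_blocks) fact
  note h = f_less[OF assms(2)] r_f[OF assms(2)]
  from assms(4) show ?thesis
  proof
    assume "x \<le> y \<and> y \<le> h x"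
    then show ?thesis using r_convex[of x y "h x"] h assms(2,3) by simp
  next
    assume "h x \<le> y \<and> y \<le> x"
    then have "r (h x) y" using r_convex[of "h x" y x] r_sym[of x "h x"] h assms(2,3) by simp
    then show ?thesis using r_trans[of x "h x" y] h assms(2,3) by blast
  qed
qed

text \<open>All vertices of \<open>Y\<close> strictly between \<open>x\<close> and
  \<open>h x\<close> lie in the block of \<open>x\<close> and are paired up by \<open>h\<close>, so
  the numbers above \<open>x\<close> and above \<open>h x\<close> have the same parity.\<close>

lemma inside_refl:
  assumes "cyc Y" "refl h r" "x < n"
  shows "inside Y (h x) \<longleftrightarrow> inside Y x"
proof -
  interpret reflection_blocks n int h r by (rule refl_blocks) fact
  note Y = cycD[OF assms(1)]
  have mem: "h x \<in> Y \<longleftrightarrow> x \<in> Y" using Y(4)[OF assms(2)] f_f[of x] assms(3) by metis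
  show ?thesis
  proof (cases "x \<in> Y")
    case False
    have "even (card {y \<in> Y. int x < int y}) \<longleftrightarrow> even (card {y \<in> Y. int (h x) < int y})"
    proof (rule parity_between[of Y x])
      show "r x y" if "y \<in> Y" "int x < int y \<and> int y < int (h x) \<or> int (h x) < int y \<and> int y < int x" for y
        using refl_convex[OF assms(2,3), of y] that Y(3) by auto
      show "int y \<noteq> int x \<and> int y \<noteq> int (h x)" if "y \<in> Y" for y
        using that False mem by auto
    qed (use Y assms in auto)
    then show ?thesis using mem by (simp add: inside_def above_def)
  qed (use mem in \<open>simp add: inside_def\<close>)
qed

lemma inside_comp:
  assumes "cyc Y" "x < n" "y \<in> comp x"
  shows "inside Y y \<longleftrightarrow> inside Y x"
proof -
  let ?S = "{z. z < n \<and> (inside Y z \<longleftrightarrow> inside Y x)}"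
  have "closed ?S"
    using inside_refl[OF assms(1) refl_al] inside_refl[OF assms(1) refl_be] A.f_less B.f_less
    unfolding closed_def by auto
  then have "comp x \<subseteq> ?S" using assms by (intro comp_minimal) auto
  then show ?thesis using assms by auto
qed

text \<open>An odd number of vertices above \<open>l\<close> singles out the lower ends
  \<open>y_2i\<close>; these are the intervals used for lying inside, with their ends
  included.\<close>

definition is_int :: "nat set \<Rightarrow> nat \<Rightarrow> nat \<Rightarrow> bool" where
  "is_int Y l u \<longleftrightarrow> l \<in> Y \<and> u \<in> Y \<and> l < u \<and> odd (above Y l) \<and> (\<forall>y\<in>Y. \<not> (l < y \<and> y < u))"

lemma above_int:
  assumes "is_int Y l u" "l \<le> z" "z < u"
  shows "above Y z = above Y l"
proof -
  have "z < y \<longleftrightarrow> l < y" if "y \<in> Y" for y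
    using assms that unfolding is_int_def by (meson le_less_trans not_le order_trans less_le_trans)
  then show ?thesis unfolding above_def by (intro arg_cong[where f = card] Collect_cong) blast
qed

lemma above_upper:
  assumes "finite Y" "is_int Y l u"
  shows "above Y l = Suc (above Y u)"
proof -
  have "{y \<in> Y. l < y} = insert u {y \<in> Y. u < y}"
    using assms(2) by (auto simp: is_int_def)
  then show ?thesis using assms(1) by (simp add: above_def)
qed

text \<open>Different intervals with a common point would have to share an end, but the numbers of
  vertices above a lower and above an upper end differ in parity.\<close>

lemma int_unique:
  assumes "finite Y" "is_int Y l u" "is_int Y l' u'" "l \<le> x" "x \<le> u" "l' \<le> x" "x \<le> u'"
  shows "l = l' \<and> u = u'"
proof -
  have *: "\<not> l < l'" if "is_int Y l u" "is_int Y l' u'" "l \<le> x" "x \<le> u" "l' \<le> x" for l u l' u'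
  proof
    assume "l < l'"
    then have "l' = u" using that unfolding is_int_def by (metis le_antisym le_trans not_le)
    then show False using above_upper[OF assms(1) that(1)] that by (auto simp: is_int_def)
  qed
  have "l = l'" using *[OF assms(2,3,4,5,6)] *[OF assms(3,2,6,7,4)] by simp
  moreover have "\<not> u < u'" "\<not> u' < u" using assms(2,3) \<open>l = l'\<close> unfolding is_int_def by blast+
  ultimately show ?thesis by simp
qed

lemma int_from_lower:
  assumes "finite Y" "l \<in> Y" "odd (above Y l)"
  shows "\<exists>u. is_int Y l u"
proof -
  let ?S = "{y \<in> Y. l < y}"
  have "?S \<noteq> {}" using assms(3) unfolding above_def by (metis card.empty even_zero)
  moreover have fin: "finite ?S" using assms by simp
  ultimately have "Min ?S \<in> ?S" by (rule Min_in[rotated])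
  moreover have "\<not> (l < y \<and> y < Min ?S)" if "y \<in> Y" for y
    using Min_le[OF fin, of y] that by auto
  ultimately have "is_int Y l (Min ?S)" using assms by (auto simp: is_int_def)
  then show ?thesis by blast
qed

lemma card_split: "finite Y \<Longrightarrow> card Y = card {y \<in> Y. y < x} + card {y \<in> Y. x \<le> (y::nat)}"
proof -
  assume "finite Y"
  moreover have "Y = {y \<in> Y. y < x} \<union> {y \<in> Y. x \<le> y}" by auto
  ultimately show ?thesis
    by (subst \<open>Y = _\<close>, subst card_Un_disjoint) auto
qed

lemma int_exists:
  assumes "cyc Y" "x \<in> Y \<or> inside Y x"
  shows "\<exists>l u. is_int Y l u \<and> l \<le> x \<and> x \<le> u"
proof -
  note Y = cycD[OF assms(1)]
  have pred: "\<exists>l u. is_int Y l u \<and> l \<le> x \<and> x \<le> u"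
    if odd: "odd (card {y \<in> Y. x \<le> y})" for x
  proof -
    let ?S = "{y \<in> Y. y < x}"
    \<comment> \<open>A cycle has an even number of vertices, so an odd number of them at or above
      \<open>x\<close> leaves an odd, hence nonzero, number below \<open>x\<close>.\<close>
    have "?S \<noteq> {}" using card_split[OF Y(2), of x] cyc_even[OF assms(1)] odd
      by (metis add.left_neutral card.empty)
    moreover have fin: "finite ?S" using Y by simp
    ultimately have m: "Max ?S \<in> ?S" by (rule Max_in[rotated])
    let ?l = "Max ?S"
    have ge: "x \<le> y" if "y \<in> Y" "?l < y" for y
      using Max_ge[OF fin, of y] that by (metis (mono_tags, lifting) mem_Collect_eq not_le)
    then have "{y \<in> Y. ?l < y} = {y \<in> Y. x \<le> y}" using m by auto
    then have "odd (above Y ?l)" using odd by (simp add: above_def)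
    with int_from_lower[OF Y(2)] m obtain u where u: "is_int Y ?l u" by blast
    then have "x \<le> u" using ge by (auto simp: is_int_def)
    then show ?thesis using u m by (metis (mono_tags, lifting) mem_Collect_eq less_imp_le)
  qed
  show ?thesis
  proof (cases "x \<in> Y")
    case True
    then have "{y \<in> Y. x \<le> y} = insert x {y \<in> Y. x < y}" by auto
    then have "card {y \<in> Y. x \<le> y} = Suc (above Y x)" using Y by (simp add: above_def)
    show ?thesis
    proof (cases "odd (above Y x)")
      case odd: True
      then obtain u where "is_int Y x u" using int_from_lower[OF Y(2) True] by blast
      then show ?thesis using less_imp_le unfolding is_int_def by blast
    next
      case False
      then show ?thesis using pred[of x] \<open>card _ = _\<close> by simp
    qed
  next
    case False
    then have "{y \<in> Y. x \<le> y} = {y \<in> Y. x < y}" by (auto simp: le_less)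
    then show ?thesis using pred[of x] assms(2) False by (simp add: inside_def above_def)
  qed
qed

lemma int_inside: "is_int Y l u \<Longrightarrow> l \<le> x \<Longrightarrow> x \<le> u \<Longrightarrow> x \<in> Y \<or> inside Y x"
  using above_int[of Y l u x] unfolding inside_def is_int_def by (cases "x = u") auto

text \<open>If a block ended between \<open>l\<close> and \<open>u\<close>, then \<open>h\<close>
  would map the vertices of \<open>Y\<close> above \<open>l\<close> among themselves, and their
  number would be even.\<close>

lemma int_same_block:
  assumes "cyc Y" "refl h r" "is_int Y l u"
  shows "r l u"
proof (rule ccontr)
  assume *: "\<not> r l u"
  interpret reflection_blocks n int h r by (rule refl_blocks) fact
  note Y = cycD[OF assms(1)]
  note lu = assms(3)[unfolded is_int_def]
  have lt: "l < n" "u < n" using lu Y by auto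
  have not_r: "\<not> r l y" if "y \<in> Y" "l < y" for y
  proof
    assume "r l y"
    have "u \<le> y" using lu that by (metis not_le)
    then have "r l u" using r_convex[of l u y] \<open>r l y\<close> lt that lu Y by auto
    then show False using * by blast
  qed
  have "even (card {y \<in> Y. l < y})"
  proof (rule even_card_involution[where h = h])
    fix y assume y: "y \<in> {y \<in> Y. l < y}"
    then have "y < n" "h y \<in> Y" using Y(3) Y(4)[OF assms(2)] by auto
    have "l < h y"
    proof (rule ccontr)
      assume "\<not> l < h y"
      then have "r y l" using refl_convex[OF assms(2) \<open>y < n\<close> lt(1)] y by auto
      then have "r l y" using r_sym[of y l] lt \<open>y < n\<close> by blast
      then show False using not_r[of y] y by blast
    qed
    then show "h y \<in> {y \<in> Y. l < y}" "h (h y) = y" "h y \<noteq> y"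
      using y \<open>h y \<in> Y\<close> Y(5,6)[OF assms(2)] by auto
  qed (use Y in auto)
  then show False using lu by (simp add: above_def)
qed

text \<open>Doubled positions make room for thresholds strictly between vertices, such as
  \<open>2 * l + 1\<close> and \<open>2 * h l - 1\<close> in \<open>int_refl\<close>.\<close>

lemma reflection_blocks_double:
  "reflection_blocks n int h r \<Longrightarrow> reflection_blocks n (\<lambda>x. 2 * int x) h r"
proof -
  assume "reflection_blocks n int h r"
  then interpret reflection_blocks n int h r .
  show ?thesis
  proof (unfold_locales, goal_cases)
    case (7 x y) then show ?case using c_f[of x y] by simp
  next
    case (9 x y z) then show ?case using r_convex[of x y z] by simp
  qed (simp_all add: f_less f_f r_f r_refl f_fixed, (metis r_sym), (metis r_trans))
qed

text \<open>No vertex of \<open>Y\<close> lies strictly between \<open>h u\<close> and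
  \<open>h l\<close>, since its mirror image would lie between \<open>l\<close> and
  \<open>u\<close>. The thresholds just above \<open>l\<close> and just below \<open>h l\<close> are
  mirror images, so the parity count makes \<open>h u\<close> a lower end too.\<close>

lemma int_refl:
  assumes "cyc Y" "refl h r" "is_int Y l u"
  shows "is_int Y (h u) (h l)"
proof -
  interpret reflection_blocks n int h r by (rule refl_blocks) fact
  interpret D: reflection_blocks n "\<lambda>x. 2 * int x" h r
    using reflection_blocks_double[OF reflection_blocks_axioms] .
  note Y = cycD[OF assms(1)] and YR = cycD(4-6)[OF assms(1,2)]
  note lu = assms(3)[unfolded is_int_def]
  have lt: "l < n" "u < n" "h l < n" "h u < n" using lu Y f_less by auto
  have r: "r l u" using int_same_block assms by blast
  have sum: "int (h l) + int l = int (h u) + int u" using c_f[of l u] lt r by auto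
  have none: "\<not> (h u < y \<and> y < h l)" if "y \<in> Y" for y
  proof
    assume y: "h u < y \<and> y < h l"
    have yn: "y < n" using that Y by auto
    have "r (h u) (h l)" using r_f[of u] r_f[of l] r r_sym r_trans lt by meson
    then have "r (h u) y" using r_convex[of "h u" y "h l"] y lt yn by auto
    then have "r u y" using r_f[of u] r_trans lt yn by meson
    then have "r l y" using r r_trans lt yn by meson
    then have "int (h y) + int y = int (h l) + int l" using c_f[of y l] r_sym lt yn by metis
    then have "l < h y \<and> h y < u" using y sum by linarith
    then show False using lu YR(1)[OF that] by blast
  qed
  have less: "h u < h l" using sum lu by linarith
  have "even (card {y \<in> Y. 2 * int l + 1 < 2 * int y}) \<longleftrightarrow>
      even (card {y \<in> Y. 2 * int (h l) - 1 < 2 * int y})"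
  proof (rule D.parity_between[of Y l])
    fix y assume y: "y \<in> Y"
      "2 * int l + 1 < 2 * int y \<and> 2 * int y < 2 * int (h l) - 1 \<or>
       2 * int (h l) - 1 < 2 * int y \<and> 2 * int y < 2 * int l + 1"
    then show "r l y" using refl_convex[OF assms(2) lt(1), of y] Y(3) by auto
  next
    fix y :: nat show "2 * int y \<noteq> 2 * int l + 1 \<and> 2 * int y \<noteq> 2 * int (h l) - 1" by presburger
  qed (use Y YR lt in auto)
  moreover have "{y \<in> Y. 2 * int l + 1 < 2 * int y} = {y \<in> Y. l < y}" by auto
  moreover have "{y \<in> Y. 2 * int (h l) - 1 < 2 * int y} = {y \<in> Y. h u < y}"
  proof (rule Collect_cong, rule conj_cong[OF HOL.refl])
    fix y assume "y \<in> Y"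
    then show "(2 * int (h l) - 1 < 2 * int y) = (h u < y)"
      using none[of y] less by auto
  qed
  ultimately have "odd (above Y (h u))" using lu by (simp add: above_def)
  then show ?thesis using lu YR less none by (auto simp: is_int_def)
qed

section \<open>Maximal components and the vertices they own\<close>

definition maximal :: "nat set \<Rightarrow> bool" where
  "maximal Y \<longleftrightarrow> Y \<in> comps \<and> (\<forall>Z. cyc Z \<longrightarrow> \<not> inside Z (Max Y))"

definition owns :: "nat set \<Rightarrow> nat \<Rightarrow> bool" where
  "owns Y x \<longleftrightarrow> maximal Y \<and> (x \<in> Y \<or> cyc Y \<and> inside Y x)"

lemma inside_less_Max: "cyc Y \<Longrightarrow> inside Y x \<Longrightarrow> x < Max Y"
proof -
  assume *: "cyc Y" "inside Y x"
  then obtain l u where "is_int Y l u" "x \<le> u" using int_exists by blast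
  then have "x \<le> u" "u \<in> Y" "x \<notin> Y" using * by (auto simp: is_int_def inside_def)
  then show ?thesis using Max_ge[of Y u] cycD(2)[OF *(1)] by (metis le_less_trans linorder_neqE_nat not_le)
qed

lemma Max_comps: "Y \<in> comps \<Longrightarrow> Max Y \<in> Y"
  using comps_finite comps_nonempty by simp

lemma inside_all:
  assumes "cyc Z" "Y \<in> comps" "x \<in> Y" "y \<in> Y"
  shows "inside Z x \<longleftrightarrow> inside Z y"
  using inside_comp[OF assms(1), of y x] comps_comp[OF assms(2)] assms(3,4) by blast

text \<open>If \<open>Z\<close> is not inside \<open>Y\<close>, then no vertex of \<open>Z\<close> lies within an interval of \<open>Y\<close>, so \<open>Z\<close>
  surrounds either the whole interval or no point of it.\<close>

lemma owner_exists:
  assumes "x < n"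
  shows "\<exists>Y. owns Y x"
proof (cases "maximal (comp x)")
  case True
  then show ?thesis using comp_self assms by (auto simp: owns_def)
next
  case False
  let ?X = "comp x"
  have X: "?X \<in> comps" using assms by (auto simp: comps_def)
  let ?m = "Max ?X"
  let ?C = "{Y. cyc Y \<and> inside Y ?m}"
  have "?C \<subseteq> comps" by (auto simp: cyc_def)
  then have "finite ?C" by (rule finite_subset) (simp add: comps_def)
  moreover have "?C \<noteq> {}" using False X by (auto simp: maximal_def)
  ultimately have "Max (Max ` ?C) \<in> Max ` ?C" by (intro Max_in) auto
  \<comment> \<open>Among the cycles around the component, one with the greatest top vertex is
    maximal: a cycle around it would have a greater top vertex and would surround the component as
    well.\<close>
  then obtain Y where Y: "cyc Y" "inside Y ?m" "Max Y = Max (Max ` ?C)" by auto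
  have best: "Max Z \<le> Max Y" if "cyc Z" "inside Z ?m" for Z
    unfolding Y(3) using that \<open>finite ?C\<close> by (intro Max_ge) auto
  have "maximal Y"
  proof (rule ccontr)
    assume "\<not> maximal Y"
    then obtain Z where Z: "cyc Z" "inside Z (Max Y)" using Y by (auto simp: maximal_def cyc_def)
    then have lt: "Max Y < Max Z" using inside_less_Max by blast
    obtain l u where lu: "is_int Y l u" "l \<le> ?m" "?m \<le> u" using int_exists Y by blast
    have "\<not> inside Y (Max Z)" using inside_less_Max[OF Y(1)] lt by fastforce
    then have out: "\<not> inside Y z" if "z \<in> Z" for z
      using that inside_all[OF Y(1) cycD(1)[OF Z(1)]] Max_comps[OF cycD(1)[OF Z(1)]] by blast
    have "u \<in> Y" using lu by (simp add: is_int_def)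
    then have insZ: "inside Z u" using Z(2) inside_all[OF Z(1) cycD(1)[OF Y(1)]]
        Max_comps[OF cycD(1)[OF Y(1)]] by blast
    have disj: "z \<notin> Y" if "z \<in> Z" for z
      using comps_disjoint[OF cycD(1)[OF Y(1)] cycD(1)[OF Z(1)]] that insZ lu
      by (auto simp: is_int_def inside_def)
    have none: "\<not> (l \<le> z \<and> z \<le> u)" if "z \<in> Z" for z
      using int_inside[OF lu(1)] out disj that by blast
    have "{z \<in> Z. ?m < z} = {z \<in> Z. u < z}"
      using none lu by (metis (mono_tags, lifting) le_less_trans less_imp_le not_le le_trans)
    then have "inside Z ?m" using insZ none[of ?m] lu by (auto simp: inside_def above_def)
    then show False using best Z lt by fastforce
  qed
  moreover have "inside Y x"
    using inside_all[OF Y(1) X, of ?m x] Max_comps[OF X] comp_self assms Y by blast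
  ultimately show ?thesis using Y by (auto simp: owns_def)
qed

text \<open>A vertex of a maximal component lies inside no cycle. Two cycles that both surround
  \<open>x\<close> have intervals overlapping at \<open>x\<close>, so the lower end of one lies in
  the interval of the other, which puts one cycle inside the other.\<close>

lemma owner_unique:
  assumes "owns Y x" "owns Z x"
  shows "Y = Z"
proof -
  have *: "\<not> (inside Z x \<and> cyc Z)" if "x \<in> Y" "maximal Y" for Y Z
    using that inside_all[of Z Y x "Max Y"] Max_comps by (auto simp: maximal_def)
  show ?thesis
  proof (cases "x \<in> Y \<or> x \<in> Z")
    case True
    then have "x \<in> Y \<and> x \<in> Z" using * assms by (auto simp: owns_def)
    then show ?thesis using comps_disjoint assms by (auto simp: owns_def maximal_def)
  next
    case False
    then have Y: "cyc Y" "inside Y x" "maximal Y" and Z: "cyc Z" "inside Z x" "maximal Z"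
      using assms by (auto simp: owns_def)
    have out: "\<not> inside Y z" if "z \<in> Z" "maximal Z" "cyc Y" for z Y Z
      using that inside_all[of Y Z z "Max Z"] Max_comps by (auto simp: maximal_def)
    obtain l u where lu: "is_int Y l u" "l \<le> x" "x \<le> u" using int_exists Y by blast
    obtain l' u' where lu': "is_int Z l' u'" "l' \<le> x" "x \<le> u'" using int_exists Z by blast
    show ?thesis
    proof (rule ccontr)
      assume "Y \<noteq> Z"
      then have disj: "z \<notin> Y" if "z \<in> Z" for z using comps_disjoint that Y Z by (auto simp: maximal_def)
      have "\<not> (l \<le> l' \<and> l' \<le> u)"
        using int_inside[OF lu(1)] out[of l' Z Y] disj[of l'] lu' Y Z by (auto simp: is_int_def)
      then have "l' < l" using lu lu' by auto
      moreover have "\<not> (l' \<le> l \<and> l \<le> u')"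
        using int_inside[OF lu'(1)] out[of l Y Z] disj[of l] lu Y Z by (auto simp: is_int_def)
      ultimately show False using lu lu' by auto
    qed
  qed
qed

section \<open>Fat intervals\<close>

definition owner :: "nat \<Rightarrow> nat set" where "owner x = (THE Y. owns Y x)"

lemma owner_owns: "x < n \<Longrightarrow> owns (owner x) x"
  unfolding owner_def using theI'[of "\<lambda>Y. owns Y x"] owner_exists owner_unique by blast

lemma owner_eqI: "owns Y x \<Longrightarrow> owner x = Y"
  unfolding owner_def by (rule the_equality) (use owner_unique in blast)+

lemma owner_comps: "x < n \<Longrightarrow> owner x \<in> comps"
  using owner_owns by (simp add: owns_def maximal_def)

text \<open>Vertices owned by a segment form intervals of a single point, so that cycles and
  segments are treated alike from here on.\<close>

definition lo :: "nat \<Rightarrow> nat" where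
  "lo x = (if cyc (owner x) then THE l. \<exists>u. is_int (owner x) l u \<and> l \<le> x \<and> x \<le> u else x)"

definition hi :: "nat \<Rightarrow> nat" where
  "hi x = (if cyc (owner x) then THE u. \<exists>l. is_int (owner x) l u \<and> l \<le> x \<and> x \<le> u else x)"

lemma lo_hi_eqI:
  assumes "cyc (owner x)" "is_int (owner x) l u" "l \<le> x" "x \<le> u"
  shows "lo x = l \<and> hi x = u"
proof -
  have "(THE l. \<exists>u. is_int (owner x) l u \<and> l \<le> x \<and> x \<le> u) = l"
    using assms int_unique[OF cycD(2)[OF assms(1)]] by (intro the_equality) blast+
  moreover have "(THE u. \<exists>l. is_int (owner x) l u \<and> l \<le> x \<and> x \<le> u) = u"
    using assms int_unique[OF cycD(2)[OF assms(1)]] by (intro the_equality) blast+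
  ultimately show ?thesis using assms(1) by (simp add: lo_def hi_def)
qed

lemma lo_hi_cyc:
  assumes "x < n" "cyc (owner x)"
  shows "is_int (owner x) (lo x) (hi x)" "lo x \<le> x" "x \<le> hi x"
proof -
  have "x \<in> owner x \<or> inside (owner x) x" using owner_owns[OF assms(1)] by (auto simp: owns_def)
  then obtain l u where lu: "is_int (owner x) l u" "l \<le> x" "x \<le> u"
    using int_exists assms(2) by blast
  with lo_hi_eqI[OF assms(2) lu] show "is_int (owner x) (lo x) (hi x)" "lo x \<le> x" "x \<le> hi x" by auto
qed

lemma lo_hi_not_cyc:
  assumes "x < n" "\<not> cyc (owner x)"
  shows "lo x = x" "hi x = x" "x \<in> owner x"
  using assms owner_owns[OF assms(1)] by (simp_all add: lo_def hi_def owns_def)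

lemma lo_le: "x < n \<Longrightarrow> lo x \<le> x" and le_hi: "x < n \<Longrightarrow> x \<le> hi x"
  using lo_hi_cyc[of x] lo_hi_not_cyc[of x] by (cases "cyc (owner x)"; simp)+

lemma hi_less: "x < n \<Longrightarrow> hi x < n"
  using lo_hi_cyc(1)[of x] lo_hi_not_cyc[of x] cycD(3)[of "owner x"]
  by (cases "cyc (owner x)") (auto simp: is_int_def)

lemma lo_less: "x < n \<Longrightarrow> lo x < n"
  using lo_le[of x] by simp

lemma same_ivl:
  assumes "x < n" "lo x \<le> y" "y \<le> hi x"
  shows "owner y = owner x" "lo y = lo x" "hi y = hi x" "y < n"
proof -
  show "y < n" using hi_less[OF assms(1)] assms(3) by simp
  have "owner y = owner x \<and> lo y = lo x \<and> hi y = hi x"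
  proof (cases "cyc (owner x)")
    case True
    note i = lo_hi_cyc[OF assms(1) True]
    have "owns (owner x) y"
      using int_inside[OF i(1) assms(2,3)] owner_owns[OF assms(1)] True by (auto simp: owns_def)
    then have o: "owner y = owner x" by (rule owner_eqI)
    moreover from this lo_hi_eqI[of y "lo x" "hi x"] have "lo y = lo x \<and> hi y = hi x"
      using True i(1) assms(2,3) by simp
    ultimately show ?thesis by simp
  next
    case False
    then have "y = x" using lo_hi_not_cyc[OF assms(1)] assms by simp
    then show ?thesis by simp
  qed
  then show "owner y = owner x" "lo y = lo x" "hi y = hi x" by auto
qed

lemma owner_refl:
  assumes "refl h r" "x < n"
  shows "owner (h x) = owner x"
proof (rule owner_eqI)
  have "maximal (owner x)" using owner_owns[OF assms(2)] by (simp add: owns_def)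
  moreover have "h x \<in> owner x" if "x \<in> owner x"
    using closed_refl[OF comps_closed[OF owner_comps[OF assms(2)]] assms(1) that] .
  moreover have "inside (owner x) (h x)" if "cyc (owner x)" "inside (owner x) x"
    using inside_refl[OF that(1) assms] that(2) by simp
  ultimately show "owns (owner x) (h x)" using owner_owns[OF assms(2)] by (auto simp: owns_def)
qed

lemma ivl_block:
  assumes "refl h r" "x < n" "lo x \<le> y" "y \<le> hi x"
  shows "r x y" "h y + y = h x + x"
proof -
  interpret reflection_blocks n int h r by (rule refl_blocks) fact
  have *: "r (lo x) y" if "lo x \<le> y" "y \<le> hi x" for y
  proof (cases "cyc (owner x)")
    case True
    then have "r (lo x) (hi x)" using int_same_block[OF True assms(1)] lo_hi_cyc(1)[OF assms(2)] by blast
    then show ?thesis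
      using r_convex[of "lo x" y "hi x"] that hi_less[OF assms(2)] lo_less[OF assms(2)] by simp
  next
    case False
    then show ?thesis using lo_hi_not_cyc[OF assms(2)] that r_refl[OF assms(2)] by simp
  qed
  have y: "y < n" using assms(4) hi_less[OF assms(2)] by simp
  show "r x y"
    using *[OF assms(3,4)] *[OF lo_le[OF assms(2)] le_hi[OF assms(2)]]
      r_sym[of "lo x" x] r_trans[of x "lo x" y] lo_less[OF assms(2)] assms(2) y by blast
  from c_f[OF assms(2) y this] show "h y + y = h x + x" by linarith
qed

lemma ivl_refl:
  assumes "refl h r" "x < n"
  shows "lo (h x) = h (hi x)" "hi (h x) = h (lo x)"
proof -
  have "lo (h x) = h (hi x) \<and> hi (h x) = h (lo x)"
  proof (cases "cyc (owner x)")
    case True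
    note i = lo_hi_cyc[OF assms(2) True] and o = owner_refl[OF assms]
    have "is_int (owner x) (h (hi x)) (h (lo x))" using int_refl[OF True assms(1) i(1)] .
    moreover have "h (hi x) + hi x = h x + x" "h (lo x) + lo x = h x + x"
      by (rule ivl_block(2)[OF assms]; use i(2,3) in linarith)+
    ultimately show ?thesis using lo_hi_eqI[of "h x" "h (hi x)" "h (lo x)"] i(2,3) True o by simp
  next
    case False
    interpret reflection_blocks n int h r by (rule refl_blocks) fact
    show ?thesis using False lo_hi_not_cyc[of x] lo_hi_not_cyc[of "h x"]
        owner_refl[OF assms] f_less[OF assms(2)] assms(2) by simp
  qed
  then show "lo (h x) = h (hi x)" "hi (h x) = h (lo x)" by auto
qed

text \<open>A reflection reverses each interval; the inner flip undoes this, so that intervals are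
  permuted with offsets kept. This is why the attached group repeats the same matrix in each block
  and not alternately its mirror image.\<close>

definition fat :: "(nat \<Rightarrow> nat) \<Rightarrow> nat \<Rightarrow> nat" where "fat h x = h (lo x + hi x - x)"
text \<open>Twice the centre, which itself may be a half-integer.\<close>

definition cen :: "nat \<Rightarrow> int" where "cen x = int (lo x) + int (hi x)"
definition off :: "nat \<Rightarrow> nat" where "off x = x - lo x"

lemma lo_off: "x < n \<Longrightarrow> lo x + off x = x"
  using lo_le by (simp add: off_def)

lemma fat_props:
  assumes "refl h r" "x < n"
  shows "fat h x < n" "owner (fat h x) = owner x" "lo (fat h x) = h (hi x)" "hi (fat h x) = h (lo x)"
    "off (fat h x) = off x" "fat h (fat h x) = x" "r x (fat h x)"
proof -
  interpret reflection_blocks n int h r by (rule refl_blocks) fact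
  let ?y = "lo x + hi x - x"
  have y: "lo x \<le> ?y" "?y \<le> hi x" using lo_le[OF assms(2)] le_hi[OF assms(2)] by auto
  note s = same_ivl[OF assms(2) y]
  have i: "lo (h ?y) = h (hi x)" "hi (h ?y) = h (lo x)" using ivl_refl[OF assms(1) s(4)] s by auto
  show less: "fat h x < n" and "owner (fat h x) = owner x"
    and lo: "lo (fat h x) = h (hi x)" and hi: "hi (fat h x) = h (lo x)"
    using f_less[OF s(4)] owner_refl[OF assms(1) s(4)] s i by (simp_all add: fat_def)
  have e: "h ?y + ?y = h x + x" "h (hi x) + hi x = h x + x" "h (lo x) + lo x = h x + x"
    by (rule ivl_block(2)[OF assms]; use lo_le[OF assms(2)] le_hi[OF assms(2)] y in linarith)+
  show off: "off (fat h x) = off x"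
    unfolding off_def lo using e lo_le[OF assms(2)] le_hi[OF assms(2)] by (simp add: fat_def)
  have "h ?y \<le> h (lo x)" "h (hi x) \<le> h ?y" using e y by auto
  then have "h (hi x) \<le> h (hi x) + h (lo x) - h ?y" "h (hi x) + h (lo x) - h ?y = h x"
    using e lo_le[OF assms(2)] le_hi[OF assms(2)] by linarith+
  then show "fat h (fat h x) = x"
    using f_f[OF assms(2)] unfolding fat_def[of h "fat h x"] lo hi by (simp add: fat_def)
  have "r x ?y" using ivl_block(1)[OF assms y] .
  then show "r x (fat h x)"
    unfolding fat_def using r_f[OF s(4)] r_trans[OF assms(2) s(4) f_less[OF s(4)]] by blast
qed

lemma cen_eq:
  assumes "x < n" "y < n" "cen x = cen y"
  shows "lo x = lo y \<and> hi x = hi y"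
proof -
  have *: "lo x = lo y \<and> hi x = hi y" if "lo x \<le> lo y" "x < n" "y < n" "cen x = cen y" for x y
    using same_ivl[of x "lo y"] same_ivl[of y "lo y"] lo_le[of y] le_hi[of y] le_hi[of x] lo_le[of x] that
    by (simp add: cen_def)
  show ?thesis using *[of x y] *[of y x] assms by (cases "lo x \<le> lo y") auto
qed

lemma cen_less:
  assumes "x < n" "y < n" "cen x < cen y"
  shows "hi x < lo y"
proof (rule ccontr)
  assume *: "\<not> hi x < lo y"
  have b: "lo x \<le> x" "x \<le> hi x" "lo y \<le> y" "y \<le> hi y" using assms lo_le le_hi by auto
  have "hi x < lo y \<or> hi y < lo x \<or> lo x = lo y \<and> hi x = hi y"
  proof (rule ccontr)
    assume "\<not> ?thesis"
    then have "lo x \<le> lo y \<and> lo y \<le> hi x \<or> lo y \<le> lo x \<and> lo x \<le> hi y"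
      and ne: "\<not> (lo x = lo y \<and> hi x = hi y)" using b by linarith+
    from this(1) show False
    proof
      assume "lo x \<le> lo y \<and> lo y \<le> hi x"
      then show False using same_ivl[of x "lo y"] same_ivl[of y "lo y"] b assms ne by simp
    next
      assume "lo y \<le> lo x \<and> lo x \<le> hi y"
      then show False using same_ivl[of y "lo x"] same_ivl[of x "lo x"] b assms ne by simp
    qed
  qed
  then show False using * assms(3) b by (auto simp: cen_def)
qed

text \<open>Centres can replace vertices as positions because disjoint intervals are ordered like
  their points and because each interval lies within one block of either composition.\<close>

lemma reflection_blocks_fat:
  assumes "refl h r"
  shows "reflection_blocks n cen (fat h) r"
proof -
  interpret reflection_blocks n int h r by (rule refl_blocks) fact
  note fp = fat_props[OF assms]
  have same: "r x y" if "x < n" "y < n" "cen x = cen y" for x y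
    using ivl_block(1)[OF assms that(1), of y] cen_eq[OF that] lo_le[OF that(2)] le_hi[OF that(2)] by simp
  have sum: "cen (fat h x) + cen x = 2 * int (h x + x)" if "x < n" for x
    using fp(3,4)[OF that] ivl_block(2)[OF assms that, of "lo x"] ivl_block(2)[OF assms that, of "hi x"]
      lo_le[OF that] le_hi[OF that] by (simp add: cen_def)
  have le: "x \<le> y \<or> cen x = cen y" if "x < n" "y < n" "cen x \<le> cen y" for x y
    using cen_less[OF that(1,2)] that(3) le_hi[OF that(1)] lo_le[OF that(2)] by fastforce
  show ?thesis
  proof (unfold_locales, goal_cases)
    case (7 x y)
    then show ?case using sum[of x] sum[of y] c_f[of x y] by simp
  next
    case (8 x)
    then have "lo (fat h x) = lo x" using cen_eq fp(1) by blast
    then show ?case using lo_off[OF fp(1)[OF 8(1)]] lo_off[OF 8(1)] fp(5)[OF 8(1)] by simp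
  next
    case (9 x y z)
    consider "cen x = cen y" | "cen y = cen z" | "x \<le> y" "y \<le> z" using le 9 by blast
    then show ?case
    proof cases
      case 1 then show ?thesis using same 9 by blast
    next
      case 2
      then have "r z y" using same[of z y] 9 by simp
      then show ?thesis using 9 r_trans[of x z y] by blast
    next
      case 3 then show ?thesis using r_convex[of x y z] 9 by simp
    qed
  qed (simp_all add: fp r_refl, (metis r_sym), (metis r_trans))
qed

lemma cen_sum:
  assumes "refl h r" "x < n"
  shows "cen x + cen (fat h x) = 2 * int (h x) + 2 * int x"
  using fat_props(3,4)[OF assms] ivl_block(2)[OF assms, of "lo x"] ivl_block(2)[OF assms, of "hi x"]
    lo_le[OF assms(2)] le_hi[OF assms(2)] by (simp add: cen_def)

text \<open>If no interval of the cycle \<open>Y\<close> were mirrored to itself, the parity of the number of interval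
  centres above a vertex would be constant on \<open>Y\<close>. But it differs at the two ends of an interval.\<close>

lemma fold_exists:
  assumes "S \<subseteq> {..<n}" "fat al ` S \<subseteq> S" "fat be ` S \<subseteq> S" "x \<in> S" "cyc (owner x)"
    and nofix: "\<And>y. y \<in> S \<Longrightarrow> fat al y \<noteq> y \<and> fat be y \<noteq> y"
  shows False
proof -
  let ?Y = "owner x"
  \<comment> \<open>One representative per interval, so that counting representatives counts
    intervals; \<open>S\<close> itself may meet an interval at several offsets.\<close>
  define H where "H = hi ` S"
  have lt: "s < n" if "s \<in> S" for s using assms(1) that by auto
  have x: "x < n" using lt assms(4) .
  note Y = cycD[OF assms(5)]
  have HV: "H \<subseteq> {..<n}" using lt hi_less by (auto simp: H_def)
  have ownY: "owner z = ?Y" if "z \<in> ?Y" for z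
    using that owner_owns[OF x] by (intro owner_eqI) (simp add: owns_def)
  \<comment> \<open>A vertex of the cycle is one of the two different ends of its interval, hence
    never the centre of an interval.\<close>
  have end_cen: "cen y \<noteq> 2 * int z" if "z \<in> ?Y" "y \<in> H" for y z
  proof
    assume e: "cen y = 2 * int z"
    have y: "y < n" using that HV by auto
    have zn: "z < n" using that Y by auto
    have "lo y \<le> y" "y \<le> hi y" using lo_le[OF y] le_hi[OF y] .
    then have "lo y \<le> z" "z \<le> hi y" using e by (auto simp: cen_def)
    then have "lo z = lo y" "hi z = hi y" using same_ivl[OF y] by blast+
    moreover have "is_int ?Y (lo z) (hi z)"
      using lo_hi_cyc(1)[OF zn] ownY[OF that(1)] assms(5) by simp
    ultimately show False using e that \<open>lo y \<le> z\<close> \<open>z \<le> hi y\<close>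
      unfolding is_int_def cen_def by (metis le_neq_implies_less mult_2 add_left_cancel add_right_cancel
          less_irrefl of_nat_eq_iff)
  qed
  \<comment> \<open>The thresholds are doubled like the centres. An interval with centre between
    \<open>z\<close> and \<open>h z\<close> belongs to the block of \<open>z\<close>, even where
    \<open>z\<close> or \<open>h z\<close> lies within it.\<close>
  have par: "even (card {y \<in> H. 2 * int z < cen y}) \<longleftrightarrow> even (card {y \<in> H. 2 * int (h z) < cen y})"
    if R: "refl h r" and fS: "fat h ` S \<subseteq> S" and nf: "\<And>y. y \<in> S \<Longrightarrow> fat h y \<noteq> y" and z: "z \<in> ?Y" for h r z
  proof -
    interpret F: reflection_blocks n cen "fat h" r by (rule reflection_blocks_fat) fact
    have zn: "z < n" using z Y by auto
    have hz: "h z \<in> ?Y" "h z < n" using Y(3) Y(4)[OF R z] by auto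
    have fh: "fat h (hi s) = hi (fat h s)" if s: "s < n" for s
    proof -
      have "hi (hi s) = hi s" "lo (hi s) = lo s" using same_ivl[OF s, of "hi s"] lo_le[OF s] le_hi[OF s] by auto
      then show ?thesis using fat_props(4)[OF R s] by (simp add: fat_def)
    qed
    show ?thesis
    proof (rule F.parity_between[of H z])
      fix y assume "y \<in> H"
      then obtain s where s: "s \<in> S" "y = hi s" "s < n" by (auto simp: H_def lt)
      then show "fat h y \<in> H" using fh fS by (auto simp: H_def)
      have b: "lo s \<le> s" "s \<le> hi s" using lo_le le_hi s by auto
      show "fat h y \<noteq> y"
      proof
        assume "fat h y = y"
        then have "hi (fat h s) = hi s" using fh s by simp
        then have "lo (fat h s) = lo s" using same_ivl[OF s(3), of "hi s"]
            same_ivl[OF fat_props(1)[OF R s(3)], of "hi (fat h s)"] b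
            lo_le[OF fat_props(1)[OF R s(3)]] le_hi[OF fat_props(1)[OF R s(3)]] by simp
        then have "fat h s = s"
          using lo_off[OF fat_props(1)[OF R s(3)]] lo_off[OF s(3)] fat_props(5)[OF R s(3)] by simp
        then show False using nf s by blast
      qed
      have yl: "lo y = lo s" "hi y = hi s" "y < n" using same_ivl[OF s(3), of y] b s by auto
      show "r z y" if between: "2 * int z < cen y \<and> cen y < 2 * int (h z) \<or> 2 * int (h z) < cen y \<and> cen y < 2 * int z"
      proof -
        consider "lo y \<le> z \<and> z \<le> hi y" | "lo y \<le> h z \<and> h z \<le> hi y"
          | "z \<le> y \<and> y \<le> h z \<or> h z \<le> y \<and> y \<le> z"
          using between yl b s(2) unfolding cen_def by linarith
        then show ?thesis
        proof cases
          case 1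
          then have "r y z" using ivl_block(1)[OF R yl(3)] by blast
          then show ?thesis using F.r_sym yl zn by blast
        next
          case 2
          then have "r y (h z)" using ivl_block(1)[OF R yl(3)] by blast
          moreover have "r (h z) z" using refl_convex[OF R hz(2) zn] Y(6)[OF R z] by (metis le_refl nle_le)
          ultimately have "r y z" using F.r_trans yl zn hz by blast
          then show ?thesis using F.r_sym yl zn by blast
        next
          case 3
          then show ?thesis using refl_convex[OF R zn yl(3)] by blast
        qed
      qed
      show "cen y \<noteq> 2 * int z \<and> cen y \<noteq> 2 * int (h z)" using end_cen \<open>y \<in> H\<close> z hz by blast
    next
      show "2 * int z + 2 * int (h z) = cen z + cen (fat h z)" using cen_sum[OF R zn] by simp
    qed (use HV zn in auto)
  qed
  let ?l = "lo x" and ?u = "hi x"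
  have lu: "is_int ?Y ?l ?u" using lo_hi_cyc(1)[OF x assms(5)] .
  define T where "T = {z \<in> ?Y. even (card {y \<in> H. 2 * int z < cen y}) = even (card {y \<in> H. 2 * int ?l < cen y})}"
  have "closed T"
    unfolding closed_def T_def
  proof (intro conjI ballI subsetI)
    let ?T = "{z \<in> ?Y. even (card {y \<in> H. 2 * int z < cen y}) = even (card {y \<in> H. 2 * int ?l < cen y})}"
    fix z assume z: "z \<in> ?T"
    then show "z \<in> {..<n}" using Y(3) by blast
    show "al z \<in> ?T"
      using z Y(4)[OF refl_al] par[OF refl_al assms(2)] nofix by blast
    show "be z \<in> ?T"
      using z Y(4)[OF refl_be] par[OF refl_be assms(3)] nofix by blast
  qed
  moreover have "?l \<in> T" using lu by (simp add: T_def is_int_def)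
  moreover have "?Y = comp ?l" using comps_comp[OF Y(1)] lu by (simp add: is_int_def)
  ultimately have "?u \<in> T" using comp_minimal lu unfolding is_int_def by blast
  \<comment> \<open>Only the interval from \<open>?l\<close> to \<open>?u\<close> has its centre
    between these two points, so the counts at its ends differ by 1.\<close>
  moreover have "{y \<in> H. 2 * int ?l < cen y} = insert ?u {y \<in> H. 2 * int ?u < cen y}"
  proof -
    have u: "lo ?u = ?l" "hi ?u = ?u" using same_ivl[OF x, of ?u] lo_le[OF x] le_hi[OF x] by auto
    have less: "?l < ?u" using lu by (simp add: is_int_def)
    have "y = ?u \<or> 2 * int ?u < cen y" if y: "y \<in> H" "2 * int ?l < cen y" for y
    proof -
      obtain s where s: "s \<in> S" "y = hi s" "s < n" using y by (auto simp: H_def lt)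
      have b: "lo s \<le> s" "s \<le> hi s" using lo_le le_hi s by auto
      have yl: "lo y = lo s" "hi y = hi s" "y < n" using same_ivl[OF s(3), of y] b s by auto
      have "cen x = int ?l + int ?u" by (simp add: cen_def)
      consider "cen y = cen x" | "cen y < cen x" | "cen x < cen y" by linarith
      then show ?thesis
      proof cases
        case 1 then show ?thesis using cen_eq[OF yl(3) x] yl s by simp
      next
        case 2 then show ?thesis using cen_less[OF yl(3) x] y yl b by (simp add: cen_def)
      next
        case 3 then show ?thesis using cen_less[OF x yl(3)] yl b by (simp add: cen_def)
      qed
    qed
    moreover have "?u \<in> H" using assms(4) by (simp add: H_def)
    ultimately show ?thesis using u less by (auto simp: cen_def)
  qed
  moreover have "finite H" using HV finite_subset by blast
  moreover have "\<not> 2 * int ?u < cen ?u"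
    using same_ivl[OF x, of ?u] lo_le[OF x] le_hi[OF x] by (simp add: cen_def)
  ultimately show False by (simp add: T_def)
qed

sublocale fat: fat_meander n cen "fat al" "fat be" ra rb
proof (intro fat_meander.intro fat_meander_axioms.intro)
  show "reflection_blocks n cen (fat al) ra" "reflection_blocks n cen (fat be) rb"
    using reflection_blocks_fat refl_al refl_be by blast+
  fix S assume S: "S \<noteq> {}" "S \<subseteq> {..<n}" "fat al ` S \<subseteq> S" "fat be ` S \<subseteq> S"
  then obtain x where x: "x \<in> S" "x < n" by auto
  show "\<exists>x\<in>S. fat al x = x \<or> fat be x = x"
  proof (cases "cyc (owner x)")
    case True
    then show ?thesis using fold_exists[OF S(2-4) x(1)] by blast
  next
    case False
    let ?Y = "owner x"
    have Yc: "?Y \<in> comps" using owner_comps[OF x(2)] .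
    \<comment> \<open>The intervals of a segment are points, so on it the fat reflections agree with
      the given ones, and one of these has a fixed point there.\<close>
    have own: "fat al y = al y \<and> fat be y = be y" if "y \<in> ?Y" for y
    proof -
      have yn: "y < n" using that comps_comp[OF Yc] by blast
      have "owner y = ?Y" using that owner_owns[OF x(2)] by (intro owner_eqI) (simp add: owns_def)
      then show ?thesis using lo_hi_not_cyc[OF yn] False by (simp add: fat_def)
    qed
    have xY: "x \<in> ?Y" using lo_hi_not_cyc(3)[OF x(2) False] .
    have "closed (S \<inter> ?Y)"
      unfolding closed_def using S(2-4) own closed_refl[OF comps_closed[OF Yc]] refl_al refl_be
      by (metis (no_types, lifting) Int_iff image_subset_iff le_infI1)
    then have "comp x \<subseteq> S \<inter> ?Y" using comp_minimal x xY by blast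
    moreover have "comp x = ?Y" using comps_comp[OF Yc xY] by simp
    moreover obtain y where "y \<in> ?Y" "al y = y \<or> be y = y" using False Yc by (auto simp: cyc_def)
    ultimately show ?thesis using own by (metis Int_iff subset_iff)
  qed
qed


section \<open>Interval lengths and the dimension formula\<close>

definition len :: "nat \<Rightarrow> nat" where "len x = hi x - lo x"

lemma len_refl:
  assumes "refl h r" "x < n"
  shows "len (h x) = len x" "off (h x) = len x - off x" "off x \<le> len x"
proof -
  have e: "h (hi x) + hi x = h x + x" "h (lo x) + lo x = h x + x"
    by (rule ivl_block(2)[OF assms]; use lo_le[OF assms(2)] le_hi[OF assms(2)] in linarith)+
  show "len (h x) = len x" "off (h x) = len x - off x" "off x \<le> len x"
    using e ivl_refl[OF assms] lo_le[OF assms(2)] le_hi[OF assms(2)] by (auto simp: len_def off_def)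
qed

lemma owner_in: "Y \<in> comps \<Longrightarrow> maximal Y \<Longrightarrow> y \<in> Y \<Longrightarrow> owner y = Y"
  by (rule owner_eqI) (simp add: owns_def)

lemma maximal_owner: "x < n \<Longrightarrow> maximal (owner x)"
  using owner_owns by (auto simp: owns_def)

text \<open>Each reflection step replaces an offset \<open>o\<close> by \<open>len - o\<close>, so
  only these two offsets occur along a component.\<close>

lemma comp_off:
  assumes "x < n" "y \<in> comp x"
  shows "owner y = owner x" "len y = len x" "off y = off x \<or> off y = len x - off x"
proof -
  let ?S = "{y. y < n \<and> owner y = owner x \<and> len y = len x \<and> (off y = off x \<or> off y = len x - off x)}"
  have *: "h y \<in> ?S" if "refl h r" "y \<in> ?S" for h r y
    using len_refl[OF that(1), of y] len_refl(3)[OF refl_al assms(1)] owner_refl[OF that(1), of y]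
      reflection_blocks.f_less[OF refl_blocks[OF that(1)], of y] that(2) by auto
  have "closed ?S" unfolding closed_def using *[OF refl_al] *[OF refl_be] by blast
  then have "comp x \<subseteq> ?S" using assms(1) by (intro comp_minimal) auto
  then show "owner y = owner x" "len y = len x" "off y = off x \<or> off y = len x - off x"
    using assms(2) by auto
qed

lemma lo_in_owner: "x < n \<Longrightarrow> lo x \<in> owner x"
  using lo_hi_cyc(1)[of x] lo_hi_not_cyc[of x] by (cases "cyc (owner x)") (auto simp: is_int_def)

lemma lo_off_len:
  assumes "x < n"
  shows "lo (lo x) = lo x" "len (lo x) = len x" "off (lo x) = 0" "owner (lo x) = owner x" "lo x < n"
  using same_ivl[OF assms, of "lo x"] lo_le[OF assms] le_hi[OF assms] by (auto simp: len_def off_def)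

lemma len_owner:
  assumes "x < n" "y < n" "owner x = owner y"
  shows "len x = len y"
proof -
  have "lo y \<in> comp (lo x)"
    using comps_comp[OF owner_comps[OF assms(1)] lo_in_owner[OF assms(1)]] lo_in_owner[OF assms(2)]
      assms(3) by simp
  then have "len (lo y) = len (lo x)" using comp_off(2) lo_off_len(5)[OF assms(1)] by blast
  then show ?thesis using lo_off_len(2) assms by simp
qed

lemma not_cyc_fixed:
  assumes "Y \<in> comps" "\<not> cyc Y"
  obtains h r y where "refl h r" "y \<in> Y" "h y = y"
  using assms refl_al refl_be unfolding cyc_def by blast

text \<open>The reflections that lead the owning cycle from interval to interval carry along every
  component that meets one of its intervals.\<close>

lemma meets_all_intervals:
  assumes "x < n" "y < n" "cyc (owner y)" "owner x = owner y"
  shows "\<exists>z \<in> comp x. lo y \<le> z \<and> z \<le> hi y"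
proof -
  let ?Y = "owner y"
  note Y = cycD[OF assms(3)]
  let ?S = "{w \<in> ?Y. \<exists>z \<in> comp x. lo w \<le> z \<and> z \<le> hi w}"
  have *: "h w \<in> ?S" if R: "refl h r" and w: "w \<in> ?S" for h r w
  proof -
    have wn: "w < n" using w Y by auto
    obtain z where z: "z \<in> comp x" "lo w \<le> z" "z \<le> hi w" using w by blast
    have e: "h (hi w) + hi w = h w + w" "h (lo w) + lo w = h w + w" "h z + z = h w + w"
      by (rule ivl_block(2)[OF R wn]; use z lo_le[OF wn] le_hi[OF wn] in linarith)+
    have "lo (h w) \<le> h z \<and> h z \<le> hi (h w)" using e z ivl_refl[OF R wn] by linarith
    moreover have "h z \<in> comp x" using closed_refl[OF closed_comp R z(1)] .
    ultimately show ?thesis using Y(4)[OF R] w by blast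
  qed
  have "closed ?S" unfolding closed_def using *[OF refl_al] *[OF refl_be] Y(3) by blast
  moreover have "lo x \<in> ?S"
    using lo_in_owner[OF assms(1)] assms(4) same_ivl[OF assms(1), of "lo x"] comp_self[OF assms(1)]
      lo_le[OF assms(1)] le_hi[OF assms(1)] by auto
  ultimately have "comp (lo x) \<subseteq> ?S" by (rule comp_minimal)
  moreover have "comp (lo x) = ?Y"
    using comps_comp[OF Y(1)] lo_in_owner[OF assms(1)] assms(4) by simp
  ultimately have "lo y \<in> ?S" using lo_in_owner[OF assms(2)] by blast
  then show ?thesis
    using same_ivl[OF assms(2), of "lo y"] lo_le[OF assms(2)] le_hi[OF assms(2)] by auto
qed

text \<open>At most two points, because only two offsets occur; at least one, because every interval
  is met; and an even number, because the ends of the interval belong to the same component and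
  hence lie both inside or both outside \<open>Z\<close>.\<close>

lemma card_cycle_interval:
  assumes "y < n" "cyc (owner y)" "cyc Z" "Z \<noteq> owner y" "z \<in> Z" "owner z = owner y"
  shows "card (Z \<inter> {lo y..hi y}) = 2"
proof -
  let ?Y = "owner y" and ?A = "Z \<inter> {lo y..hi y}"
  note Y = cycD[OF assms(2)] and Z = cycD[OF assms(3)]
  note i = lo_hi_cyc[OF assms(1,2), unfolded is_int_def]
  have zn: "z < n" using assms(5) Z by auto
  have Zc: "Z = comp z" using comps_comp[OF Z(1) assms(5)] by simp
  have notin: "lo y \<notin> Z" "hi y \<notin> Z" using comps_disjoint[OF Y(1) Z(1)] i assms(4) by blast+
  have "inside Z (lo y) \<longleftrightarrow> inside Z (hi y)" using inside_all[OF assms(3) Y(1)] i by blast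
  then have "odd (above Z (lo y)) \<longleftrightarrow> odd (above Z (hi y))" using notin by (simp add: inside_def)
  moreover have "{z \<in> Z. lo y < z} = ?A \<union> {z \<in> Z. hi y < z}"
    using notin i by (auto simp: le_less)
  moreover have "card (?A \<union> {z \<in> Z. hi y < z}) = card ?A + card {z \<in> Z. hi y < z}"
    by (rule card_Un_disjoint) (use Z(2) in auto)
  ultimately have ev: "even (card ?A)"
    unfolding above_def by (cases "even (card {z \<in> Z. hi y < z})") simp_all
  obtain w where w: "w \<in> ?A" using meets_all_intervals[OF zn assms(1,2,6)] Zc by auto
  have sub: "?A \<subseteq> {w, lo y + hi y - w}"
  proof
    fix v assume v: "v \<in> ?A"
    have wn: "w < n" using w Z by auto
    have "v \<in> comp w" using comps_comp[OF Z(1), of w] w v by auto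
    then have "off v = off w \<or> off v = len w - off w" using comp_off(3)[OF wn] by blast
    moreover have "lo v = lo y" "lo w = lo y" "hi w = hi y"
      using same_ivl[OF assms(1), of v] same_ivl[OF assms(1), of w] v w by auto
    ultimately show "v \<in> {w, lo y + hi y - w}" using v w by (auto simp: off_def len_def)
  qed
  have "card ?A \<le> 2"
    using card_mono[OF _ sub] by (rule order_trans) (auto simp: card_insert_if)
  moreover have "card ?A \<noteq> 0" using w Z(2) by auto
  ultimately show ?thesis using ev by (metis One_nat_def dvd_refl even_Suc le_SucE le_zero_eq less_2_cases_iff
        linorder_not_le numeral_2_eq_2 odd_one order_le_less)
qed

text \<open>A segment has a vertex fixed by a reflection, whose offset is therefore exactly the
  middle one. Then all offsets along the segment coincide.\<close>

lemma card_segment_interval: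
  assumes "y < n" "cyc (owner y)" "Z \<in> comps" "\<not> cyc Z" "z \<in> Z" "owner z = owner y"
  shows "card (Z \<inter> {lo y..hi y}) = 1"
proof -
  let ?A = "Z \<inter> {lo y..hi y}"
  have zn: "z < n" and Zc: "Z = comp z" using comps_comp[OF assms(3,5)] by auto
  obtain w where w: "w \<in> ?A" using meets_all_intervals[OF zn assms(1,2,6)] Zc by auto
  obtain h r x where x: "refl h r" "x \<in> Z" "h x = x" using not_cyc_fixed[OF assms(3,4)] .
  have xn: "x < n" using comps_comp[OF assms(3) x(2)] by simp
  have mid: "off x = len x - off x" using len_refl(2)[OF x(1) xn] x(3) by simp
  have "v = w" if v: "v \<in> ?A" for v
  proof -
    have "v \<in> comp x" "w \<in> comp x" using comps_comp[OF assms(3) x(2)] v w by auto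
    then have "off v = off x" "off w = off x" using comp_off(3)[OF xn] mid by metis+
    moreover have "lo v = lo y" "lo w = lo y"
      using same_ivl[OF assms(1), of v] same_ivl[OF assms(1), of w] v w by auto
    moreover have "v < n" "w < n" using same_ivl(4)[OF assms(1)] v w by auto
    ultimately show ?thesis using lo_off[of v] lo_off[of w] by simp
  qed
  then have "?A = {w}" using w by blast
  then show ?thesis by simp
qed

lemma owner_iff:
  assumes "Y \<in> comps" "maximal Y" "cyc Y" "Z \<in> comps" "z \<in> Z"
  shows "owner z = Y \<longleftrightarrow> Z = Y \<or> inside Y (Max Z)"
proof -
  have "z < n" using comps_comp[OF assms(4,5)] by simp
  have "owns Y z \<longleftrightarrow> z \<in> Y \<or> inside Y z" using assms by (auto simp: owns_def)
  also have "z \<in> Y \<longleftrightarrow> Z = Y" using comps_disjoint[OF assms(1,4)] assms(5) by blast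
  also have "inside Y z \<longleftrightarrow> inside Y (Max Z)"
    using inside_all[OF assms(3,4,5) Max_comps[OF assms(4)]] .
  finally show ?thesis using owner_eqI owner_owns[OF \<open>z < n\<close>] by metis
qed

text \<open>The interval is split by components: the owner contributes its two ends, each inner
  cycle two points, each inner segment one. The \<open>Suc\<close> is there because
  \<open>len\<close> is the difference of the ends.\<close>

lemma interval_length:
  assumes "y < n" "cyc (owner y)"
  shows "Suc (len y) = 2 * card {Z. cyc Z \<and> inside (owner y) (Max Z)}
    + card {Z \<in> comps. \<not> cyc Z \<and> inside (owner y) (Max Z)} + 2"
proof -
  let ?Y = "owner y" and ?I = "{lo y..hi y}"
  let ?C = "{Z. cyc Z \<and> inside ?Y (Max Z)}" and ?S = "{Z \<in> comps. \<not> cyc Z \<and> inside ?Y (Max Z)}"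
  note Y = cycD[OF assms(2)]
  have mY: "maximal ?Y" using maximal_owner[OF assms(1)] .
  note i = lo_hi_cyc[OF assms, unfolded is_int_def]
  have fin: "finite comps" by (simp add: comps_def)
  have CS: "?C \<subseteq> comps" by (auto simp: cyc_def)
  have finC: "finite ?C" "finite ?S" using fin CS finite_subset by auto
  have YC: "?Y \<notin> ?C" using inside_less_Max[OF assms(2)] by fastforce
  have own: "owner z = ?Y \<longleftrightarrow> Z = ?Y \<or> inside ?Y (Max Z)" if "Z \<in> comps" "z \<in> Z" for z Z
    using owner_iff[OF Y(1) mY assms(2) that] .
  have union: "?I = (\<Union>Z \<in> insert ?Y (?C \<union> ?S). Z \<inter> ?I)"
  proof -
    have "x \<in> (\<Union>Z \<in> insert ?Y (?C \<union> ?S). Z \<inter> ?I)" if x: "x \<in> ?I" for x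
    proof -
      have xn: "x < n" "owner x = ?Y" using same_ivl[OF assms(1)] x by auto
      have c: "comp x \<in> comps" using xn by (auto simp: comps_def)
      have "comp x = ?Y \<or> inside ?Y (Max (comp x))" using own[OF c comp_self[OF xn(1)]] xn by simp
      then have "comp x \<in> insert ?Y (?C \<union> ?S)" using c by blast
      then show ?thesis using comp_self[OF xn(1)] x by blast
    qed
    then show ?thesis by blast
  qed
  have sub: "insert ?Y (?C \<union> ?S) \<subseteq> comps" using CS Y(1) by auto
  have "card ?I = (\<Sum>Z \<in> insert ?Y (?C \<union> ?S). card (Z \<inter> ?I))"
  proof (subst union, rule card_UN_disjoint)
    show "finite (insert ?Y (?C \<union> ?S))" using finC by simp
    show "\<forall>Z\<in>insert ?Y (?C \<union> ?S). finite (Z \<inter> ?I)" by simp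
    have "Z \<inter> ?I \<inter> (Z' \<inter> ?I) = {}" if "Z \<in> insert ?Y (?C \<union> ?S)" "Z' \<in> insert ?Y (?C \<union> ?S)" "Z \<noteq> Z'" for Z Z'
      using comps_disjoint[of Z Z'] that sub by blast
    then show "\<forall>Z\<in>insert ?Y (?C \<union> ?S). \<forall>Z'\<in>insert ?Y (?C \<union> ?S).
        Z \<noteq> Z' \<longrightarrow> Z \<inter> ?I \<inter> (Z' \<inter> ?I) = {}" by blast
  qed
  also have "\<dots> = card (?Y \<inter> ?I) + (\<Sum>Z \<in> ?C \<union> ?S. card (Z \<inter> ?I))"
    using finC YC assms(2) by (subst sum.insert) auto
  also have "(\<Sum>Z \<in> ?C \<union> ?S. card (Z \<inter> ?I)) = (\<Sum>Z \<in> ?C. card (Z \<inter> ?I)) + (\<Sum>Z \<in> ?S. card (Z \<inter> ?I))"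
    using finC by (intro sum.union_disjoint) auto
  also have "(\<Sum>Z \<in> ?C. card (Z \<inter> ?I)) = (\<Sum>Z \<in> ?C. 2)"
  proof (rule sum.cong[OF HOL.refl])
    fix Z assume Z: "Z \<in> ?C"
    then have "Z \<in> comps" "Z \<noteq> ?Y" using YC by (auto simp: cyc_def)
    then show "card (Z \<inter> ?I) = 2"
      using card_cycle_interval[OF assms, of Z "Max Z"] Max_comps own Z by blast
  qed
  also have "(\<Sum>Z \<in> ?S. card (Z \<inter> ?I)) = (\<Sum>Z \<in> ?S. 1)"
  proof (rule sum.cong[OF HOL.refl])
    fix Z assume Z: "Z \<in> ?S"
    then show "card (Z \<inter> ?I) = 1"
      using card_segment_interval[OF assms, of Z "Max Z"] Max_comps own by blast
  qed
  also have "?Y \<inter> ?I = {lo y, hi y}" using i by (auto simp: le_less)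
  finally show ?thesis using i by (simp add: len_def)
qed

text \<open>At a fixed offset, a set stable under the fat reflections yields a stable set of
  vertices of the owner, which is a single component. This is what makes all blocks along a path
  equal.\<close>

lemma fat_connected:
  assumes "x < n" "y < n" "owner x = owner y" "off x = off y"
    and "S \<subseteq> {..<n}" "fat al ` S \<subseteq> S" "fat be ` S \<subseteq> S" "x \<in> S"
  shows "y \<in> S"
proof -
  let ?Y = "owner x"
  let ?T = "{w \<in> ?Y. lo w + off x \<in> S}"
  have Yc: "?Y \<in> comps" using owner_comps[OF assms(1)] .
  have off_len: "off x \<le> len x" using len_refl(3)[OF refl_al assms(1)] .
  have *: "h w \<in> ?T" if R: "refl h r" and w: "w \<in> ?T" and fS: "fat h ` S \<subseteq> S" for h r w
  proof -
    have wn: "w < n" using comps_comp[OF Yc] w by blast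
    have "owner w = ?Y" using owner_in[OF Yc maximal_owner[OF assms(1)]] w by blast
    then have "len w = len x" using len_owner[OF wn assms(1)] by blast
    then have "lo w \<le> lo w + off x" "lo w + off x \<le> hi w" using off_len lo_le[OF wn] le_hi[OF wn]
      by (auto simp: len_def)
    note v = same_ivl[OF wn this]
    let ?v = "lo w + off x"
    have "fat h ?v \<in> S" using fS w by blast
    moreover have "lo (fat h ?v) = lo (h w)" "off (fat h ?v) = off x"
      using fat_props[OF R v(4)] ivl_refl[OF R wn] v by (auto simp: off_def)
    ultimately have "lo (h w) + off x \<in> S" using lo_off[OF fat_props(1)[OF R v(4)]] by metis
    then show ?thesis using closed_refl[OF comps_closed[OF Yc] R] w by blast
  qed
  have "closed ?T" unfolding closed_def
    using *[OF refl_al _ assms(6)] *[OF refl_be _ assms(7)] comps_comp[OF Yc] by blast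
  moreover have "lo x \<in> ?T"
    using lo_in_owner[OF assms(1)] lo_off_len(1)[OF assms(1)] lo_off[OF assms(1)] assms(8) by simp
  ultimately have "comp (lo x) \<subseteq> ?T" by (rule comp_minimal)
  moreover have "comp (lo x) = ?Y" using comps_comp[OF Yc lo_in_owner[OF assms(1)]] by simp
  ultimately have "lo y \<in> ?T" using lo_in_owner[OF assms(2)] assms(3) by auto
  then show ?thesis using lo_off_len(1)[OF assms(2)] lo_off[OF assms(2)] assms(4) by simp
qed

section \<open>Comparison with the meander graph of a pair of compositions\<close>

fun walk :: "nat \<Rightarrow> nat \<Rightarrow> nat" where
  "walk x 0 = x"
| "walk x (Suc k) = (if even k then al else be) (walk x k)"

context
  fixes X x assumes X: "X \<in> comps" "x \<in> X" and nofix: "\<And>y. y \<in> X \<Longrightarrow> al y \<noteq> y \<and> be y \<noteq> y"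
begin

lemma cyc_X: "cyc X"
  using X nofix by (auto simp: cyc_def)

lemma walk_in: "walk x k \<in> X"
proof (induction k)
  case (Suc k)
  then show ?case using cycD(4)[OF cyc_X refl_al] cycD(4)[OF cyc_X refl_be] by simp
qed (use X in simp)

lemma walk_back:
  "(if even k then al else be) (walk x (Suc k)) = walk x k"
  using cycD(6)[OF cyc_X refl_al walk_in] cycD(6)[OF cyc_X refl_be walk_in] by simp

text \<open>If two points at odd distance agreed, the same reflection would move both ends of the
  stretch inwards, until at distance 1 a fixed point appears. So the walk closes up only after an
  even number of steps.\<close>

lemma walk_odd: "odd d \<Longrightarrow> walk x i \<noteq> walk x (i + d)"
proof (induction d arbitrary: i rule: less_induct)
  case (less d)
  show ?case
  proof (cases "d = 1")
    case True
    then show ?thesis using nofix[OF walk_in[of i]] by (auto simp: eq_commute)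
  next
    case False
    with less.prems obtain e where e: "d = Suc (Suc e)" "odd e" by (metis One_nat_def even_Suc not0_implies_Suc odd_one odd_pos less_numeral_extra(3) even_zero)
    show ?thesis
    proof
      assume "walk x i = walk x (i + d)"
      then have "walk x (Suc i) = (if even (i + Suc e) then al else be) (walk x (Suc (i + Suc e)))"
        using e by simp
      also have "\<dots> = walk x (Suc i + e)" unfolding walk_back by simp
      finally show False using less.IH[of e "Suc i"] e by simp
    qed
  qed
qed

lemma walk_shift: "even d \<Longrightarrow> walk x i = walk x (i + d) \<Longrightarrow> walk x 0 = walk x d"
proof (induction i)
  case (Suc i)
  have "walk x i = (if even i then al else be) (walk x (Suc i))" using walk_back by simp
  also have "\<dots> = (if even (i + d) then al else be) (walk x (Suc (i + d)))" using Suc.prems by simp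
  also have "\<dots> = walk x (i + d)" by (rule walk_back)
  finally show ?case using Suc by simp
qed simp

lemma walk_period:
  obtains L where "even L" "L \<ge> 2" "walk x L = x" "inj_on (walk x) {..<L}" "X = walk x ` {..<L}"
proof -
  have "\<not> inj (walk x)"
    using finite_subset[of "range (walk x)" X, OF image_subsetI[OF walk_in] cycD(2)[OF cyc_X]]
      finite_imageD[of "walk x" UNIV] infinite_UNIV_nat by blast
  then obtain i j where "i < j" "walk x i = walk x j" unfolding inj_def by (metis linorder_neqE_nat)
  then obtain d where d: "d > 0" "walk x i = walk x (i + d)" using less_imp_add_positive by metis
  then have "even d" using walk_odd by blast
  then have ex: "0 < d \<and> walk x d = x" using walk_shift d by fastforce
  define L where "L = (LEAST d. 0 < d \<and> walk x d = x)"
  have L: "0 < L" "walk x L = x" using LeastI[of "\<lambda>d. 0 < d \<and> walk x d = x", OF ex] by (auto simp: L_def)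
  have min: "L \<le> d" if "0 < d" "walk x d = x" for d
    unfolding L_def using that by (intro Least_le) simp
  have "even L" using walk_odd[of L 0] L by auto
  moreover from this have "L \<ge> 2" using L by (cases L rule: nat.exhaust; cases "L - 1") auto
  moreover have inj: "inj_on (walk x) {..<L}"
  proof (rule inj_onI, rule ccontr)
    have *: False if ij: "i < j" "j < L" "walk x i = walk x j" for i j
    proof -
      obtain d where d: "j = i + d" "d > 0" using less_imp_add_positive[OF ij(1)] by metis
      then have "even d" using walk_odd[of d i] ij by blast
      then have "walk x d = x" using walk_shift[of d i] ij d by simp
      then show False using min[of d] d ij by simp
    qed
    fix i j assume "i \<in> {..<L}" "j \<in> {..<L}" "walk x i = walk x j" "i \<noteq> j"
    then show False using *[of i j] *[of j i] by (cases "i < j") auto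
  qed
  moreover have "X = walk x ` {..<L}"
  proof
    show "walk x ` {..<L} \<subseteq> X" using walk_in by blast
    have fwd: "walk x (Suc k) \<in> walk x ` {..<L}" if "k < L" for k
    proof (cases "Suc k = L")
      case True
      then have "walk x (Suc k) = walk x 0" using L by simp
      then show ?thesis using L by blast
    next
      case False
      then show ?thesis using that by (intro imageI) simp
    qed
    \<comment> \<open>At \<open>k = 0\<close> the backward reflection is \<open>be\<close>, which
      leads to the last point of the walk because \<open>L\<close> is even.\<close>
    have bwd: "(if odd k then al else be) (walk x k) \<in> walk x ` {..<L}" if "k < L" for k
    proof (cases k)
      case 0
      obtain m where m: "L = Suc m" using L by (cases L) auto
      then have "be (walk x (Suc m)) = walk x m" using walk_back[of m] \<open>even L\<close> by simp
      then show ?thesis using 0 m L by auto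
    next
      case (Suc m)
      then have "(if odd k then al else be) (walk x k) = walk x m" using walk_back[of m] by simp
      then show ?thesis using that Suc by auto
    qed
    have "closed (walk x ` {..<L})"
      unfolding closed_def
    proof (intro conjI ballI)
      show "walk x ` {..<L} \<subseteq> {..<n}" using walk_in cycD(3)[OF cyc_X] by blast
      fix y assume "y \<in> walk x ` {..<L}"
      then obtain k where k: "k < L" "y = walk x k" by blast
      show "al y \<in> walk x ` {..<L}" "be y \<in> walk x ` {..<L}"
        using fwd[OF k(1)] bwd[OF k(1)] k(2) by (cases "even k"; simp)+
    qed
    moreover have "x \<in> walk x ` {..<L}" using L by (auto intro: image_eqI[of _ _ 0])
    ultimately show "X \<subseteq> walk x ` {..<L}" using comp_minimal comps_comp[OF X] by blast
  qed
  ultimately show ?thesis using that L by blast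
qed

end

end

lemma
  assumes "finite Y"
  shows length_descending: "length (descending Y) = card Y"
    and descending_in: "k < card Y \<Longrightarrow> descending Y ! k \<in> Y"
    and descending_less: "j < k \<Longrightarrow> k < card Y \<Longrightarrow> descending Y ! k < descending Y ! j"
    and descending_ex: "y \<in> Y \<Longrightarrow> \<exists>k < card Y. y = descending Y ! k"
proof -
  show len: "length (descending Y) = card Y" by (simp add: descending_def)
  have set: "set (descending Y) = Y" using assms by (simp add: descending_def)
  show "descending Y ! k \<in> Y" if "k < card Y" using that len set nth_mem by metis
  show "\<exists>k < card Y. y = descending Y ! k" if "y \<in> Y"
    using that len set by (metis in_set_conv_nth)
  show "descending Y ! k < descending Y ! j" if "j < k" "k < card Y"
  proof -
    have "sorted_wrt (<) (rev (descending Y))" by (simp add: descending_def)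
    then have "sorted_wrt (\<lambda>x y. y < x) (descending Y)" by (simp add: sorted_wrt_rev)
    from sorted_wrt_nth_less[OF this that(1)] show ?thesis using that len by simp
  qed
qed

section \<open>Identification with the graph of two compositions\<close>

locale seaweed_meander =
  fixes n :: nat and as bs :: "nat list"
  assumes comp_as: "composition n as" and comp_bs: "composition n bs"

sublocale seaweed_meander \<subseteq> meander n "reflect as" "reflect bs" "same_block as" "same_block bs"
  using reflection_blocks_reflect comp_as comp_bs by (intro meander.intro) auto

context seaweed_meander
begin

lemma meander_edges_eq:
  "meander_edges as bs = {Inl {x, reflect as x} | x. x < n \<and> reflect as x \<noteq> x} \<union>
     {Inr {x, reflect bs x} | x. x < n \<and> reflect bs x \<noteq> x}"
  unfolding meander_edges_def arcs_eq[OF comp_as] arcs_eq[OF comp_bs] Plus_def by blast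

lemma edge_at:
  assumes "e \<in> meander_edges as bs" "v \<in> ends e"
  shows "e = Inl {v, reflect as v} \<and> reflect as v \<noteq> v \<and> v < n \<or> e = Inr {v, reflect bs v} \<and> reflect bs v \<noteq> v \<and> v < n"
proof -
  consider x where "e = Inl {x, reflect as x}" "x < n" "reflect as x \<noteq> x"
    | x where "e = Inr {x, reflect bs x}" "x < n" "reflect bs x \<noteq> x"
    using assms(1) unfolding meander_edges_eq by blast
  then show ?thesis
  proof cases
    case 1
    then have "v = x \<or> v = reflect as x" using assms(2) by (simp add: ends_def)
    then show ?thesis using 1 A.f_f[of x] A.f_less[of x] by (auto simp: insert_commute)
  next
    case 2
    then have "v = x \<or> v = reflect bs x" using assms(2) by (simp add: ends_def)
    then show ?thesis using 2 B.f_f[of x] B.f_less[of x] by (auto simp: insert_commute)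
  qed
qed

lemma adjacency_eq:
  "adjacency as bs = {(u, v). u < n \<and> v \<noteq> u \<and> (v = reflect as u \<or> v = reflect bs u)}"
proof (rule equalityI; clarify)
  fix u v assume "(u, v) \<in> adjacency as bs"
  then obtain e where e: "e \<in> meander_edges as bs" "ends e = {u, v}" by (auto simp: adjacency_def)
  then have "e = Inl {u, reflect as u} \<and> reflect as u \<noteq> u \<and> u < n \<or> e = Inr {u, reflect bs u} \<and> reflect bs u \<noteq> u \<and> u < n"
    using edge_at by blast
  then show "u < n \<and> v \<noteq> u \<and> (v = reflect as u \<or> v = reflect bs u)" (is ?P)
  proof (elim disjE conjE)
    assume *: "e = Inl {u, reflect as u}" "reflect as u \<noteq> u" "u < n"
    then have "{u, reflect as u} = {u, v}" using e(2) by (simp add: ends_def)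
    then have "v = reflect as u" by (metis doubleton_eq_iff)
    then show ?P using * by simp
  next
    assume *: "e = Inr {u, reflect bs u}" "reflect bs u \<noteq> u" "u < n"
    then have "{u, reflect bs u} = {u, v}" using e(2) by (simp add: ends_def)
    then have "v = reflect bs u" by (metis doubleton_eq_iff)
    then show ?P using * by simp
  qed
next
  fix u v assume *: "u < n" "v \<noteq> u" "v = reflect as u \<or> v = reflect bs u"
  then have "Inl {u, v} \<in> meander_edges as bs \<or> Inr {u, v} \<in> meander_edges as bs"
    unfolding meander_edges_eq by blast
  then show "(u, v) \<in> adjacency as bs"
    unfolding adjacency_def by (auto simp: ends_def intro: bexI[of _ "Inl {u, v}"] bexI[of _ "Inr {u, v}"])
qed

lemma comp_eq_reachable: "x < n \<Longrightarrow> comp x = {y. y < n \<and> (x, y) \<in> (adjacency as bs)\<^sup>*}"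
proof
  assume x: "x < n"
  let ?S = "{y. y < n \<and> (x, y) \<in> (adjacency as bs)\<^sup>*}"
  have "h y \<in> ?S" if R: "refl h r" and y: "y \<in> ?S" for h r y
  proof -
    have "h y < n" using reflection_blocks.f_less[OF refl_blocks[OF R]] y by blast
    moreover have "h y = y \<or> (y, h y) \<in> adjacency as bs"
      unfolding adjacency_eq using R y by (auto simp: refl_def)
    ultimately show ?thesis using y by (auto intro: rtrancl_into_rtrancl)
  qed
  then have "closed ?S" unfolding closed_def using refl_al refl_be by blast
  then show "comp x \<subseteq> ?S" using x by (intro comp_minimal) auto
  show "?S \<subseteq> comp x"
  proof clarify
    fix y assume "(x, y) \<in> (adjacency as bs)\<^sup>*" "y < n"
    from this(1) show "y \<in> comp x"
    proof (induction rule: rtrancl_induct)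
      case base
      then show ?case using comp_self x by blast
    next
      case (step y z)
      then show ?case using closed_comp[of x] unfolding closed_def adjacency_eq by blast
    qed
  qed
qed

lemma meander_components_eq: "meander_components n as bs = comps"
proof -
  have "((adjacency as bs)\<^sup>* \<inter> {..<n} \<times> {..<n}) `` {x} = comp x" if "x < n" for x
    using comp_eq_reachable[OF that] that by auto
  then show ?thesis unfolding meander_components_def quotient_def comps_def by auto
qed

text \<open>The cycle has two different edges at each of its vertices, and a vertex carries at most
  one edge of each kind, so both kinds occur and neither reflection fixes it.\<close>

lemma spans_cycle_nofix:
  assumes "spans_cycle as bs X" "v \<in> X"
  shows "reflect as v \<noteq> v \<and> reflect bs v \<noteq> v"
proof -
  obtain vs es where c: "length vs \<ge> 2" "length es = length vs" "distinct es" "set vs = X"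
    "set es \<subseteq> meander_edges as bs"
    "\<And>i. i < length vs \<Longrightarrow> ends (es ! i) = {vs ! i, vs ! (Suc i mod length vs)}"
    using assms(1) unfolding spans_cycle_def by blast
  let ?L = "length vs"
  obtain i where i: "i < ?L" "v = vs ! i" using assms(2) c(4) by (metis in_set_conv_nth)
  define j where "j = (if i = 0 then ?L - 1 else i - 1)"
  have j: "j < ?L" "Suc j mod ?L = i" "j \<noteq> i" using i c(1) by (auto simp: j_def)
  have mem: "es ! i \<in> meander_edges as bs" "es ! j \<in> meander_edges as bs"
    using i j c(2,5) nth_mem by (metis subsetD)+
  have "v \<in> ends (es ! i)" "v \<in> ends (es ! j)" using c(6)[OF i(1)] c(6)[OF j(1)] i j by auto
  note edge_at[OF mem(1) this(1)] edge_at[OF mem(2) this(2)]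
  moreover have "es ! i \<noteq> es ! j" using c(2,3) i j by (simp add: nth_eq_iff_index_eq)
  ultimately show ?thesis by metis
qed

lemma nofix_spans_cycle:
  assumes "X \<in> comps" and nofix: "\<And>y. y \<in> X \<Longrightarrow> reflect as y \<noteq> y \<and> reflect bs y \<noteq> y"
  shows "spans_cycle as bs X"
proof -
  obtain x where x: "x \<in> X" using comps_nonempty assms(1) by blast
  note c = assms(1) x nofix
  obtain L where L: "even L" "L \<ge> 2" "walk x L = x" "inj_on (walk x) {..<L}" "X = walk x ` {..<L}"
    using walk_period[OF c] .
  let ?w = "walk x"
  \<comment> \<open>Tagging edges by the parity of the step keeps the two edges of a two-vertex
    cycle apart.\<close>
  define e :: "nat \<Rightarrow> nat set + nat set" where
    "e = (\<lambda>k. if even k then Inl {?w k, ?w (Suc k)} else Inr {?w k, ?w (Suc k)})"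
  have inj_e: "inj_on e {..<L}"
  proof (rule inj_onI, rule ccontr)
    have *: False if "i < j" "j < L" "e i = e j" for i j
    proof -
      have "even i \<longleftrightarrow> even j" "{?w i, ?w (Suc i)} = {?w j, ?w (Suc j)}"
        using that(3) by (auto simp: e_def split: if_splits)
      moreover have "?w i \<noteq> ?w j" using L(4) that by (auto simp: inj_on_def)
      \<comment> \<open>Equal edges with different starting points are traversed in opposite
        directions, which identifies two points at odd distance.\<close>
      ultimately have "?w i = ?w (Suc j)" by (auto simp: doubleton_eq_iff)
      moreover have "Suc j = i + (Suc j - i)" "odd (Suc j - i)"
        using that(1) \<open>even i \<longleftrightarrow> even j\<close> by auto
      ultimately show False using walk_odd[OF c, of "Suc j - i" i] by metis
    qed
    fix i j assume "i \<in> {..<L}" "j \<in> {..<L}" "e i = e j" "i \<noteq> j"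
    then show False using *[of i j] *[of j i] by (cases "i < j") auto
  qed
  have e_edge: "e k \<in> meander_edges as bs" for k
  proof -
    have k: "?w k \<in> X" using walk_in[OF c] .
    then have "?w k < n" using comps_comp assms(1) by blast
    then show ?thesis using nofix[OF k] unfolding meander_edges_eq e_def by auto
  qed
  show ?thesis
    unfolding spans_cycle_def
  proof (intro exI[of _ "map ?w [0..<L]"] exI[of _ "map e [0..<L]"] conjI allI impI)
    show "distinct (map ?w [0..<L])" "distinct (map e [0..<L])"
      using L(4) inj_e by (simp_all add: distinct_map atLeast0LessThan)
    show "set (map ?w [0..<L]) = X" using L(5) by (simp add: atLeast0LessThan)
    show "set (map e [0..<L]) \<subseteq> meander_edges as bs" using e_edge by auto
    fix k assume k: "k < length (map ?w [0..<L])"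
    have "?w (Suc k) = map ?w [0..<L] ! (Suc k mod L)"
    proof (cases "Suc k = L")
      case True
      then show ?thesis using L by simp
    next
      case False
      then show ?thesis using k by simp
    qed
    then show "ends (map e [0..<L] ! k) = {map ?w [0..<L] ! k, map ?w [0..<L] ! (Suc k mod length (map ?w [0..<L]))}"
      using k by (simp add: e_def ends_def del: walk.simps)
  qed (use L in auto)
qed

lemma cycles_eq: "cycles n as bs = {X. cyc X}"
  unfolding cycles_def meander_components_eq cyc_def using spans_cycle_nofix nofix_spans_cycle by blast

lemma segments_eq: "segments n as bs = {X \<in> comps. \<not> cyc X}"
  unfolding segments_def meander_components_eq cycles_eq by blast

lemma above_descending:
  assumes "finite Y" "k < card Y"
  shows "above Y (descending Y ! k) = k"
proof -
  have "{y \<in> Y. descending Y ! k < y} = (!) (descending Y) ` {..<k}"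
  proof (rule equalityI; rule subsetI)
    fix y assume "y \<in> {y \<in> Y. descending Y ! k < y}"
    then obtain j where "j < card Y" "y = descending Y ! j" "descending Y ! k < descending Y ! j"
      using descending_ex[OF assms(1)] by blast
    moreover from this have "j < k"
      using descending_less[OF assms(1), of k j] by (metis linorder_neqE_nat not_less_iff_gr_or_eq)
    ultimately show "y \<in> (!) (descending Y) ` {..<k}" by blast
  next
    fix y assume "y \<in> (!) (descending Y) ` {..<k}"
    then show "y \<in> {y \<in> Y. descending Y ! k < y}"
      using descending_less[OF assms(1)] descending_in[OF assms(1)] assms(2) by auto
  qed
  moreover have "inj_on ((!) (descending Y)) {..<k}"
    using descending_less[OF assms(1)] assms(2)
    by (intro linorder_inj_onI) (auto, metis less_irrefl less_trans)
  ultimately show ?thesis by (simp add: above_def card_image)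
qed

text \<open>The list is numbered from 0, so entry \<open>k\<close> has exactly \<open>k\<close>
  vertices above it and the lower ends are the entries with odd index.\<close>

lemma is_int_descending:
  assumes "finite Y"
  shows "is_int Y l u \<longleftrightarrow> (\<exists>i. 2 * i + 1 < card Y \<and> l = descending Y ! (2 * i + 1) \<and> u = descending Y ! (2 * i))"
proof
  assume lu: "is_int Y l u"
  then obtain j k where j: "j < card Y" "l = descending Y ! j" and k: "k < card Y" "u = descending Y ! k"
    using descending_ex[OF assms] unfolding is_int_def by meson
  then have "above Y l = j" "above Y u = k" using above_descending[OF assms] by auto
  moreover have "odd (above Y l)" "above Y l = Suc (above Y u)"
    using above_upper[OF assms lu] lu by (auto simp: is_int_def)
  ultimately show "\<exists>i. 2 * i + 1 < card Y \<and> l = descending Y ! (2 * i + 1) \<and> u = descending Y ! (2 * i)"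
    using j k by (intro exI[of _ "j div 2"]) (auto elim!: oddE)
next
  assume "\<exists>i. 2 * i + 1 < card Y \<and> l = descending Y ! (2 * i + 1) \<and> u = descending Y ! (2 * i)"
  then obtain i where i: "2 * i + 1 < card Y" "l = descending Y ! (2 * i + 1)" "u = descending Y ! (2 * i)"
    by blast
  have "\<not> (l < y \<and> y < u)" if "y \<in> Y" for y
  proof
    assume y: "l < y \<and> y < u"
    obtain j where j: "j < card Y" "y = descending Y ! j"
      using descending_ex[OF assms \<open>y \<in> Y\<close>] by blast
    have "2 * i < j" using y j i descending_less[OF assms, of j "2 * i"]
      by (metis add_lessD1 less_asym less_irrefl linorder_neqE_nat)
    moreover have "j < 2 * i + 1" using y j i descending_less[OF assms, of "2 * i + 1" j]
      by (metis less_asym less_irrefl linorder_neqE_nat)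
    ultimately show False by simp
  qed
  then show "is_int Y l u"
    using i above_descending[OF assms i(1)] descending_in[OF assms] descending_less[OF assms, of "2 * i" "2 * i + 1"]
    by (simp add: is_int_def)
qed

lemma lies_inside_eq: "cyc Y \<Longrightarrow> lies_inside X Y \<longleftrightarrow> inside Y (Max X)"
proof -
  assume Y: "cyc Y"
  have "lies_inside X Y \<longleftrightarrow> (\<exists>l u. is_int Y l u \<and> l < Max X \<and> Max X < u)"
    unfolding lies_inside_def is_int_descending[OF cycD(2)[OF Y]] by blast
  also have "\<dots> \<longleftrightarrow> inside Y (Max X)"
  proof
    assume "\<exists>l u. is_int Y l u \<and> l < Max X \<and> Max X < u"
    then obtain l u where "is_int Y l u" "l < Max X" "Max X < u" by blast
    then show "inside Y (Max X)" using int_inside[of Y l u "Max X"] by (auto simp: is_int_def)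
  next
    assume i: "inside Y (Max X)"
    then obtain l u where lu: "is_int Y l u" "l \<le> Max X" "Max X \<le> u" using int_exists[OF Y] by blast
    moreover have "Max X \<noteq> l" "Max X \<noteq> u" using i lu(1) by (auto simp: inside_def is_int_def)
    ultimately show "\<exists>l u. is_int Y l u \<and> l < Max X \<and> Max X < u" by (auto simp: le_less)
  qed
  finally show ?thesis .
qed

lemma maximal_components_eq: "maximal_components n as bs = {Y. maximal Y}"
  unfolding maximal_components_def meander_components_eq maximal_def cycles_eq
  using lies_inside_eq by blast

lemma dimension_owner:
  assumes "x < n"
  shows "dimension n as bs (owner x) = Suc (len x)"
proof (cases "cyc (owner x)")
  case True
  have "{Y \<in> cycles n as bs. lies_inside Y (owner x)} = {Z. cyc Z \<and> inside (owner x) (Max Z)}"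
    "{Y \<in> segments n as bs. lies_inside Y (owner x)} = {Z \<in> comps. \<not> cyc Z \<and> inside (owner x) (Max Z)}"
    using lies_inside_eq[OF True] by (auto simp: cycles_eq segments_eq)
  then show ?thesis
    using interval_length[OF assms True] True by (simp add: dimension_def cycles_eq)
next
  case False
  then show ?thesis using lo_hi_not_cyc[OF assms False] by (simp add: dimension_def cycles_eq len_def)
qed

end

section \<open>Matrices and the Zariski topology\<close>

lemma mult_mat_entry:
  assumes "A \<in> carrier_mat n m" "B \<in> carrier_mat m l" "i < n" "j < l"
  shows "(A * B) $$ (i, j) = (\<Sum>k<m. A $$ (i, k) * B $$ (k, j))"
  using assms by (simp add: scalar_prod_def atLeast0LessThan)

lemma GL_simps: "x \<otimes>\<^bsub>GL n\<^esub> y = x * y" "\<one>\<^bsub>GL n\<^esub> = 1\<^sub>m n"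
  by (simp_all add: GL_def units_of_def ring_mat_simps)

lemma GL_group: "group (GL n)"
proof -
  interpret ring "ring_mat TYPE(complex) n ()" by (rule ring_mat)
  show ?thesis unfolding GL_def by (rule units_group)
qed

lemma GL_carrier_det: "A \<in> carrier (GL n) \<longleftrightarrow> A \<in> carrier_mat n n \<and> det A \<noteq> 0"
  unfolding GL_def units_of_carrier
  using det_non_zero_imp_unit[of A n "()"] unit_imp_det_non_zero[of A n "()"]
  by (auto simp: Units_def ring_mat_simps)

lemma GL_carrier_mat: "A \<in> carrier (GL n) \<Longrightarrow> A \<in> carrier_mat n n"
  by (simp add: GL_carrier_det)

lemma GL_carrierI:
  fixes A B :: "complex mat"
  assumes "A \<in> carrier_mat n n" "B \<in> carrier_mat n n" "A * B = 1\<^sub>m n"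
  shows "A \<in> carrier (GL n)"
  using assms det_mult[OF assms(1,2)] by (auto simp: GL_carrier_det)

lemma GL_inv:
  assumes "A \<in> carrier (GL n)"
  shows "inv\<^bsub>GL n\<^esub> A \<in> carrier (GL n)" "inv\<^bsub>GL n\<^esub> A \<in> carrier_mat n n"
    "A * inv\<^bsub>GL n\<^esub> A = 1\<^sub>m n" "inv\<^bsub>GL n\<^esub> A * A = 1\<^sub>m n"
proof -
  interpret group "GL n" by (rule GL_group)
  show "inv\<^bsub>GL n\<^esub> A \<in> carrier (GL n)" using assms by simp
  then show "inv\<^bsub>GL n\<^esub> A \<in> carrier_mat n n" by (rule GL_carrier_mat)
  show "A * inv\<^bsub>GL n\<^esub> A = 1\<^sub>m n" "inv\<^bsub>GL n\<^esub> A * A = 1\<^sub>m n"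
    using r_inv[OF assms] l_inv[OF assms] by (simp_all add: GL_simps)
qed

lemma GL_inv_eqI:
  assumes "A \<in> carrier_mat n n" "B \<in> carrier_mat n n" "A * B = 1\<^sub>m n"
  shows "inv\<^bsub>GL n\<^esub> A = B"
proof -
  interpret group "GL n" by (rule GL_group)
  have BA: "B * A = 1\<^sub>m n" using mat_mult_left_right_inverse[OF assms] .
  show ?thesis
    by (rule inv_equality) (use GL_carrierI[OF assms(1,2,3)] GL_carrierI[OF assms(2,1) BA] BA in \<open>auto simp: GL_simps\<close>)
qed

lemma GL_mult: "A \<in> carrier (GL n) \<Longrightarrow> B \<in> carrier (GL n) \<Longrightarrow> A * B \<in> carrier (GL n)"
  using monoid.m_closed[OF group.is_monoid[OF GL_group[of n]], of A B] by (simp add: GL_simps)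

lemma GL_one: "1\<^sub>m n \<in> carrier (GL n)"
  by (simp add: GL_carrier_det)

section \<open>Polynomial functions and Zariski-closed sets\<close>

lemma poly_funs_sum:
  assumes "\<And>x. x \<in> A \<Longrightarrow> f x \<in> poly_funs C"
  shows "(\<lambda>T. \<Sum>x\<in>A. f x T) \<in> poly_funs C"
  using assms by (induction A rule: infinite_finite_induct) (auto intro: poly_funs.intros)

lemma poly_funs_prod:
  assumes "\<And>x. x \<in> A \<Longrightarrow> f x \<in> poly_funs C"
  shows "(\<lambda>T. \<Prod>x\<in>A. f x T) \<in> poly_funs C"
  using assms by (induction A rule: infinite_finite_induct) (auto intro: poly_funs.intros)

lemma poly_funs_diff:
  "f \<in> poly_funs C \<Longrightarrow> g \<in> poly_funs C \<Longrightarrow> (\<lambda>T. f T - g T) \<in> poly_funs C"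
  using poly_funs.add[of f C, OF _ poly_funs.mult[OF poly_funs.const[of "-1"], of g]] by simp

lemma poly_funs_det:
  assumes "\<And>i j. i < m \<Longrightarrow> j < m \<Longrightarrow> (\<lambda>T. a T i j) \<in> poly_funs C"
  shows "(\<lambda>T. det (mat m m (\<lambda>(i, j). a T i j))) \<in> poly_funs C"
proof -
  have "(\<lambda>T. det (mat m m (\<lambda>(i, j). a T i j))) =
    (\<lambda>T. \<Sum>p \<in> {p. p permutes {0..<m}}. signof p * (\<Prod>i = 0..<m. a T i (p i)))"
  proof
    fix T
    have "(\<Prod>i = 0..<m. mat m m (\<lambda>(i, j). a T i j) $$ (i, p i)) = (\<Prod>i = 0..<m. a T i (p i))"
      if "p permutes {0..<m}" for p
      using permutes_in_image[OF that] by (intro prod.cong) auto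
    then show "det (mat m m (\<lambda>(i, j). a T i j)) =
        (\<Sum>p \<in> {p. p permutes {0..<m}}. signof p * (\<Prod>i = 0..<m. a T i (p i)))"
      by (subst det_def'[of _ m]) auto
  qed
  moreover have "p i < m" if "p permutes {0..<m}" "i < m" for p i
    using permutes_in_image[OF that(1), of i] that(2) by simp
  ultimately show ?thesis
    using assms by (auto intro!: poly_funs_sum poly_funs.mult poly_funs_prod poly_funs.const)
qed

lemma zariski_open_basic:
  assumes "openin (zariski C) U" "x \<in> U"
  shows "\<exists>f \<in> poly_funs C. f x \<noteq> 0 \<and> (\<forall>y. f y \<noteq> 0 \<longrightarrow> y \<in> U)"
proof -
  have "generate_topology_on {{x. f x \<noteq> 0} | f. f \<in> poly_funs C} U"
    using assms(1) by (simp add: zariski_def openin_topology_generated_by_iff)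
  then show ?thesis using assms(2)
  proof (induction arbitrary: x rule: generate_topology_on.induct)
    case (Int a b)
    then obtain f g where "f \<in> poly_funs C" "g \<in> poly_funs C" "f x \<noteq> 0" "g x \<noteq> 0"
      "\<forall>y. f y \<noteq> 0 \<longrightarrow> y \<in> a" "\<forall>y. g y \<noteq> 0 \<longrightarrow> y \<in> b" by blast
    then have "(\<lambda>x. f x * g x) \<in> poly_funs C" "f x * g x \<noteq> 0" "\<forall>y. f y * g y \<noteq> 0 \<longrightarrow> y \<in> a \<inter> b"
      by (simp_all add: poly_funs.mult)
    then show ?case by (intro bexI[of _ "\<lambda>x. f x * g x"] conjI)
  next
    case (UN K)
    then obtain k where k: "k \<in> K" "x \<in> k" by blast
    with UN.IH[OF k] show ?case by blast
  next
    case (Basis s)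
    then show ?case by blast
  qed simp
qed

lemma zariski_open: "f \<in> poly_funs C \<Longrightarrow> openin (zariski C) {x. f x \<noteq> 0}"
  unfolding zariski_def by (rule topology_generated_by_Basis) blast

lemma topspace_zariski: "topspace (zariski C) = UNIV"
proof -
  have "openin (zariski C) {x. (1::complex) \<noteq> 0}"
    using zariski_open[OF poly_funs.const[of 1]] .
  then show ?thesis using openin_subset by fastforce
qed

lemma closedin_zariskiI:
  assumes "G \<subseteq> S" "\<And>x. x \<in> S \<Longrightarrow> x \<notin> G \<Longrightarrow> \<exists>f \<in> poly_funs C. f x \<noteq> 0 \<and> (\<forall>y\<in>G. f y = 0)"
  shows "closedin (subtopology (zariski C) S) G"
proof -
  let ?U = "\<Union>{{x. f x \<noteq> 0} | f. f \<in> poly_funs C \<and> (\<forall>y\<in>G. f y = 0)}"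
  have "openin (zariski C) ?U" using zariski_open by (intro openin_Union) auto
  moreover have "S - G = ?U \<inter> S" using assms(2) by blast
  ultimately have "openin (subtopology (zariski C) S) (S - G)"
    unfolding openin_subtopology by blast
  then show ?thesis using assms(1) by (simp add: closedin_def topspace_zariski)
qed

lemma closedin_zariskiD:
  assumes "closedin (subtopology (zariski C) S) G" "x \<in> S" "x \<notin> G"
  shows "\<exists>f \<in> poly_funs C. f x \<noteq> 0 \<and> (\<forall>y\<in>G. f y = 0)"
proof -
  have "openin (subtopology (zariski C) S) (S - G)" "G \<subseteq> S"
    using assms(1) by (auto simp: closedin_def topspace_zariski)
  then obtain U where U: "openin (zariski C) U" "S - G = U \<inter> S"
    unfolding openin_subtopology by blast
  then obtain f where "f \<in> poly_funs C" "f x \<noteq> 0" "\<forall>y. f y \<noteq> 0 \<longrightarrow> y \<in> U"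
    using zariski_open_basic[OF U(1), of x] assms(2,3) by blast
  then show ?thesis using U(2) \<open>G \<subseteq> S\<close> by blast
qed

text \<open>The loci where \<open>f\<close> and where \<open>h\<close> is nonzero are open and split
  \<open>Q\<close>. For a function with only two possible values, \<open>f\<close> and
  \<open>h\<close> are its differences from these values; in \<open>Q_subset_inc\<close> they are 0
  and the determinant.\<close>

lemma connectedin_zariski_dichotomy:
  assumes "connectedin (zariski C) Q" "f \<in> poly_funs C" "h \<in> poly_funs C"
    and "\<And>x. x \<in> Q \<Longrightarrow> f x = 0 \<longleftrightarrow> h x \<noteq> 0" and "x0 \<in> Q" "f x0 \<noteq> 0" "x \<in> Q"
  shows "f x \<noteq> 0"
proof (rule ccontr)
  assume "\<not> f x \<noteq> 0"
  let ?U = "{x. f x \<noteq> 0}" and ?V = "{x. h x \<noteq> 0}"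
  have o: "openin (zariski C) ?U" "openin (zariski C) ?V" using zariski_open assms by blast+
  have "\<not> connectedin (zariski C) Q"
    unfolding connectedin
    using o assms \<open>\<not> f x \<noteq> 0\<close> by blast
  then show False using assms(1) by blast
qed

section \<open>The matrix exponential\<close>

lemma pow_mat_bound:
  fixes A :: "complex mat"
  assumes "A \<in> carrier_mat n n" "\<And>i j. i < n \<Longrightarrow> j < n \<Longrightarrow> norm (A $$ (i, j)) \<le> B" "0 \<le> B" "i < n" "j < n"
  shows "norm ((A ^\<^sub>m k) $$ (i, j)) \<le> (real n * B) ^ k"
  using assms(5)
proof (induction k arbitrary: j)
  case 0
  then show ?case using assms by simp
next
  case (Suc k)
  have "norm ((A ^\<^sub>m Suc k) $$ (i, j)) = norm (\<Sum>l<n. (A ^\<^sub>m k) $$ (i, l) * A $$ (l, j))"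
    using mult_mat_entry[of "A ^\<^sub>m k" n n A n i j] assms(1,4) Suc.prems by simp
  also have "\<dots> \<le> (\<Sum>l<n. norm ((A ^\<^sub>m k) $$ (i, l) * A $$ (l, j)))" by (rule norm_sum)
  also have "\<dots> \<le> (\<Sum>l<n. (real n * B) ^ k * B)"
    using Suc assms by (intro sum_mono) (auto simp: norm_mult intro!: mult_mono)
  also have "\<dots> = (real n * B) ^ Suc k" by simp
  finally show ?case .
qed

lemma mat_exp_summable:
  fixes A :: "complex mat"
  assumes "A \<in> carrier_mat n n" "i < n" "j < n"
  shows "summable (\<lambda>k. (A ^\<^sub>m k) $$ (i, j) / fact k)"
proof -
  let ?B = "\<Sum>i<n. \<Sum>j<n. norm (A $$ (i, j))"
  have B: "norm (A $$ (i, j)) \<le> ?B" if "i < n" "j < n" for i j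
  proof -
    have "norm (A $$ (i, j)) \<le> (\<Sum>j<n. norm (A $$ (i, j)))"
      using that member_le_sum[of j "{..<n}" "\<lambda>j. norm (A $$ (i, j))"] by simp
    also have "\<dots> \<le> ?B"
      using that member_le_sum[of i "{..<n}" "\<lambda>i. \<Sum>j<n. norm (A $$ (i, j))"] by (simp add: sum_nonneg)
    finally show ?thesis .
  qed
  have "0 \<le> ?B" by (simp add: sum_nonneg)
  note bound = pow_mat_bound[OF assms(1) B this assms(2,3)]
  show ?thesis
  proof (rule summable_comparison_test'[where N = 0])
    show "summable (\<lambda>k. (real n * ?B) ^ k / fact k)"
      using summable_exp[of "real n * ?B"] by (simp add: field_simps)
    show "norm ((A ^\<^sub>m k) $$ (i, j) / fact k) \<le> (real n * ?B) ^ k / fact k" for k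
      using bound[of k] by (simp add: norm_divide divide_right_mono)
  qed
qed

lemma mat_exp_entry: "i < n \<Longrightarrow> j < n \<Longrightarrow> mat_exp n X $$ (i, j) = (\<Sum>k. (X ^\<^sub>m k) $$ (i, j) / fact k)"
  by (simp add: mat_exp_def)

lemma mat_exp_carrier [simp]:
  "mat_exp n X \<in> carrier_mat n n" "dim_row (mat_exp n X) = n" "dim_col (mat_exp n X) = n"
  by (simp_all add: mat_exp_def)

lemma conj_pow:
  fixes g h X :: "complex mat"
  assumes "g \<in> carrier_mat n n" "h \<in> carrier_mat n n" "X \<in> carrier_mat n n" "h * g = 1\<^sub>m n" "g * h = 1\<^sub>m n"
  shows "(g * X * h) ^\<^sub>m k = g * X ^\<^sub>m k * h"
proof (induction k)
  case 0
  then show ?case using assms by simp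
next
  case (Suc k)
  have P: "X ^\<^sub>m k \<in> carrier_mat n n" using assms by simp
  have "(g * X * h) ^\<^sub>m Suc k = g * X ^\<^sub>m k * h * (g * X * h)" using Suc by simp
  also have "\<dots> = g * X ^\<^sub>m k * (h * (g * X * h))" using assms P by (intro assoc_mult_mat) auto
  also have "h * (g * X * h) = h * (g * (X * h))" using assms by simp
  also have "\<dots> = h * g * (X * h)" using assms by (intro assoc_mult_mat[symmetric]) auto
  also have "\<dots> = X * h" using assms by simp
  also have "g * X ^\<^sub>m k * (X * h) = g * X ^\<^sub>m k * X * h"
    using assms P by (intro assoc_mult_mat[symmetric]) auto
  also have "g * X ^\<^sub>m k * X = g * (X ^\<^sub>m k * X)" using assms P by (intro assoc_mult_mat) auto
  finally show ?case by simp
qed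

lemma triple_entry:
  assumes "g \<in> carrier_mat n n" "h \<in> carrier_mat n n" "X \<in> carrier_mat n n" "i < n" "j < n"
  shows "(g * X * h) $$ (i, j) = (\<Sum>l<n. \<Sum>k<n. g $$ (i, k) * X $$ (k, l) * h $$ (l, j))"
proof -
  have "(g * X * h) $$ (i, j) = (\<Sum>l<n. (g * X) $$ (i, l) * h $$ (l, j))"
    using assms by (intro mult_mat_entry) auto
  also have "\<dots> = (\<Sum>l<n. \<Sum>k<n. g $$ (i, k) * X $$ (k, l) * h $$ (l, j))"
    using mult_mat_entry[OF assms(1,3,4)] by (intro sum.cong) (auto simp: sum_distrib_right)
  finally show ?thesis .
qed

lemma mat_exp_conj:
  fixes g h X :: "complex mat"
  assumes "g \<in> carrier_mat n n" "h \<in> carrier_mat n n" "X \<in> carrier_mat n n" "h * g = 1\<^sub>m n" "g * h = 1\<^sub>m n"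
  shows "mat_exp n (g * X * h) = g * mat_exp n X * h"
proof (rule eq_matI)
  fix i j assume "i < dim_row (g * mat_exp n X * h)" "j < dim_col (g * mat_exp n X * h)"
  then have ij: "i < n" "j < n" using assms by auto
  have "(\<lambda>k. \<Sum>l<n. \<Sum>m<n. g $$ (i, m) * ((X ^\<^sub>m k) $$ (m, l) / fact k) * h $$ (l, j)) sums
      (\<Sum>l<n. \<Sum>m<n. g $$ (i, m) * mat_exp n X $$ (m, l) * h $$ (l, j))"
  proof (intro sums_sum sums_mult2 sums_mult)
    fix l m assume "l \<in> {..<n}" "m \<in> {..<n}"
    then show "(\<lambda>k. (X ^\<^sub>m k) $$ (m, l) / fact k) sums mat_exp n X $$ (m, l)"
      using mat_exp_summable[OF assms(3), of m l] by (simp add: mat_exp_entry summable_sums)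
  qed
  moreover have "(\<Sum>l<n. \<Sum>m<n. g $$ (i, m) * ((X ^\<^sub>m k) $$ (m, l) / fact k) * h $$ (l, j)) =
      ((g * X * h) ^\<^sub>m k) $$ (i, j) / fact k" for k
    using triple_entry[OF assms(1,2) _ ij, of "X ^\<^sub>m k"] assms(3)
    by (simp add: conj_pow[OF assms] sum_divide_distrib)
  ultimately show "mat_exp n (g * X * h) $$ (i, j) = (g * mat_exp n X * h) $$ (i, j)"
    using triple_entry[OF assms(1,2) mat_exp_carrier(1) ij] ij by (simp add: mat_exp_entry sums_iff)
qed (use assms in auto)

lemma smult_pow:
  fixes N :: "complex mat"
  assumes "N \<in> carrier_mat n n"
  shows "(t \<cdot>\<^sub>m N) ^\<^sub>m k = t ^ k \<cdot>\<^sub>m (N ^\<^sub>m k)"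
proof (induction k)
  case 0
  then show ?case using assms by (intro eq_matI) auto
next
  case (Suc k)
  have P: "N ^\<^sub>m k \<in> carrier_mat n n" using assms by simp
  have "(t \<cdot>\<^sub>m N) ^\<^sub>m Suc k = t ^ k \<cdot>\<^sub>m (N ^\<^sub>m k) * (t \<cdot>\<^sub>m N)" using Suc by simp
  also have "\<dots> = t ^ k \<cdot>\<^sub>m (N ^\<^sub>m k * (t \<cdot>\<^sub>m N))"
    using assms P by (intro mult_smult_assoc_mat[of _ n n _ n]) auto
  also have "N ^\<^sub>m k * (t \<cdot>\<^sub>m N) = t \<cdot>\<^sub>m (N ^\<^sub>m k * N)"
    using assms P by (intro mult_smult_distrib[of _ n n _ n]) auto
  finally show ?case by (auto simp: mult.commute)
qed

lemma smult_conj: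
  fixes g h X :: "complex mat"
  assumes "g \<in> carrier_mat n n" "h \<in> carrier_mat n n" "X \<in> carrier_mat n n"
  shows "g * (t \<cdot>\<^sub>m X) * h = t \<cdot>\<^sub>m (g * X * h)"
  using assms by (simp add: mult_smult_distrib[of g n n X n] mult_smult_assoc_mat[of "g * X" n n h n])

text \<open>All positive powers of \<open>N\<close> are multiples of \<open>N\<close>, so the series
  collapses to a scalar one. The branch \<open>c = 0\<close> is the limit of the other. Every matrix
  of rank one is of this kind.\<close>

lemma mat_exp_scaled_idempotent:
  fixes N :: "complex mat"
  assumes N: "N \<in> carrier_mat n n" and NN: "N * N = c \<cdot>\<^sub>m N"
  shows "mat_exp n (t \<cdot>\<^sub>m N) = 1\<^sub>m n + (if c = 0 then t else (exp (t * c) - 1) / c) \<cdot>\<^sub>m N"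
proof (rule eq_matI)
  let ?\<phi> = "if c = 0 then t else (exp (t * c) - 1) / c"
  fix i j assume "i < dim_row (1\<^sub>m n + ?\<phi> \<cdot>\<^sub>m N)" "j < dim_col (1\<^sub>m n + ?\<phi> \<cdot>\<^sub>m N)"
  then have ij: "i < n" "j < n" using N by auto
  have pow: "N ^\<^sub>m Suc k = c ^ k \<cdot>\<^sub>m N" for k
  proof (induction k)
    case 0
    show ?case using N by (intro eq_matI) auto
  next
    case (Suc k)
    have "N ^\<^sub>m Suc (Suc k) = c ^ k \<cdot>\<^sub>m N * N" using Suc by simp
    also have "\<dots> = c ^ k \<cdot>\<^sub>m (N * N)" using N by (intro mult_smult_assoc_mat[of _ n n _ n]) auto
    finally show ?case using N by (auto simp: NN mult.commute)
  qed
  let ?a = "\<lambda>k. ((t \<cdot>\<^sub>m N) ^\<^sub>m k) $$ (i, j) / fact k"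
  have aS: "?a (Suc k) = (t ^ Suc k * c ^ k / fact (Suc k)) * N $$ (i, j)" for k
    using ij N by (simp add: smult_pow[OF N] pow del: pow_mat.simps)
  have "(\<lambda>k. t ^ Suc k * c ^ k / fact (Suc k)) sums ?\<phi>"
  proof (cases "c = 0")
    case True
    have "(\<lambda>k. t ^ Suc k * c ^ k / fact (Suc k)) sums (t ^ Suc 0 * c ^ 0 / fact (Suc 0))"
      using True by (intro sums_single[of 0 "\<lambda>k. t ^ Suc k * c ^ k / fact (Suc k)", THEN sums_cong[THEN iffD1, rotated]]) auto
    then show ?thesis using True by simp
  next
    case False
    have "(\<lambda>k. (t * c) ^ k / fact k) sums exp (t * c)"
      using exp_converges[of "t * c"] by (simp add: scaleR_conv_of_real field_simps)
    then have "(\<lambda>k. (t * c) ^ Suc k / fact (Suc k)) sums (exp (t * c) - 1)"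
      by (subst sums_Suc_iff) simp
    then have "(\<lambda>k. (t * c) ^ Suc k / fact (Suc k) / c) sums ((exp (t * c) - 1) / c)"
      by (rule sums_divide)
    then show ?thesis using False by (simp add: power_mult_distrib mult_ac)
  qed
  then have "(\<lambda>k. ?a (Suc k)) sums (?\<phi> * N $$ (i, j))"
    unfolding aS by (rule sums_mult2)
  then have "?a sums (?\<phi> * N $$ (i, j) + ?a 0)" by (subst (asm) sums_Suc_iff) simp
  then show "mat_exp n (t \<cdot>\<^sub>m N) $$ (i, j) = (1\<^sub>m n + ?\<phi> \<cdot>\<^sub>m N) $$ (i, j)"
    using ij N by (simp add: mat_exp_entry sums_iff)
qed (use N in auto)

text \<open>The entry is a power series in \<open>t\<close> that vanishes identically; dividing it
  by \<open>t\<close> and letting \<open>t\<close> tend to 0 isolates the linear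
  coefficient.\<close>

lemma mat_exp_off_diagonal:
  fixes X :: "complex mat"
  assumes X: "X \<in> carrier_mat n n" and ij: "i < n" "j < n" "i \<noteq> j"
    and zero: "\<And>t. mat_exp n (t \<cdot>\<^sub>m X) $$ (i, j) = 0"
  shows "X $$ (i, j) = 0"
proof -
  let ?a = "\<lambda>k. (X ^\<^sub>m k) $$ (i, j) / fact k"
  have s: "(\<lambda>k. ?a k * t ^ k) sums 0" for t
  proof -
    have "(\<lambda>k. ((t \<cdot>\<^sub>m X) ^\<^sub>m k) $$ (i, j) / fact k) sums mat_exp n (t \<cdot>\<^sub>m X) $$ (i, j)"
      using mat_exp_summable[of "t \<cdot>\<^sub>m X" n i j] X ij by (simp add: mat_exp_entry summable_sums)
    then show ?thesis using zero[of t] X ij by (simp add: smult_pow[OF X] mult.commute)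
  qed
  have a0: "?a 0 = 0" using X ij by simp
  define b where "b = (\<lambda>k. ?a (Suc k))"
  have "((\<lambda>t::complex. 0) \<longlongrightarrow> b 0) (at 0)"
  proof (rule powser_limit_0_strong[where s = 1])
    fix t :: complex assume "t \<noteq> 0"
    have "(\<lambda>k. ?a (Suc k) * t ^ Suc k) sums 0"
      using s[of t] a0 by (subst sums_Suc_iff) simp
    then have "(\<lambda>k. ?a (Suc k) * t ^ Suc k / t) sums (0 / t)" by (rule sums_divide)
    then show "(\<lambda>k. b k * t ^ k) sums 0" using \<open>t \<noteq> 0\<close> by (simp add: b_def)
  qed simp
  then have "b 0 = 0" using LIM_const_eq by metis
  then show ?thesis using X ij by (simp add: b_def)
qed

section \<open>Connected groups of incidence algebras\<close>

lemma mult_mat_vec_entry: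
  assumes "A \<in> carrier_mat n m" "v \<in> carrier_vec m" "i < n"
  shows "(A *\<^sub>v v) $ i = (\<Sum>k<m. A $$ (i, k) * v $ k)"
  using assms by (simp add: scalar_prod_def atLeast0LessThan)

lemma complex_log_exists:
  assumes "w \<noteq> 0"
  shows "\<exists>z. exp z = (w :: complex)"
proof -
  have "exp (complex_of_real (ln (cmod w)) + \<i> * complex_of_real (Arg w)) = rcis (cmod w) (Arg w)"
    using assms by (simp add: exp_add exp_of_real rcis_def cis_conv_exp)
  then show ?thesis using rcis_cmod_Arg[of w] by metis
qed

locale incidence =
  fixes n :: nat and R :: "nat \<Rightarrow> nat \<Rightarrow> bool"
  assumes R_refl: "i < n \<Longrightarrow> R i i"
    and R_trans: "i < n \<Longrightarrow> j < n \<Longrightarrow> k < n \<Longrightarrow> R i j \<Longrightarrow> R j k \<Longrightarrow> R i k"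
begin

definition inc :: "complex mat set" where
  "inc = {A \<in> carrier_mat n n. \<forall>i<n. \<forall>j<n. \<not> R i j \<longrightarrow> A $$ (i, j) = 0}"

definition unit_mat :: "nat \<Rightarrow> nat \<Rightarrow> complex mat" where
  "unit_mat i j = mat n n (\<lambda>(k, l). if k = i \<and> l = j then 1 else 0)"

lemma unit_mat_carrier [simp]:
  "unit_mat i j \<in> carrier_mat n n" "dim_row (unit_mat i j) = n" "dim_col (unit_mat i j) = n"
  by (simp_all add: unit_mat_def)

lemma unit_mat_entry: "k < n \<Longrightarrow> l < n \<Longrightarrow> unit_mat i j $$ (k, l) = (if k = i \<and> l = j then 1 else 0)"
  by (simp add: unit_mat_def)

lemma inc_carrier: "A \<in> inc \<Longrightarrow> A \<in> carrier_mat n n"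
  by (simp add: inc_def)

lemma inc_nonzero: "A \<in> inc \<Longrightarrow> i < n \<Longrightarrow> j < n \<Longrightarrow> A $$ (i, j) \<noteq> 0 \<Longrightarrow> R i j"
  by (auto simp: inc_def)

lemma incI: "A \<in> carrier_mat n n \<Longrightarrow> (\<And>i j. i < n \<Longrightarrow> j < n \<Longrightarrow> A $$ (i, j) \<noteq> 0 \<Longrightarrow> R i j) \<Longrightarrow> A \<in> inc"
  unfolding inc_def by blast

lemma unit_mat_inc: "i < n \<Longrightarrow> j < n \<Longrightarrow> R i j \<Longrightarrow> unit_mat i j \<in> inc"
  by (rule incI) (auto simp: unit_mat_entry split: if_splits)

lemma inc_one: "1\<^sub>m n \<in> inc"
  by (rule incI) (auto simp: R_refl split: if_splits)

lemma inc_add: "A \<in> inc \<Longrightarrow> B \<in> inc \<Longrightarrow> A + B \<in> inc"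
  by (auto simp: inc_def)

lemma inc_smult: "A \<in> inc \<Longrightarrow> c \<cdot>\<^sub>m A \<in> inc"
  by (auto simp: inc_def)

lemma inc_mult:
  assumes "A \<in> inc" "B \<in> inc"
  shows "A * B \<in> inc"
proof (rule incI)
  note c = inc_carrier[OF assms(1)] inc_carrier[OF assms(2)]
  show "A * B \<in> carrier_mat n n" using c by simp
  fix i j assume ij: "i < n" "j < n" "(A * B) $$ (i, j) \<noteq> 0"
  then obtain k where "k < n" "A $$ (i, k) * B $$ (k, j) \<noteq> 0"
    using mult_mat_entry[OF c ij(1,2)] by (metis (no_types, lifting) lessThan_iff sum.neutral)
  then show "R i j" using inc_nonzero assms ij R_trans[of i k j] by auto
qed

text \<open>The columns of the inverse are found by solving the equation in the span of an order ideal.\<close>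

lemma inc_inverse:
  assumes A: "A \<in> inc" and B: "B \<in> carrier_mat n n" and AB: "A * B = 1\<^sub>m n"
  shows "B \<in> inc"
proof (rule incI[OF B])
  note Ac = inc_carrier[OF A]
  have BA: "B * A = 1\<^sub>m n" using mat_mult_left_right_inverse[OF Ac B AB] .
  fix i j assume ij: "i < n" "j < n" "B $$ (i, j) \<noteq> 0"
  let ?T = "\<lambda>k. R k j"
  define A' where "A' = mat n n (\<lambda>(i, k). if ?T k then A $$ (i, k) else if i = k then 1 else 0)"
  have A'c: "A' \<in> carrier_mat n n" by (simp add: A'_def)
  have outside: "(A' *\<^sub>v v) $ i = v $ i" if v: "v \<in> carrier_vec n" and i: "i < n" "\<not> ?T i" for v i
  proof -
    have "(A' *\<^sub>v v) $ i = (\<Sum>k<n. if i = k then v $ k else 0)"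
      unfolding mult_mat_vec_entry[OF A'c v i(1)]
    proof (rule sum.cong[OF HOL.refl])
      fix k assume "k \<in> {..<n}"
      then have k: "k < n" by simp
      have "A $$ (i, k) = 0" if "?T k"
        using inc_nonzero[OF A i(1) k] R_trans[OF i(1) k ij(2)] that i(2) by blast
      then show "A' $$ (i, k) * v $ k = (if i = k then v $ k else 0)"
        using i k by (auto simp: A'_def)
    qed
    then show ?thesis using i by simp
  qed
  have same: "A' *\<^sub>v v = A *\<^sub>v v" if v: "v \<in> carrier_vec n" and z: "\<And>k. k < n \<Longrightarrow> \<not> ?T k \<Longrightarrow> v $ k = 0" for v
  proof (rule eq_vecI)
    fix i assume "i < dim_vec (A *\<^sub>v v)"
    then have i: "i < n" using Ac by simp
    show "(A' *\<^sub>v v) $ i = (A *\<^sub>v v) $ i"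
      unfolding mult_mat_vec_entry[OF A'c v i] mult_mat_vec_entry[OF Ac v i]
      using z i by (intro sum.cong[OF HOL.refl]) (auto simp: A'_def)
  qed (use Ac A'c in simp)
  have detA: "det A \<noteq> 0" using GL_carrierI[OF Ac B AB] by (simp add: GL_carrier_det)
  have "det A' \<noteq> 0"
  proof
    assume "det A' = 0"
    then obtain v where v: "v \<in> carrier_vec n" "v \<noteq> 0\<^sub>v n" "A' *\<^sub>v v = 0\<^sub>v n"
      using det_0_iff_vec_prod_zero_field[OF A'c] by blast
    have "v $ k = 0" if "k < n" "\<not> ?T k" for k using outside[OF v(1) that] v(3) that by simp
    then have "A *\<^sub>v v = 0\<^sub>v n" using same[OF v(1)] v(3) by simp
    then show False using det_0_iff_vec_prod_zero_field[OF Ac] v detA by blast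
  qed
  then have gl: "A' \<in> carrier (GL n)" using A'c by (simp add: GL_carrier_det)
  let ?C = "inv\<^bsub>GL n\<^esub> A'"
  note C = GL_inv[OF gl]
  let ?w = "?C *\<^sub>v unit_vec n j"
  have w: "?w \<in> carrier_vec n" using C by simp
  have "A' *\<^sub>v ?w = unit_vec n j"
    using C(2,3) A'c by (subst assoc_mult_mat_vec[symmetric, of _ n n _ n]) auto
  moreover from this have wz: "?w $ k = 0" if "k < n" "\<not> ?T k" for k
  proof -
    have "k \<noteq> j" using that R_refl ij by blast
    then show ?thesis using outside[OF w that] \<open>A' *\<^sub>v ?w = unit_vec n j\<close> that(1) ij(2) by simp
  qed
  ultimately have "A *\<^sub>v ?w = unit_vec n j" using same[OF w] by simp
  then have "B *\<^sub>v unit_vec n j = B *\<^sub>v (A *\<^sub>v ?w)" by simp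
  also have "\<dots> = ?w"
    using BA w Ac B by (subst assoc_mult_mat_vec[symmetric, of _ n n _ n]) auto
  finally have "B *\<^sub>v unit_vec n j = ?w" .
  moreover have "(B *\<^sub>v unit_vec n j) $ i = B $$ (i, j)" using B ij by simp
  ultimately show "R i j" using wz[OF ij(1)] ij(3) by metis
qed

lemma inc_inv:
  assumes "A \<in> inc" "A \<in> carrier (GL n)"
  shows "inv\<^bsub>GL n\<^esub> A \<in> inc"
  using inc_inverse[OF assms(1)] GL_inv[OF assms(2)] by blast

section \<open>Filling in a matrix entry by entry\<close>

definition partial :: "complex mat \<Rightarrow> nat \<Rightarrow> complex mat" where
  "partial G k = mat n n (\<lambda>(i, j). if i * n + j < k then G $$ (i, j) else 0)"

lemma partial_carrier [simp]:
  "partial G k \<in> carrier_mat n n" "dim_row (partial G k) = n" "dim_col (partial G k) = n"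
  by (simp_all add: partial_def)

lemma partial_Suc:
  assumes G: "G \<in> inc"
  shows "partial G (Suc k) = partial G k \<or>
    (\<exists>i j. i < n \<and> j < n \<and> R i j \<and> partial G (Suc k) = partial G k + G $$ (i, j) \<cdot>\<^sub>m unit_mat i j)"
proof (cases "\<exists>i j. i < n \<and> j < n \<and> i * n + j = k \<and> R i j")
  case True
  then obtain i j where ij: "i < n" "j < n" "i * n + j = k" "R i j" by blast
  have uniq: "i' = i \<and> j' = j" if "i' * n + j' = k" "j' < n" for i' j'
  proof -
    have "(i' * n + j') div n = i'" using that(2) by simp
    moreover have "(i * n + j) div n = i" using ij(2) by simp
    ultimately have "i' = i" using that(1) ij(3) by simp
    then show ?thesis using that ij by simp
  qed
  have "partial G (Suc k) = partial G k + G $$ (i, j) \<cdot>\<^sub>m unit_mat i j"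
  proof (rule eq_matI)
    fix k' l' assume "k' < dim_row (partial G k + G $$ (i, j) \<cdot>\<^sub>m unit_mat i j)"
      "l' < dim_col (partial G k + G $$ (i, j) \<cdot>\<^sub>m unit_mat i j)"
    then have kl: "k' < n" "l' < n" by auto
    have "k' * n + l' < Suc k \<longleftrightarrow> k' * n + l' < k \<or> k' = i \<and> l' = j"
      using uniq[OF _ kl(2), of k'] ij(3) by (auto simp: less_Suc_eq)
    moreover have "\<not> (k' * n + l' < k \<and> k' = i \<and> l' = j)" using ij(3) by auto
    ultimately show "partial G (Suc k) $$ (k', l') = (partial G k + G $$ (i, j) \<cdot>\<^sub>m unit_mat i j) $$ (k', l')"
      using kl by (auto simp: partial_def unit_mat_entry)
  qed auto
  then show ?thesis using ij by blast
next
  case False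
  have "partial G (Suc k) = partial G k"
  proof (rule eq_matI)
    fix i j assume "i < dim_row (partial G k)" "j < dim_col (partial G k)"
    then have "i < n" "j < n" by auto
    moreover from this have "i * n + j = k \<Longrightarrow> G $$ (i, j) = 0" using False inc_nonzero[OF G] by blast
    ultimately show "partial G (Suc k) $$ (i, j) = partial G k $$ (i, j)"
      by (auto simp: partial_def less_Suc_eq)
  qed auto
  then show ?thesis by blast
qed

lemma partial_late:
  assumes "n * n \<le> k" "G \<in> carrier_mat n n"
  shows "partial G k = G"
proof (rule eq_matI)
  fix i j assume "i < dim_row G" "j < dim_col G"
  then have ij: "i < n" "j < n" using assms by auto
  have "i * n + j < (i + 1) * n" using ij by simp
  also have "\<dots> \<le> n * n" using ij by (intro mult_right_mono) auto
  finally show "partial G k $$ (i, j) = G $$ (i, j)" using ij assms(1) by (simp add: partial_def)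
qed (use assms in auto)

lemma partial_inc: "G \<in> inc \<Longrightarrow> partial G k \<in> inc"
  by (intro incI) (auto simp: partial_def intro: inc_nonzero split: if_splits)

lemma inc_induct:
  assumes "G \<in> inc" and "P (0\<^sub>m n n)"
    and "\<And>A B. A \<in> inc \<Longrightarrow> B \<in> inc \<Longrightarrow> P A \<Longrightarrow> P B \<Longrightarrow> P (A + B)"
    and "\<And>i j c. i < n \<Longrightarrow> j < n \<Longrightarrow> R i j \<Longrightarrow> P (c \<cdot>\<^sub>m unit_mat i j)"
  shows "P G"
proof -
  have "P (partial G k)" for k
  proof (induction k)
    case 0
    have "partial G 0 = 0\<^sub>m n n" by (intro eq_matI) (auto simp: partial_def)
    then show ?case using assms(2) by simp
  next
    case (Suc k)
    from partial_Suc[OF assms(1), of k] show ?case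
    proof (elim disjE exE conjE)
      fix i j assume "i < n" "j < n" "R i j" "partial G (Suc k) = partial G k + G $$ (i, j) \<cdot>\<^sub>m unit_mat i j"
      then show ?thesis
        using assms(3)[OF partial_inc[OF assms(1), of k] inc_smult[OF unit_mat_inc] Suc assms(4)] by metis
    qed (use Suc in simp)
  qed
  then show ?thesis using partial_late[OF order_refl inc_carrier[OF assms(1)]] by metis
qed

end

section \<open>The units of the algebra belong to the group\<close>

locale incidence_group = incidence +
  fixes Q :: "complex mat set"
  assumes alg: "linear_algebraic_group n Q" and lie: "lie_algebra n Q = inc"
begin

lemma Q_GL: "Q \<subseteq> carrier (GL n)"
  using alg subgroup.subset by (auto simp: linear_algebraic_group_def)

lemma Q_subgroup: "subgroup Q (GL n)"
  using alg by (simp add: linear_algebraic_group_def)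

lemma Q_mult: "A \<in> Q \<Longrightarrow> B \<in> Q \<Longrightarrow> A * B \<in> Q"
  using subgroup.m_closed[OF Q_subgroup, of A B] by (simp add: GL_simps)

lemma mat_exp_in_Q: "X \<in> inc \<Longrightarrow> mat_exp n (t \<cdot>\<^sub>m X) \<in> Q"
  using lie by (auto simp: lie_algebra_def)

text \<open>Solving \<open>exp (s * c) = 1 + t * c\<close> for \<open>s\<close> exhibits the matrix
  as the exponential of \<open>s\<close> times \<open>N\<close>.\<close>

lemma scaled_idempotent_in_Q:
  assumes N: "N \<in> inc" and NN: "N * N = c \<cdot>\<^sub>m N" and inv: "1 + t * c \<noteq> 0"
  shows "1\<^sub>m n + t \<cdot>\<^sub>m N \<in> Q"
proof -
  obtain z where z: "exp z = 1 + t * c" using complex_log_exists inv by blast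
  define s where "s = (if c = 0 then t else z / c)"
  have "(if c = 0 then s else (exp (s * c) - 1) / c) = t"
    using z by (auto simp: s_def)
  then show ?thesis
    using mat_exp_in_Q[OF N, of s] mat_exp_scaled_idempotent[OF inc_carrier[OF N] NN, of s] by simp
qed

text \<open>\<open>A + t E\<close> factors as \<open>A (1 + t N)\<close>, where \<open>N\<close> is
  the inverse of \<open>A\<close> times the matrix unit \<open>E\<close>. As \<open>N\<close> has
  rank one, its square is a multiple of \<open>N\<close>, and \<open>1 + t N\<close> is an
  exponential.\<close>

lemma add_unit_mat_in_Q:
  assumes A: "A \<in> Q" "A \<in> inc" and ij: "i < n" "j < n" "R i j"
    and det: "det (A + t \<cdot>\<^sub>m unit_mat i j) \<noteq> 0"
  shows "A + t \<cdot>\<^sub>m unit_mat i j \<in> Q"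
proof -
  let ?E = "unit_mat i j"
  have Ac: "A \<in> carrier_mat n n" using inc_carrier A by blast
  have gl: "A \<in> carrier (GL n)" using Q_GL A by blast
  let ?B = "inv\<^bsub>GL n\<^esub> A"
  note B = GL_inv[OF gl]
  let ?N = "?B * ?E"
  let ?c = "?B $$ (j, i)"
  have N: "?N \<in> inc" using inc_mult inc_inv[OF A(2) gl] unit_mat_inc[OF ij] by blast
  note Nc = inc_carrier[OF N]
  have Ne: "?N $$ (k, l) = (if l = j then ?B $$ (k, i) else 0)" if "k < n" "l < n" for k l
  proof -
    have "?N $$ (k, l) = (\<Sum>m<n. if m = i then (if l = j then ?B $$ (k, i) else 0) else 0)"
      unfolding mult_mat_entry[OF B(2) unit_mat_carrier(1) that]
      using that by (intro sum.cong) (auto simp: unit_mat_entry)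
    then show ?thesis using ij by simp
  qed
  have NN: "?N * ?N = ?c \<cdot>\<^sub>m ?N"
  proof (rule eq_matI)
    fix k l assume "k < dim_row (?c \<cdot>\<^sub>m ?N)" "l < dim_col (?c \<cdot>\<^sub>m ?N)"
    then have kl: "k < n" "l < n" using Nc by auto
    have "(?N * ?N) $$ (k, l) = (\<Sum>m<n. if m = j then ?N $$ (k, j) * ?N $$ (j, l) else 0)"
      unfolding mult_mat_entry[OF Nc Nc kl]
      using kl by (intro sum.cong) (auto simp: Ne)
    also have "\<dots> = ?N $$ (k, j) * ?N $$ (j, l)" using ij by simp
    also have "\<dots> = (?c \<cdot>\<^sub>m ?N) $$ (k, l)" using kl ij carrier_matD[OF Nc]
      by (simp add: Ne del: index_mult_mat)
    finally show "(?N * ?N) $$ (k, l) = (?c \<cdot>\<^sub>m ?N) $$ (k, l)" .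
  qed (use Nc in auto)
  have AN: "A * ?N = ?E"
    using Ac B(2,3) by (subst assoc_mult_mat[symmetric, of _ n n _ n _ n]) auto
  have tN: "t \<cdot>\<^sub>m ?N \<in> carrier_mat n n" using Nc by simp
  have "A * (1\<^sub>m n + t \<cdot>\<^sub>m ?N) = A * 1\<^sub>m n + A * (t \<cdot>\<^sub>m ?N)"
    using Ac tN by (intro mult_add_distrib_mat[of _ n n _ n]) auto
  also have "A * (t \<cdot>\<^sub>m ?N) = t \<cdot>\<^sub>m (A * ?N)" using Ac Nc by (intro mult_smult_distrib) auto
  finally have prod: "A * (1\<^sub>m n + t \<cdot>\<^sub>m ?N) = A + t \<cdot>\<^sub>m ?E" using Ac AN by simp
  \<comment> \<open>Otherwise \<open>1 + t N\<close> annihilates the nonzero column \<open>j\<close>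
    of \<open>N\<close>, and the determinant vanishes.\<close>
  have "1 + t * ?c \<noteq> 0"
  proof
    assume z: "1 + t * ?c = 0"
    let ?M = "1\<^sub>m n + t \<cdot>\<^sub>m ?N"
    let ?v = "col ?N j"
    have v: "?v \<in> carrier_vec n" using carrier_matD[OF Nc] by (intro carrier_vecI) simp
    have "?M * ?N = 0\<^sub>m n n"
    proof -
      have "?M * ?N = 1\<^sub>m n * ?N + t \<cdot>\<^sub>m ?N * ?N"
        using Nc tN by (intro add_mult_distrib_mat[of _ n n _ _ n]) auto
      also have "t \<cdot>\<^sub>m ?N * ?N = t \<cdot>\<^sub>m (?c \<cdot>\<^sub>m ?N)"
        using Nc NN by (subst mult_smult_assoc_mat[of _ n n _ n]) auto
      finally have e: "?M * ?N = ?N + t \<cdot>\<^sub>m (?c \<cdot>\<^sub>m ?N)" unfolding left_mult_one_mat[OF Nc] .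
      have "x + t * (?c * x) = 0" for x :: complex
      proof -
        have "x + t * (?c * x) = (1 + t * ?c) * x" by (simp add: algebra_simps)
        then show ?thesis using z by simp
      qed
      then show ?thesis unfolding e using Nc by (intro eq_matI) auto
    qed
    have Mc: "?M \<in> carrier_mat n n" using tN by simp
    have "?M *\<^sub>v ?v = col (?M * ?N) j" using col_mult2[OF Mc Nc ij(2)] by simp
    then have "?M *\<^sub>v ?v = 0\<^sub>v n" unfolding \<open>?M * ?N = 0\<^sub>m n n\<close> using ij by simp
    moreover have "?v \<noteq> 0\<^sub>v n"
    proof
      assume "?v = 0\<^sub>v n"
      then have "?N $$ (k, j) = 0" if "k < n" for k
        using that ij Nc by (metis carrier_matD index_col index_zero_vec(1))
      then have "?c = 0" using Ne[of j j] ij by simp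
      then show False using z by simp
    qed
    ultimately have "det ?M = 0" using det_0_iff_vec_prod_zero_field[of ?M n] v tN by auto
    then show False using det det_mult[of A n ?M] Ac tN prod by simp
  qed
  then have "1\<^sub>m n + t \<cdot>\<^sub>m ?N \<in> Q" using scaled_idempotent_in_Q N NN by blast
  then show ?thesis using Q_mult[OF A(1)] prod by metis
qed

lemma scalar_in_Q: "c \<noteq> 0 \<Longrightarrow> c \<cdot>\<^sub>m 1\<^sub>m n \<in> Q"
proof -
  assume "c \<noteq> 0"
  have "1\<^sub>m n + (c - 1) \<cdot>\<^sub>m 1\<^sub>m n \<in> Q"
    using \<open>c \<noteq> 0\<close> by (intro scaled_idempotent_in_Q[of _ 1] inc_one) auto
  moreover have "1\<^sub>m n + (c - 1) \<cdot>\<^sub>m 1\<^sub>m n = c \<cdot>\<^sub>m 1\<^sub>m n" by (intro eq_matI) auto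
  ultimately show ?thesis by simp
qed

lemma finite_singular_shifts:
  fixes H :: "complex mat"
  assumes H: "H \<in> carrier_mat n n"
  shows "finite {c. det (c \<cdot>\<^sub>m 1\<^sub>m n + H) = 0}"
proof -
  have "poly (char_poly H) (- c) = 0" if d: "det (c \<cdot>\<^sub>m 1\<^sub>m n + H) = 0" for c
  proof -
    have cH: "c \<cdot>\<^sub>m 1\<^sub>m n + H \<in> carrier_mat n n" using H by simp
    then obtain v where v: "v \<in> carrier_vec n" "v \<noteq> 0\<^sub>v n" "(c \<cdot>\<^sub>m 1\<^sub>m n + H) *\<^sub>v v = 0\<^sub>v n"
      using det_0_iff_vec_prod_zero_field d by blast
    have "H *\<^sub>v v = (- c) \<cdot>\<^sub>v v"
    proof (rule eq_vecI)
      fix i assume "i < dim_vec (- c \<cdot>\<^sub>v v)"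
      then have i: "i < n" using v by simp
      have "0 = (\<Sum>k<n. (c \<cdot>\<^sub>m 1\<^sub>m n + H) $$ (i, k) * v $ k)"
        using mult_mat_vec_entry[OF cH v(1) i] v(3) index_zero_vec(1)[OF i] by metis
      also have "\<dots> = (\<Sum>k<n. (if k = i then c * v $ i else 0) + H $$ (i, k) * v $ k)"
        using i H by (intro sum.cong) (auto simp: algebra_simps)
      also have "\<dots> = c * v $ i + (H *\<^sub>v v) $ i"
        using i by (simp add: sum.distrib mult_mat_vec_entry[OF H v(1) i])
      finally show "(H *\<^sub>v v) $ i = (- c \<cdot>\<^sub>v v) $ i"
        using i v by (simp add: add_eq_0_iff)
    qed (use v H in auto)
    then have "eigenvalue H (- c)" using v H unfolding eigenvalue_def eigenvector_def by auto
    then show ?thesis using eigenvalue_root_char_poly[OF H] by simp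
  qed
  then have "uminus ` {c. det (c \<cdot>\<^sub>m 1\<^sub>m n + H) = 0} \<subseteq> {x. poly (char_poly H) x = 0}" by auto
  moreover have "finite {x. poly (char_poly H) x = 0}"
    using degree_monic_char_poly[OF H] by (intro poly_roots_finite) auto
  ultimately have "finite (uminus ` {c. det (c \<cdot>\<^sub>m 1\<^sub>m n + H) = 0})" by (rule finite_subset)
  then show ?thesis by (rule finite_imageD) simp
qed

text \<open>Starting from a scalar matrix, the entries of \<open>G\<close> are added one at a time;
  the hypothesis keeps all intermediate matrices invertible.\<close>

lemma shifted_in_Q:
  assumes G: "G \<in> inc" and c: "\<And>k. det (c \<cdot>\<^sub>m 1\<^sub>m n + partial G k) \<noteq> 0"
  shows "c \<cdot>\<^sub>m 1\<^sub>m n + G \<in> Q"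
proof -
  note Gc = inc_carrier[OF G]
  have inc: "c \<cdot>\<^sub>m 1\<^sub>m n + partial G k \<in> inc" for k
    by (intro inc_add inc_smult inc_one partial_inc G)
  have "c \<cdot>\<^sub>m 1\<^sub>m n + partial G k \<in> Q" for k
  proof (induction k)
    case 0
    have "c \<cdot>\<^sub>m 1\<^sub>m n + partial G 0 = c \<cdot>\<^sub>m 1\<^sub>m n" by (intro eq_matI) (auto simp: partial_def)
    moreover have "c \<noteq> 0 \<or> n = 0"
      using c[of 0] unfolding calculation by (cases "n = 0") (auto simp: det_smult power_0_left)
    moreover have "c \<cdot>\<^sub>m 1\<^sub>m n = 1 \<cdot>\<^sub>m 1\<^sub>m n" if "n = 0" using that by (intro eq_matI) auto
    ultimately show ?case using scalar_in_Q[of c] scalar_in_Q[of 1] by auto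
  next
    case (Suc k)
    from partial_Suc[OF G, of k] show ?case
    proof (elim disjE exE conjE)
      fix i j assume ij: "i < n" "j < n" "R i j"
        "partial G (Suc k) = partial G k + G $$ (i, j) \<cdot>\<^sub>m unit_mat i j"
      have "c \<cdot>\<^sub>m 1\<^sub>m n + partial G (Suc k) = (c \<cdot>\<^sub>m 1\<^sub>m n + partial G k) + G $$ (i, j) \<cdot>\<^sub>m unit_mat i j"
        unfolding ij(4) by (rule assoc_add_mat[symmetric]) auto
      then show ?thesis using add_unit_mat_in_Q[OF Suc inc ij(1-3)] c[of "Suc k"] by metis
    qed (use Suc in simp)
  qed
  then show ?thesis using partial_late[OF order_refl Gc] by metis
qed

lemma poly_funs_line:
  assumes "f \<in> poly_funs (mat_coords n)" "G \<in> carrier_mat n n"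
  shows "\<exists>p. \<forall>c. f (c \<cdot>\<^sub>m 1\<^sub>m n + G) = poly p c"
  using assms(1)
proof (induction rule: poly_funs.induct)
  case (coord f)
  then obtain i j where "f = (\<lambda>A. A $$ (i, j))" "i < n" "j < n" by (auto simp: mat_coords_def)
  then show ?case
    using assms(2) by (intro exI[of _ "[: G $$ (i, j), if i = j then 1 else 0 :]"]) auto
next
  case (const c)
  show ?case by (rule exI[of _ "[:c:]"]) simp
next
  case (add f g)
  then obtain p q where "\<forall>c. f (c \<cdot>\<^sub>m 1\<^sub>m n + G) = poly p c" "\<forall>c. g (c \<cdot>\<^sub>m 1\<^sub>m n + G) = poly q c" by blast
  then show ?case by (intro exI[of _ "p + q"]) simp
next
  case (mult f g)
  then obtain p q where "\<forall>c. f (c \<cdot>\<^sub>m 1\<^sub>m n + G) = poly p c" "\<forall>c. g (c \<cdot>\<^sub>m 1\<^sub>m n + G) = poly q c" by blast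
  then show ?case by (intro exI[of _ "p * q"]) simp
qed

text \<open>The intermediate matrices for \<open>G\<close> itself may be singular, hence the shift:
  all but finitely many \<open>c 1 + G\<close> lie in \<open>Q\<close>, so a polynomial vanishing on
  \<open>Q\<close> vanishes on this whole line and in particular at \<open>c = 0\<close>.\<close>

lemma inc_GL_subset_Q:
  assumes G: "G \<in> inc" "G \<in> carrier (GL n)"
  shows "G \<in> Q"
proof (rule ccontr)
  assume "G \<notin> Q"
  then obtain f where f: "f \<in> poly_funs (mat_coords n)" "f G \<noteq> 0" "\<forall>y\<in>Q. f y = 0"
    using closedin_zariskiD[of "mat_coords n" "carrier (GL n)" Q G] alg G
    by (auto simp: linear_algebraic_group_def)
  note Gc = inc_carrier[OF G(1)]
  obtain p where p: "\<And>c. f (c \<cdot>\<^sub>m 1\<^sub>m n + G) = poly p c" using poly_funs_line[OF f(1) Gc] by blast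
  let ?P = "(\<lambda>k. partial G k) ` {..n * n}"
  let ?bad = "\<Union>H \<in> ?P. {c. det (c \<cdot>\<^sub>m 1\<^sub>m n + H) = 0}"
  have "finite ?bad" using finite_singular_shifts[OF partial_carrier(1)] by (intro finite_UN_I) auto
  have late: "partial G k \<in> ?P" for k
  proof (cases "k \<le> n * n")
    case False
    then have "partial G k = partial G (n * n)" using partial_late[OF _ Gc] by simp
    then show ?thesis by (intro image_eqI[of _ _ "n * n"]) auto
  qed auto
  have "poly p c = 0" if "c \<notin> ?bad" for c
  proof -
    have "c \<cdot>\<^sub>m 1\<^sub>m n + G \<in> Q" using shifted_in_Q[OF G(1)] that late by blast
    then show ?thesis using f(3) p by metis
  qed
  then have "- ?bad \<subseteq> {c. poly p c = 0}" by blast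
  moreover have "infinite (- ?bad)" using \<open>finite ?bad\<close> infinite_UNIV_char_0 by (metis Compl_eq_Diff_UNIV finite_Diff2)
  ultimately have "p = 0" using poly_roots_finite finite_subset by blast
  moreover have "0 \<cdot>\<^sub>m 1\<^sub>m n + G = G" using Gc by (intro eq_matI) auto
  ultimately show False using p[of 0] f(2) by simp
qed

lemma Q_normalises:
  assumes g: "g \<in> Q" and X: "X \<in> inc"
  shows "g * X * inv\<^bsub>GL n\<^esub> g \<in> inc"
proof -
  have gl: "g \<in> carrier (GL n)" using Q_GL g by blast
  note h = GL_inv[OF gl] and gc = GL_carrier_mat[OF gl] and Xc = inc_carrier[OF X]
  have hQ: "inv\<^bsub>GL n\<^esub> g \<in> Q" using subgroup.m_inv_closed[OF Q_subgroup g] .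
  have "mat_exp n (t \<cdot>\<^sub>m (g * X * inv\<^bsub>GL n\<^esub> g)) \<in> Q" for t
  proof -
    have "t \<cdot>\<^sub>m (g * X * inv\<^bsub>GL n\<^esub> g) = g * (t \<cdot>\<^sub>m X) * inv\<^bsub>GL n\<^esub> g"
      using smult_conj[OF gc h(2) Xc] by simp
    moreover have "mat_exp n (g * (t \<cdot>\<^sub>m X) * inv\<^bsub>GL n\<^esub> g) = g * mat_exp n (t \<cdot>\<^sub>m X) * inv\<^bsub>GL n\<^esub> g"
      using mat_exp_conj[OF gc h(2) _ h(4,3)] Xc by simp
    ultimately show ?thesis using Q_mult mat_exp_in_Q[OF X] g hQ by simp
  qed
  then have "g * X * inv\<^bsub>GL n\<^esub> g \<in> lie_algebra n Q" using gc h Xc by (simp add: lie_algebra_def)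
  then show ?thesis using lie by simp
qed

end

section \<open>Connectedness and the reverse inclusion\<close>

locale connected_incidence_group = incidence_group +
  assumes conn: "connectedin (zariski (mat_coords n)) Q"
begin

text \<open>For \<open>g\<close> normalising the algebra with inverse \<open>h\<close>, the sum of \<open>h\<^sub>i\<^sub>p g\<^sub>p\<^sub>i\<close> over the class of \<open>i\<close> is
  0 or 1. By Cramer's rule it is \<open>det g\<close> times a polynomial, so on \<open>Q\<close> it is constantly 1.\<close>

lemma Q_subset_inc: "Q \<subseteq> inc"
proof
  fix g assume g: "g \<in> Q"
  define D where "D A = det (mat n n (\<lambda>(k, l). A $$ (k, l)))" for A :: "complex mat"
  \<comment> \<open>The determinant after cutting column \<open>i\<close> down to the class of
    \<open>i\<close>: by Cramer's rule this is \<open>det A\<close> times the sum in question,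
    without any inverse.\<close>
  define F where "F i A = det (mat n n (\<lambda>(k, l). if l = i then if R k i \<and> R i k then A $$ (k, i) else 0 else A $$ (k, l)))"
    for i and A :: "complex mat"
  have coordp: "(\<lambda>A. A $$ (k, l)) \<in> poly_funs (mat_coords n)" if "k < n" "l < n" for k l
    using that by (intro poly_funs.coord) (auto simp: mat_coords_def)
  have Dp: "D \<in> poly_funs (mat_coords n)" unfolding D_def by (intro poly_funs_det coordp)
  have Fp: "F i \<in> poly_funs (mat_coords n)" if "i < n" for i
    unfolding F_def
  proof (rule poly_funs_det)
    fix k l assume "k < n" "l < n"
    then show "(\<lambda>T. if l = i then if R k i \<and> R i k then T $$ (k, i) else 0 else T $$ (k, l)) \<in> poly_funs (mat_coords n)"
      using coordp poly_funs.const[of 0] that by (cases "l = i"; cases "R k i \<and> R i k") auto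
  qed
  have gl: "g \<in> carrier (GL n)" if "g \<in> Q" for g using Q_GL that by blast
  have DQ: "D g \<noteq> 0" "D g = det g" if "g \<in> Q" for g
  proof -
    have "mat n n (\<lambda>(k, l). g $$ (k, l)) = g" using GL_carrier_mat[OF gl[OF that]] by (intro eq_matI) auto
    then show "D g = det g" "D g \<noteq> 0" using gl[OF that] by (simp_all add: D_def GL_carrier_det)
  qed
  have FQ: "F i g = det g * (\<Sum>p<n. if R p i \<and> R i p then (inv\<^bsub>GL n\<^esub> g) $$ (i, p) * g $$ (p, i) else 0)"
    if i: "i < n" and g: "g \<in> Q" for i g
  proof -
    let ?h = "inv\<^bsub>GL n\<^esub> g"
    note h = GL_inv[OF gl[OF g]] and gc = GL_carrier_mat[OF gl[OF g]]
    let ?v = "vec n (\<lambda>p. if R p i \<and> R i p then g $$ (p, i) else 0)"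
    have "g *\<^sub>v (?h *\<^sub>v ?v) = ?v" using h gc by (subst assoc_mult_mat_vec[symmetric, of _ n n _ n]) auto
    then have "det (replace_col g ?v i) = (?h *\<^sub>v ?v) $ i * det g"
      using cramer_lemma_mat[OF gc _ i, of "?h *\<^sub>v ?v"] h by simp
    moreover have "replace_col g ?v i = mat n n (\<lambda>(k, l). if l = i then if R k i \<and> R i k then g $$ (k, i) else 0 else g $$ (k, l))"
      using gc by (intro eq_matI) (auto simp: replace_col_def)
    moreover have "(?h *\<^sub>v ?v) $ i = (\<Sum>p<n. if R p i \<and> R i p then ?h $$ (i, p) * g $$ (p, i) else 0)"
      using h i by (auto simp: scalar_prod_def atLeast0LessThan intro!: sum.cong)
    ultimately show ?thesis unfolding F_def by (simp add: mult.commute)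
  qed
  \<comment> \<open>Conjugating the diagonal matrix unit at \<open>i\<close> by \<open>g\<close>
    gives a matrix of the algebra whose entry at \<open>(p, r)\<close> is the product of the two
    given nonzero entries.\<close>
  have tri: "R p r" if "g \<in> Q" "i < n" "p < n" "r < n" "g $$ (p, i) \<noteq> 0" "(inv\<^bsub>GL n\<^esub> g) $$ (i, r) \<noteq> 0" for g i p r
  proof -
    let ?h = "inv\<^bsub>GL n\<^esub> g"
    note h = GL_inv[OF gl[OF that(1)]] and gc = GL_carrier_mat[OF gl[OF that(1)]]
    have "(g * unit_mat i i * ?h) $$ (p, r) = (\<Sum>l<n. \<Sum>k<n. g $$ (p, k) * unit_mat i i $$ (k, l) * ?h $$ (l, r))"
      using triple_entry[OF gc h(2) unit_mat_carrier(1) that(3,4)] .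
    also have "\<dots> = (\<Sum>l<n. \<Sum>k<n. if k = i then (if l = i then g $$ (p, i) * ?h $$ (i, r) else 0) else 0)"
      by (intro sum.cong HOL.refl) (auto simp: unit_mat_entry)
    also have "\<dots> = g $$ (p, i) * ?h $$ (i, r)" using that by simp
    finally have "(g * unit_mat i i * ?h) $$ (p, r) \<noteq> 0" using that by simp
    moreover have "g * unit_mat i i * ?h \<in> inc"
      using Q_normalises[OF that(1) unit_mat_inc] R_refl that by blast
    ultimately show ?thesis using inc_nonzero that by blast
  qed
  have dich: "F i g = 0 \<longleftrightarrow> F i g - D g \<noteq> 0" if i: "i < n" and g: "g \<in> Q" for i g
  proof (cases "\<exists>p<n. R p i \<and> R i p \<and> (inv\<^bsub>GL n\<^esub> g) $$ (i, p) * g $$ (p, i) \<noteq> 0")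
    case False
    then have "F i g = 0" unfolding FQ[OF that] by (auto intro!: sum.neutral)
    then show ?thesis using DQ[OF g] by simp
  next
    case True
    let ?h = "inv\<^bsub>GL n\<^esub> g"
    note h = GL_inv[OF gl[OF g]] and gc = GL_carrier_mat[OF gl[OF g]]
    obtain q where q: "q < n" "R q i" "R i q" "?h $$ (i, q) \<noteq> 0" "g $$ (q, i) \<noteq> 0" using True by auto
    \<comment> \<open>One contributing index in the class of \<open>i\<close> forces all
      contributing indices into it, so the sum is a full diagonal entry of the identity.\<close>
    have cls: "R p i \<and> R i p" if "p < n" "?h $$ (i, p) * g $$ (p, i) \<noteq> 0" for p
    proof -
      have "R p q" "R q p" using tri[OF g i, of p q] tri[OF g i, of q p] q that by auto
      then show ?thesis using R_trans[of p q i] R_trans[of i q p] q that i by blast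
    qed
    have "(\<Sum>p<n. if R p i \<and> R i p then ?h $$ (i, p) * g $$ (p, i) else 0) = (\<Sum>p<n. ?h $$ (i, p) * g $$ (p, i))"
      using cls by (intro sum.cong) auto
    also have "\<dots> = 1" using mult_mat_entry[OF h(2) gc i i] h(4) i by simp
    finally show ?thesis using FQ[OF that] DQ[OF g] by simp
  qed
  have one: "1\<^sub>m n \<in> Q" using subgroup.one_closed[OF Q_subgroup] by (simp add: GL_simps)
  show "g \<in> inc"
  proof (rule incI)
    show gc: "g \<in> carrier_mat n n" using GL_carrier_mat[OF gl[OF g]] .
    fix k i assume k: "k < n" and i: "i < n" and ki: "g $$ (k, i) \<noteq> 0"
    have "inv\<^bsub>GL n\<^esub> (1\<^sub>m n) = (1\<^sub>m n :: complex mat)" by (rule GL_inv_eqI) auto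
    then have "(\<Sum>p<n. if R p i \<and> R i p then (inv\<^bsub>GL n\<^esub> (1\<^sub>m n)) $$ (i, p) * 1\<^sub>m n $$ (p, i) else 0) = (\<Sum>p<n. if p = i then 1 else (0::complex))"
      using i R_refl[OF i] by (intro sum.cong) auto
    then have "F i (1\<^sub>m n) \<noteq> 0" using FQ[OF i one] i by simp
    \<comment> \<open>Nonzero at the identity, hence on all of \<open>Q\<close>. So some
      \<open>p\<close> in the class of \<open>i\<close> has a nonzero entry of the inverse, and
      \<open>tri\<close> relates \<open>k\<close> to \<open>p\<close>.\<close>
    then have "F i g \<noteq> 0"
      using connectedin_zariski_dichotomy[OF conn Fp[OF i] poly_funs_diff[OF Fp[OF i] Dp] dich[OF i] one _ g] by blast
    have "\<exists>p<n. R p i \<and> (inv\<^bsub>GL n\<^esub> g) $$ (i, p) \<noteq> 0"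
    proof (rule ccontr)
      assume "\<not> ?thesis"
      then have "F i g = 0" unfolding FQ[OF i g] by (auto intro!: sum.neutral)
      then show False using \<open>F i g \<noteq> 0\<close> by blast
    qed
    then obtain p where p: "p < n" "R p i" "(inv\<^bsub>GL n\<^esub> g) $$ (i, p) \<noteq> 0" by blast
    then have "R k p" using tri[OF g i k p(1)] ki by blast
    then show "R k i" using R_trans k p i by blast
  qed
qed

lemma Q_eq: "Q = inc \<inter> carrier (GL n)"
  using Q_subset_inc Q_GL inc_GL_subset_Q by blast

text \<open>Commuting with a diagonal matrix of distinct entries forces the exponentials of all
  multiples of \<open>X\<close> to be diagonal, hence \<open>X\<close> itself. Entries starting at 1
  keep this matrix invertible.\<close>

lemma lie_centre_diagonal:
  assumes "X \<in> lie_algebra n (centre Q)"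
  shows "diagonal_mat X"
proof -
  have X: "X \<in> carrier_mat n n" and e: "\<And>t. mat_exp n (t \<cdot>\<^sub>m X) \<in> centre Q"
    using assms by (auto simp: lie_algebra_def)
  let ?D = "mat n n (\<lambda>(i, j). if i = j then of_nat (Suc i) else (0::complex))"
  let ?E = "mat n n (\<lambda>(i, j). if i = j then 1 / of_nat (Suc i) else (0::complex))"
  have "?D \<in> inc" by (rule incI) (auto simp: R_refl split: if_splits)
  moreover have "?D * ?E = 1\<^sub>m n"
  proof (rule eq_matI)
    fix i j assume "i < dim_row (1\<^sub>m n :: complex mat)" "j < dim_col (1\<^sub>m n :: complex mat)"
    then have ij: "i < n" "j < n" by auto
    have "(?D * ?E) $$ (i, j) = (\<Sum>k<n. if k = i then (if i = j then 1 else 0) else 0)"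
      unfolding mult_mat_entry[of ?D n n ?E n, OF mat_carrier mat_carrier ij]
      using ij by (intro sum.cong) (auto simp del: of_nat_Suc)
    then show "(?D * ?E) $$ (i, j) = 1\<^sub>m n $$ (i, j)" using ij by simp
  qed auto
  then have "?D \<in> carrier (GL n)" using GL_carrierI[of ?D n ?E] by simp
  ultimately have D: "?D \<in> Q" using Q_eq by blast
  show ?thesis
    unfolding diagonal_mat_def
  proof (intro allI impI)
    fix i j assume "i < dim_row X" "j < dim_col X" "i \<noteq> j"
    then have ij: "i < n" "j < n" "i \<noteq> j" using X by auto
    have "mat_exp n (t \<cdot>\<^sub>m X) $$ (i, j) = 0" for t
    proof -
      let ?Z = "mat_exp n (t \<cdot>\<^sub>m X)"
      have "?Z * ?D = ?D * ?Z" using e[of t] D by (simp add: centre_def)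
      moreover have "(?Z * ?D) $$ (i, j) = (\<Sum>k<n. if k = j then ?Z $$ (i, j) * of_nat (Suc j) else 0)"
        unfolding mult_mat_entry[OF mat_exp_carrier(1) mat_carrier ij(1,2)]
        using ij by (intro sum.cong) auto
      moreover have "(?D * ?Z) $$ (i, j) = (\<Sum>k<n. if k = i then of_nat (Suc i) * ?Z $$ (i, j) else 0)"
        unfolding mult_mat_entry[OF mat_carrier mat_exp_carrier(1) ij(1,2)]
        using ij by (intro sum.cong) auto
      ultimately have "?Z $$ (i, j) * of_nat (Suc j) = of_nat (Suc i) * ?Z $$ (i, j)" using ij by simp
      then have "?Z $$ (i, j) * (of_nat (Suc j) - of_nat (Suc i)) = 0" by (simp add: algebra_simps)
      moreover have "(of_nat (Suc j) :: complex) \<noteq> of_nat (Suc i)" using ij(3) by (metis of_nat_eq_iff old.nat.inject)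
      ultimately show ?thesis by simp
    qed
    then show "X $$ (i, j) = 0" using mat_exp_off_diagonal[OF X ij] by blast
  qed
qed

lemma lie_centre_semisimple:
  assumes "X \<in> lie_algebra n (centre Q)"
  shows "semisimple_mat X"
  unfolding semisimple_mat_def
  using lie_centre_diagonal[OF assms] assms similar_mat_refl[of X n] by (auto simp: lie_algebra_def)

end

section \<open>The stabiliser of the linear form\<close>

text \<open>\<open>kap\<close> and \<open>off\<close> stand for owner and offset. They serve to
  build stabiliser elements that act in the same way on all intervals of one owner.\<close>

locale fat_group = fat_meander +
  fixes Q :: "complex mat set" and kap :: "nat \<Rightarrow> 'k" and off :: "nat \<Rightarrow> nat"
  assumes group: "connected_incidence_group n rel Q"
    and kap_f: "x < n \<Longrightarrow> kap (f x) = kap x" and kap_g: "x < n \<Longrightarrow> kap (g x) = kap x"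
    and off_f: "x < n \<Longrightarrow> off (f x) = off x" and off_g: "x < n \<Longrightarrow> off (g x) = off x"
    and kap_c: "x < n \<Longrightarrow> y < n \<Longrightarrow> c x = c y \<Longrightarrow> kap x = kap y"
    and off_inj: "x < n \<Longrightarrow> y < n \<Longrightarrow> c x = c y \<Longrightarrow> off x = off y \<Longrightarrow> x = y"

sublocale fat_group \<subseteq> connected_incidence_group n rel Q
  by (rule group)

context fat_group
begin

text \<open>Each pair joined by a fat arc contributes the one entry allowed by its composition,
  below the diagonal for \<open>f\<close> and above it for \<open>g\<close>. The strict inequalities
  leave out the diagonal blocks, which makes the form of nilpotent type.\<close>

definition gamma :: "complex mat \<Rightarrow> complex" where
  "gamma X = (\<Sum>q<n. (if c q < c (f q) then X $$ (f q, q) else 0) + (if c (g q) < c q then X $$ (g q, q) else 0))"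

lemma gamma_add: "X \<in> carrier_mat n n \<Longrightarrow> Y \<in> carrier_mat n n \<Longrightarrow> gamma (X + Y) = gamma X + gamma Y"
  unfolding gamma_def sum.distrib[symmetric]
  by (intro sum.cong HOL.refl) (auto simp: A.f_less B.f_less)

lemma gamma_smult: "X \<in> carrier_mat n n \<Longrightarrow> gamma (a \<cdot>\<^sub>m X) = a * gamma X"
  unfolding gamma_def sum_distrib_left
  by (intro sum.cong HOL.refl) (auto simp: A.f_less B.f_less algebra_simps)

lemma gamma_linear: "linear_form inc gamma"
  unfolding linear_form_def using gamma_add gamma_smult inc_carrier by blast

lemma gamma_diff:
  assumes "X \<in> carrier_mat n n" "Y \<in> carrier_mat n n"
  shows "gamma (X - Y) = gamma X - gamma Y"
proof -
  have "gamma X = gamma ((X - Y) + Y)"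
    using assms by (intro arg_cong[where f = gamma] eq_matI) auto
  also have "\<dots> = gamma (X - Y) + gamma Y" by (rule gamma_add) (use assms in auto)
  finally show ?thesis by simp
qed

definition entries :: "complex mat \<Rightarrow> nat \<Rightarrow> nat \<Rightarrow> complex" where
  "entries X = (\<lambda>i j. X $$ (i, j))"

lemma sum_reindex_involution:
  assumes "reflection_blocks n d h r"
  shows "(\<Sum>q<n. F q) = (\<Sum>p<n. F (h p))"
proof -
  interpret H: reflection_blocks n d h r by fact
  show ?thesis
    by (rule sum.reindex_bij_witness[of _ h h]) (auto simp: H.f_f H.f_less)
qed

text \<open>Reindexing the second product by the reflections collects the coefficient of each
  \<open>Y $$ (p, q)\<close>; this is the origin of \<open>a_term\<close>.\<close>

lemma gamma_commutator:
  assumes X: "X \<in> carrier_mat n n" and Y: "Y \<in> carrier_mat n n"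
  shows "gamma (X * Y) - gamma (Y * X) =
    (\<Sum>p<n. \<Sum>q<n. Y $$ (p, q) * (a_term c f (entries X) p q + a_term (\<lambda>x. - c x) g (entries X) p q))"
proof -
  have XY: "gamma (X * Y) = (\<Sum>q<n. \<Sum>p<n. Y $$ (p, q) *
     ((if c q < c (f q) then X $$ (f q, p) else 0) + (if c (g q) < c q then X $$ (g q, p) else 0)))"
    unfolding gamma_def
    by (intro sum.cong HOL.refl)
      (auto simp: mult_mat_entry[OF X Y] A.f_less B.f_less sum.distrib algebra_simps)
  have "gamma (Y * X) = (\<Sum>q<n. if c q < c (f q) then (Y * X) $$ (f q, q) else 0) +
      (\<Sum>q<n. if c (g q) < c q then (Y * X) $$ (g q, q) else 0)"
    unfolding gamma_def by (simp add: sum.distrib)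
  also have "\<dots> = (\<Sum>p<n. if c (f p) < c (f (f p)) then (Y * X) $$ (f (f p), f p) else 0) +
      (\<Sum>p<n. if c (g (g p)) < c (g p) then (Y * X) $$ (g (g p), g p) else 0)"
    using sum_reindex_involution[OF A.reflection_blocks_axioms, of "\<lambda>q. if c q < c (f q) then (Y * X) $$ (f q, q) else 0"]
      sum_reindex_involution[OF B.reflection_blocks_axioms, of "\<lambda>q. if c (g q) < c q then (Y * X) $$ (g q, q) else 0"]
    by simp
  also have "\<dots> = (\<Sum>p<n. \<Sum>q<n. Y $$ (p, q) *
     ((if c (f p) < c p then X $$ (q, f p) else 0) + (if c p < c (g p) then X $$ (q, g p) else 0)))"
    unfolding sum.distrib[symmetric]
    by (intro sum.cong HOL.refl)
      (auto simp: mult_mat_entry[OF Y X] A.f_less B.f_less A.f_f B.f_f sum.distrib algebra_simps)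
  finally have YX: "gamma (Y * X) = \<dots>" .
  have "gamma (X * Y) = (\<Sum>p<n. \<Sum>q<n. Y $$ (p, q) *
     ((if c q < c (f q) then X $$ (f q, p) else 0) + (if c (g q) < c q then X $$ (g q, p) else 0)))"
    unfolding XY by (rule sum.swap)
  then show ?thesis
    unfolding YX by (simp add: sum_subtractf[symmetric] a_term_def entries_def algebra_simps)
qed

section \<open>The stabiliser in the algebra and in the group\<close>

definition stab :: "complex mat set" where
  "stab = {A \<in> carrier_mat n n. \<forall>i<n. \<forall>j<n.
     (c i \<noteq> c j \<longrightarrow> A $$ (i, j) = 0) \<and>
     (c i = c j \<longrightarrow> A $$ (f i, f j) = A $$ (i, j) \<and> A $$ (g i, g j) = A $$ (i, j))}"

lemma stab_carrier: "A \<in> stab \<Longrightarrow> A \<in> carrier_mat n n"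
  by (simp add: stab_def)

lemma stab_zero: "A \<in> stab \<Longrightarrow> i < n \<Longrightarrow> j < n \<Longrightarrow> c i \<noteq> c j \<Longrightarrow> A $$ (i, j) = 0"
  by (simp add: stab_def)

lemma stab_inc: "A \<in> stab \<Longrightarrow> A \<in> inc"
  by (rule incI) (auto simp: stab_def rel_def)

text \<open>Matrix units as \<open>Y\<close> yield the entrywise equations, whose solutions are the
  block matrices determined earlier.\<close>

lemma stab_iff: "X \<in> stab \<longleftrightarrow> X \<in> inc \<and> (\<forall>Y \<in> inc. gamma (X * Y) = gamma (Y * X))"
proof
  assume X: "X \<in> stab"
  interpret E: stabiliser_equations n c f g ra rb "entries X"
    by (rule stabiliser_equationsI) (use X in \<open>auto simp: stab_def entries_def\<close>)
  show "X \<in> inc \<and> (\<forall>Y \<in> inc. gamma (X * Y) = gamma (Y * X))"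
  proof (intro conjI ballI stab_inc X)
    fix Y assume Y: "Y \<in> inc"
    have "gamma (X * Y) - gamma (Y * X) = 0"
      unfolding gamma_commutator[OF stab_carrier[OF X] inc_carrier[OF Y]]
    proof (intro sum.neutral ballI)
      fix p q assume "p \<in> {..<n}" "q \<in> {..<n}"
      then show "Y $$ (p, q) * (a_term c f (entries X) p q + a_term (\<lambda>x. - c x) g (entries X) p q) = 0"
        using E.eqn[of p q] inc_nonzero[OF Y, of p q] by auto
    qed
    then show "gamma (X * Y) = gamma (Y * X)" by simp
  qed
next
  assume *: "X \<in> inc \<and> (\<forall>Y \<in> inc. gamma (X * Y) = gamma (Y * X))"
  then have X: "X \<in> carrier_mat n n" using inc_carrier by blast
  interpret E: stabiliser_equations n c f g ra rb "entries X"
  proof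
    show "entries X i j = 0" if "i < n" "j < n" "\<not> rel i j" for i j
      using that inc_nonzero * unfolding entries_def by blast
    fix p q assume pq: "p < n" "q < n" "rel p q"
    let ?t = "\<lambda>p q. a_term c f (entries X) p q + a_term (\<lambda>x. - c x) g (entries X) p q"
    have "0 = gamma (X * unit_mat p q) - gamma (unit_mat p q * X)" using * unit_mat_inc[OF pq] by simp
    also have "\<dots> = (\<Sum>p'<n. \<Sum>q'<n. unit_mat p q $$ (p', q') * ?t p' q')"
      by (rule gamma_commutator) (use X in auto)
    also have "\<dots> = (\<Sum>p'<n. \<Sum>q'<n. if q' = q then (if p' = p then ?t p q else 0) else 0)"
      by (intro sum.cong HOL.refl) (auto simp: unit_mat_entry)
    also have "\<dots> = ?t p q" using pq by simp
    finally show "?t p q = 0" by simp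
  qed
  show "X \<in> stab"
    unfolding stab_def
  proof (intro CollectI conjI allI impI X)
    fix i j assume ij: "i < n" "j < n"
    show "X $$ (i, j) = 0" if "c i \<noteq> c j"
      using E.off_diagonal_zero[OF ij that] by (simp add: entries_def)
    show "X $$ (f i, f j) = X $$ (i, j)" "X $$ (g i, g j) = X $$ (i, j)" if "c i = c j"
      using E.diagonal_invariant[OF ij that] by (simp_all add: entries_def)
  qed
qed

lemma lie_stabiliser_eq: "lie_stabiliser n Q gamma = stab"
proof -
  have "gamma (X * Y - Y * X) = gamma (X * Y) - gamma (Y * X)" if "X \<in> inc" "Y \<in> inc" for X Y
    using gamma_diff inc_carrier[OF inc_mult[OF that]] inc_carrier[OF inc_mult[OF that(2,1)]] by blast
  then show ?thesis unfolding lie_stabiliser_def lie using stab_iff by auto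
qed

lemma nilpotent_gamma: "nilpotent_type n Q gamma"
  unfolding nilpotent_type_def lie_stabiliser_eq
proof
  fix X assume "X \<in> stab"
  then show "gamma X = 0"
    unfolding gamma_def by (intro sum.neutral) (auto simp: stab_zero A.f_less B.f_less)
qed

lemma Q_inv: "h \<in> Q \<Longrightarrow> inv\<^bsub>GL n\<^esub> h \<in> Q"
  using subgroup.m_inv_closed[OF Q_subgroup] .

lemma inv_inv: "h \<in> Q \<Longrightarrow> inv\<^bsub>GL n\<^esub> (inv\<^bsub>GL n\<^esub> h) = h"
  using group.inv_inv[OF GL_group] Q_GL by blast

text \<open>As \<open>Q\<close> consists of the units, multiplication by \<open>h\<close> is a
  bijection of the algebra; substituting \<open>h Y\<close> for the argument turns coadjoint
  invariance into commutation under \<open>gamma\<close>.\<close>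

lemma group_stabiliser_eq: "group_stabiliser n Q gamma = stab \<inter> carrier (GL n)"
proof (rule equalityI; rule subsetI)
  fix h assume h: "h \<in> group_stabiliser n Q gamma"
  then have hQ: "h \<in> Q" by (simp add: group_stabiliser_def)
  then have hi: "h \<in> inc" "h \<in> carrier (GL n)" using Q_eq by auto
  note hc = inc_carrier[OF hi(1)] and k = GL_inv[OF hi(2)]
  have "gamma (h * Y) = gamma (Y * h)" if Y: "Y \<in> inc" for Y
  proof -
    note Yc = inc_carrier[OF Y]
    have "conj_mat n (inv\<^bsub>GL n\<^esub> h) (h * Y) = inv\<^bsub>GL n\<^esub> h * (h * Y) * h"
      by (simp add: conj_mat_def inv_inv[OF hQ])
    also have "inv\<^bsub>GL n\<^esub> h * (h * Y) = Y"
      using hc k Yc by (subst assoc_mult_mat[symmetric, of _ n n _ n _ n]) auto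
    finally have "coadjoint n h gamma (h * Y) = gamma (Y * h)" by (simp add: coadjoint_def)
    moreover have "h * Y \<in> inc" using inc_mult hi Y by blast
    ultimately show ?thesis using h lie by (simp add: group_stabiliser_def)
  qed
  then show "h \<in> stab \<inter> carrier (GL n)" using stab_iff hi by blast
next
  fix h assume h: "h \<in> stab \<inter> carrier (GL n)"
  then have hi: "h \<in> inc" "h \<in> carrier (GL n)" using stab_inc by auto
  then have hQ: "h \<in> Q" using Q_eq by blast
  note hc = inc_carrier[OF hi(1)] and k = GL_inv[OF hi(2)]
  have "coadjoint n h gamma X = gamma X" if X: "X \<in> inc" for X
  proof -
    note Xc = inc_carrier[OF X]
    let ?Y = "inv\<^bsub>GL n\<^esub> h * X"
    have Y: "?Y \<in> inc" using inc_mult inc_inv[OF hi] X by blast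
    have "coadjoint n h gamma X = gamma (?Y * h)"
      by (simp add: coadjoint_def conj_mat_def inv_inv[OF hQ])
    also have "\<dots> = gamma (h * ?Y)" using h stab_iff Y by simp
    also have "h * ?Y = X" using hc k Xc by (subst assoc_mult_mat[symmetric, of _ n n _ n _ n]) auto
    finally show ?thesis .
  qed
  then show "h \<in> group_stabiliser n Q gamma" using hQ lie by (simp add: group_stabiliser_def)
qed

abbreviation "H \<equiv> stab \<inter> carrier (GL n)"

lemma H_Q: "h \<in> H \<Longrightarrow> h \<in> Q"
  using Q_eq stab_inc by blast

text \<open>The description by \<open>gamma\<close> allows one factor at a time to be moved
  cyclically, so entries need not be touched.\<close>

lemma H_mult: "x \<in> H \<Longrightarrow> y \<in> H \<Longrightarrow> x * y \<in> H"
proof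
  assume x: "x \<in> H" and y: "y \<in> H"
  then show "x * y \<in> carrier (GL n)" using GL_mult by blast
  have xi: "x \<in> inc" and yi: "y \<in> inc" using x y stab_inc by auto
  note c = inc_carrier[OF xi] inc_carrier[OF yi]
  have "gamma (x * y * Y) = gamma (Y * (x * y))" if Y: "Y \<in> inc" for Y
  proof -
    note Yc = inc_carrier[OF Y]
    have "gamma (x * y * Y) = gamma (x * (y * Y))" using c Yc by (simp add: assoc_mult_mat[of _ n n _ n _ n])
    also have "\<dots> = gamma (y * Y * x)" using x yi Y inc_mult stab_iff by blast
    also have "\<dots> = gamma (y * (Y * x))" using c Yc by (simp add: assoc_mult_mat[of _ n n _ n _ n])
    also have "\<dots> = gamma (Y * x * y)" using y xi Y inc_mult stab_iff by blast
    also have "\<dots> = gamma (Y * (x * y))" using c Yc by (simp add: assoc_mult_mat[of _ n n _ n _ n])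
    finally show ?thesis .
  qed
  then show "x * y \<in> stab" using stab_iff inc_mult[OF xi yi] by blast
qed

lemma H_inv: "x \<in> H \<Longrightarrow> inv\<^bsub>GL n\<^esub> x \<in> H"
proof
  assume x: "x \<in> H"
  then have xi: "x \<in> inc" "x \<in> carrier (GL n)" using stab_inc by auto
  let ?y = "inv\<^bsub>GL n\<^esub> x"
  have yi: "?y \<in> inc" using inc_inv[OF xi] .
  note c = inc_carrier[OF xi(1)] and y = GL_inv[OF xi(2)]
  show "?y \<in> carrier (GL n)" by (rule y(1))
  have "gamma (?y * Y) = gamma (Y * ?y)" if Y: "Y \<in> inc" for Y
  proof -
    note Yc = inc_carrier[OF Y]
    have Z: "?y * Y * ?y \<in> inc" using inc_mult yi Y by blast
    have "x * (?y * Y * ?y) = (x * ?y) * Y * ?y"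
      using c y(2) Yc by (simp add: assoc_mult_mat[of _ n n _ n _ n])
    then have e1: "x * (?y * Y * ?y) = Y * ?y" using y(2,3) Yc by simp
    have "?y * Y * ?y * x = ?y * Y * (?y * x)"
      using c y(2) Yc by (intro assoc_mult_mat[of _ n n _ n _ n]) auto
    then have e2: "?y * Y * ?y * x = ?y * Y" using y(2,4) Yc by simp
    have "gamma (x * (?y * Y * ?y)) = gamma (?y * Y * ?y * x)" using x Z stab_iff by blast
    then show ?thesis using e1 e2 by simp
  qed
  then show "?y \<in> stab" using stab_iff yi by blast
qed

lemma H_one: "1\<^sub>m n \<in> H"
proof
  have "gamma (1\<^sub>m n * Y) = gamma (Y * 1\<^sub>m n)" if "Y \<in> inc" for Y using inc_carrier[OF that] by simp
  then show "1\<^sub>m n \<in> stab" using stab_iff inc_one by blast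
qed (rule GL_one)

end

section \<open>The image of the stabiliser under the adjoint action is closed\<close>

text \<open>If a linear system has only the trivial solution, its Gram matrix is invertible. Keeping one
  of the two factors of the Gram matrix constant makes its determinant a polynomial.\<close>

lemma nontrivial_kernel_closed:
  fixes E :: "('t \<Rightarrow> 'i \<Rightarrow> complex) set"
  assumes fin: "finite E" "finite I"
    and poly: "\<And>a x. a \<in> E \<Longrightarrow> x \<in> I \<Longrightarrow> (\<lambda>T. a T x) \<in> poly_funs C"
    and triv: "\<And>v x. (\<And>a. a \<in> E \<Longrightarrow> (\<Sum>x\<in>I. a T0 x * v x) = 0) \<Longrightarrow> x \<in> I \<Longrightarrow> v x = 0"
  shows "\<exists>F \<in> poly_funs C. F T0 \<noteq> 0 \<and>
    (\<forall>T v x. x \<in> I \<longrightarrow> v x \<noteq> 0 \<longrightarrow> (\<forall>a\<in>E. (\<Sum>x\<in>I. a T x * v x) = 0) \<longrightarrow> F T = 0)"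
proof -
  define N where "N = card I"
  obtain e where e: "bij_betw e {..<N} I"
    using ex_bij_betw_nat_finite[OF fin(2)] by (auto simp: N_def atLeast0LessThan)
  have eI: "e x \<in> I" if "x < N" for x using bij_betwE[OF e] that by simp
  have sum_e: "(\<Sum>x\<in>I. F x) = (\<Sum>x<N. F (e x))" for F :: "'i \<Rightarrow> complex"
    using sum.reindex_bij_betw[OF e, of F] by simp
  define gr where "gr T = (\<lambda>x y. \<Sum>a\<in>E. cnj (a T0 (e x)) * a T (e y))" for T
  define Gr where "Gr T = mat N N (\<lambda>(x, y). gr T x y)" for T
  have Grc: "Gr T \<in> carrier_mat N N" for T by (simp add: Gr_def)
  have mv: "(Gr T *\<^sub>v w) $ x = (\<Sum>a\<in>E. cnj (a T0 (e x)) * (\<Sum>y<N. a T (e y) * w $ y))"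
    if "w \<in> carrier_vec N" "x < N" for T w x
  proof -
    have "(Gr T *\<^sub>v w) $ x = (\<Sum>y<N. \<Sum>a\<in>E. cnj (a T0 (e x)) * (a T (e y) * w $ y))"
      unfolding mult_mat_vec_entry[OF Grc that]
      using that by (intro sum.cong HOL.refl) (simp add: Gr_def gr_def sum_distrib_right mult.assoc)
    then show ?thesis by (subst (asm) sum.swap) (simp add: sum_distrib_left)
  qed
  have p: "(\<lambda>T. det (Gr T)) \<in> poly_funs C"
    unfolding Gr_def gr_def
    by (intro poly_funs_det poly_funs_sum poly_funs.mult poly_funs.const poly eI)
  have nz: "det (Gr T0) \<noteq> 0"
  proof
    assume "det (Gr T0) = 0"
    then obtain w where w: "w \<in> carrier_vec N" "w \<noteq> 0\<^sub>v N" "Gr T0 *\<^sub>v w = 0\<^sub>v N"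
      using det_0_iff_vec_prod_zero_field[OF Grc] by blast
    let ?s = "\<lambda>a. \<Sum>y<N. a T0 (e y) * w $ y"
    have "0 = (\<Sum>x<N. cnj (w $ x) * (Gr T0 *\<^sub>v w) $ x)" using w(3) by simp
    also have "\<dots> = (\<Sum>x<N. \<Sum>a\<in>E. cnj (w $ x) * cnj (a T0 (e x)) * ?s a)"
      using mv[OF w(1)] by (intro sum.cong HOL.refl) (simp add: sum_distrib_left mult.assoc)
    also have "\<dots> = (\<Sum>a\<in>E. \<Sum>x<N. cnj (w $ x) * cnj (a T0 (e x)) * ?s a)" by (rule sum.swap)
    also have "\<dots> = (\<Sum>a\<in>E. cnj (?s a) * ?s a)"
    proof (rule sum.cong[OF HOL.refl])
      fix a
      have "(\<Sum>x<N. cnj (w $ x) * cnj (a T0 (e x))) = cnj (?s a)"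
        by (simp add: cnj_sum mult.commute)
      then show "(\<Sum>x<N. cnj (w $ x) * cnj (a T0 (e x)) * ?s a) = cnj (?s a) * ?s a"
        by (simp only: sum_distrib_right[symmetric])
    qed
    also have "\<dots> = complex_of_real (\<Sum>a\<in>E. (cmod (?s a))\<^sup>2)"
      unfolding of_real_sum
    proof (rule sum.cong[OF HOL.refl])
      fix a show "cnj (?s a) * ?s a = complex_of_real ((cmod (?s a))\<^sup>2)"
        unfolding complex_norm_square by (rule mult.commute)
    qed
    finally have "complex_of_real (\<Sum>a\<in>E. (cmod (?s a))\<^sup>2) = 0" by (rule sym)
    then have "(\<Sum>a\<in>E. (cmod (?s a))\<^sup>2) = 0" by (simp only: of_real_eq_0_iff)
    then have s0: "?s a = 0" if "a \<in> E" for a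
      using sum_nonneg_eq_0_iff[OF fin(1), of "\<lambda>a. (cmod (?s a))\<^sup>2"] that by simp
    define v where "v = (\<lambda>i. w $ inv_into {..<N} e i)"
    have ve: "v (e x) = w $ x" if "x < N" for x
      using inv_into_f_f[OF bij_betw_imp_inj_on[OF e], of x] that by (simp add: v_def)
    have "(\<Sum>x\<in>I. a T0 x * v x) = 0" if "a \<in> E" for a
      unfolding sum_e using s0[OF that] ve by simp
    then have "v (e x) = 0" if "x < N" for x using triv eI that by blast
    then have "w = 0\<^sub>v N" using ve w(1) by (intro eq_vecI) auto
    then show False using w(2) by blast
  qed
  have z: "det (Gr T) = 0"
    if x: "x \<in> I" "v x \<noteq> 0" and v: "\<forall>a\<in>E. (\<Sum>x\<in>I. a T x * v x) = 0" for T v x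
  proof -
    let ?w = "vec N (\<lambda>x. v (e x))"
    have z: "Gr T *\<^sub>v ?w = 0\<^sub>v N"
    proof (rule eq_vecI)
      fix y assume "y < dim_vec (0\<^sub>v N :: complex vec)"
      then have y: "y < N" by simp
      have "(\<Sum>y<N. a T (e y) * ?w $ y) = 0" if "a \<in> E" for a
        using v that unfolding sum_e by simp
      then show "(Gr T *\<^sub>v ?w) $ y = 0\<^sub>v N $ y"
        unfolding mv[OF vec_carrier y] using y by simp
    qed (use Grc[of T] in simp)
    obtain y where y: "y < N" "x = e y" using e x(1) by (auto simp: bij_betw_def)
    have nz: "?w \<noteq> 0\<^sub>v N"
    proof
      assume "?w = 0\<^sub>v N"
      then have "?w $ y = 0" using y(1) by simp
      then show False using x(2) y by simp
    qed
    have "\<exists>w. w \<in> carrier_vec N \<and> w \<noteq> 0\<^sub>v N \<and> Gr T *\<^sub>v w = 0\<^sub>v N"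
      by (intro exI[of _ ?w] conjI vec_carrier z nz)
    then show ?thesis using det_0_iff_vec_prod_zero_field[OF Grc[of T]] by simp
  qed
  show ?thesis by (intro bexI[of _ "\<lambda>T. det (Gr T)"] conjI allI impI p nz z)
qed

section \<open>The general linear group of the algebra\<close>

context incidence
begin

lemma zero_inc: "0\<^sub>m n n \<in> inc"
  by (rule incI) auto

lemma linear_bij_in: "T \<in> linear_bij inc \<Longrightarrow> X \<in> inc \<Longrightarrow> T X \<in> inc"
  unfolding linear_bij_def using Bij_imp_funcset by blast

lemma linear_bij_add: "T \<in> linear_bij inc \<Longrightarrow> X \<in> inc \<Longrightarrow> Y \<in> inc \<Longrightarrow> T (X + Y) = T X + T Y"
  by (simp add: linear_bij_def)

lemma linear_bij_smult: "T \<in> linear_bij inc \<Longrightarrow> X \<in> inc \<Longrightarrow> T (a \<cdot>\<^sub>m X) = a \<cdot>\<^sub>m T X"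
  by (simp add: linear_bij_def)

lemma linear_bij_zero:
  assumes "T \<in> linear_bij inc"
  shows "T (0\<^sub>m n n) = 0\<^sub>m n n"
proof -
  have "T (0 \<cdot>\<^sub>m 0\<^sub>m n n) = 0 \<cdot>\<^sub>m T (0\<^sub>m n n)" using linear_bij_smult[OF assms zero_inc] .
  moreover have "T (0\<^sub>m n n) \<in> carrier_mat n n" using linear_bij_in[OF assms zero_inc] inc_carrier by blast
  moreover have "0 \<cdot>\<^sub>m M = 0\<^sub>m n n" if "M \<in> carrier_mat n n" for M :: "complex mat"
    using that by (intro eq_matI) auto
  ultimately show ?thesis by simp
qed

lemma linear_bij_inj: "T \<in> linear_bij inc \<Longrightarrow> X \<in> inc \<Longrightarrow> Y \<in> inc \<Longrightarrow> T X = T Y \<Longrightarrow> X = Y"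
  unfolding linear_bij_def Bij_def bij_betw_def inj_on_def by blast

lemma GL_of_simps:
  "carrier (GL_of inc) = linear_bij inc"
  "\<one>\<^bsub>GL_of inc\<^esub> = (\<lambda>X\<in>inc. X)"
  "T \<in> linear_bij inc \<Longrightarrow> U \<in> linear_bij inc \<Longrightarrow> T \<otimes>\<^bsub>GL_of inc\<^esub> U = compose inc T U"
  by (simp_all add: GL_of_def BijGroup_def linear_bij_def)

lemma subgroup_linear_bij: "subgroup (linear_bij inc) (BijGroup inc)"
proof (rule group.subgroupI[OF group_BijGroup])
  show "linear_bij inc \<subseteq> carrier (BijGroup inc)" by (auto simp: linear_bij_def BijGroup_def)
  have "(\<lambda>X\<in>inc. X) \<in> linear_bij inc"
    using id_Bij inc_add inc_smult by (simp add: linear_bij_def)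
  then show "linear_bij inc \<noteq> {}" by blast
next
  fix T assume T: "T \<in> linear_bij inc"
  then have B: "T \<in> Bij inc" by (simp add: linear_bij_def)
  let ?U = "\<lambda>X\<in>inc. inv_into inc T X"
  have U: "?U X \<in> inc" "T (?U X) = X" if "X \<in> inc" for X
    using Bij_inv_into_mem[OF B that] that B by (auto simp: Bij_def bij_betw_def f_inv_into_f)
  have "?U (X + Y) = ?U X + ?U Y" if "X \<in> inc" "Y \<in> inc" for X Y
    by (rule linear_bij_inj[OF T]) (use U inc_add linear_bij_add[OF T] that in metis)+
  moreover have "?U (a \<cdot>\<^sub>m X) = a \<cdot>\<^sub>m ?U X" if "X \<in> inc" for X a
    by (rule linear_bij_inj[OF T]) (use U inc_smult linear_bij_smult[OF T] that in metis)+
  ultimately show "inv\<^bsub>BijGroup inc\<^esub> T \<in> linear_bij inc"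
    unfolding inv_BijGroup[OF B] using restrict_inv_into_Bij[OF B] by (simp add: linear_bij_def)
next
  fix T U assume T: "T \<in> linear_bij inc" and U: "U \<in> linear_bij inc"
  then have B: "T \<in> Bij inc" "U \<in> Bij inc" by (auto simp: linear_bij_def)
  then have "T \<otimes>\<^bsub>BijGroup inc\<^esub> U = compose inc T U" by (simp add: BijGroup_def)
  moreover have "compose inc T U \<in> linear_bij inc"
    using compose_Bij[OF B] inc_add inc_smult linear_bij_in[OF U] linear_bij_add T U
    by (simp add: linear_bij_def compose_def)
  ultimately show "T \<otimes>\<^bsub>BijGroup inc\<^esub> U \<in> linear_bij inc" by simp
qed

lemma GL_of_group: "group (GL_of inc)"
  unfolding GL_of_def using subgroup.subgroup_is_group[OF subgroup_linear_bij group_BijGroup] .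

end

section \<open>The adjoint action of the group\<close>

context fat_group
begin

lemma Ad_apply: "X \<in> inc \<Longrightarrow> Ad n Q h X = h * X * inv\<^bsub>GL n\<^esub> h"
  by (simp add: Ad_def lie conj_mat_def)

lemma Ad_extensional: "Ad n Q h \<in> extensional inc"
  by (simp add: Ad_def lie)

lemma Q_carrier: "h \<in> Q \<Longrightarrow> h \<in> carrier_mat n n"
  using Q_eq inc_carrier by auto

lemma conj_conj:
  fixes h k k' h' X :: "complex mat"
  assumes "h \<in> carrier_mat n n" "k \<in> carrier_mat n n" "X \<in> carrier_mat n n" "k' \<in> carrier_mat n n" "h' \<in> carrier_mat n n"
  shows "h * (k * X * k') * h' = (h * k) * X * (k' * h')"
  using assms by (simp add: assoc_mult_mat[of _ n n _ n _ n])

lemma Q_GL_inv: "h \<in> Q \<Longrightarrow> h * inv\<^bsub>GL n\<^esub> h = 1\<^sub>m n" "h \<in> Q \<Longrightarrow> inv\<^bsub>GL n\<^esub> h * h = 1\<^sub>m n"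
  using GL_inv Q_GL by blast+

lemma Ad_in_inc: "h \<in> Q \<Longrightarrow> X \<in> inc \<Longrightarrow> Ad n Q h X \<in> inc"
  using Q_normalises Ad_apply by simp

lemma Ad_compose:
  assumes "h \<in> Q" "k \<in> Q" "X \<in> inc"
  shows "Ad n Q h (Ad n Q k X) = Ad n Q (h * k) X"
proof -
  have "inv\<^bsub>GL n\<^esub> (h * k) = inv\<^bsub>GL n\<^esub> k * inv\<^bsub>GL n\<^esub> h"
    using group.inv_mult_group[OF GL_group[of n], of h k] Q_GL assms by (auto simp: GL_simps)
  then show ?thesis
    using conj_conj[of h k X "inv\<^bsub>GL n\<^esub> k" "inv\<^bsub>GL n\<^esub> h"] Ad_in_inc[OF assms(2,3)] assms Q_inv
    by (simp add: Ad_apply Q_carrier inc_carrier)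
qed

lemma inv_one: "inv\<^bsub>GL n\<^esub> (1\<^sub>m n) = (1\<^sub>m n :: complex mat)"
  by (rule GL_inv_eqI) auto

lemma Ad_one: "X \<in> inc \<Longrightarrow> Ad n Q (1\<^sub>m n) X = X"
  using inc_carrier[of X] by (simp add: Ad_apply inv_one)

lemma Ad_linear_bij:
  assumes h: "h \<in> Q"
  shows "Ad n Q h \<in> linear_bij inc"
proof -
  note hi = Q_inv[OF h]
  have c: "h \<in> carrier_mat n n" "inv\<^bsub>GL n\<^esub> h \<in> carrier_mat n n" using Q_carrier h hi by auto
  have "bij_betw (Ad n Q h) inc inc"
  proof (rule bij_betw_byWitness[where f' = "Ad n Q (inv\<^bsub>GL n\<^esub> h)"])
    show "\<forall>X\<in>inc. Ad n Q (inv\<^bsub>GL n\<^esub> h) (Ad n Q h X) = X" "\<forall>X\<in>inc. Ad n Q h (Ad n Q (inv\<^bsub>GL n\<^esub> h) X) = X"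
      using Ad_compose[OF hi h] Ad_compose[OF h hi] Q_GL_inv[OF h] Ad_one by auto
    show "Ad n Q h ` inc \<subseteq> inc" "Ad n Q (inv\<^bsub>GL n\<^esub> h) ` inc \<subseteq> inc" using Ad_in_inc h hi by auto
  qed
  moreover have "Ad n Q h (X + Y) = Ad n Q h X + Ad n Q h Y" if "X \<in> inc" "Y \<in> inc" for X Y
    using inc_carrier[OF that(1)] inc_carrier[OF that(2)] inc_add[OF that] c that
    by (simp add: Ad_apply mult_add_distrib_mat[of h n n] add_mult_distrib_mat[of "h * X" n n "h * Y"])
  moreover have "Ad n Q h (a \<cdot>\<^sub>m X) = a \<cdot>\<^sub>m Ad n Q h X" if "X \<in> inc" for X a
    using smult_conj[OF c inc_carrier[OF that]] inc_smult[OF that] that by (simp add: Ad_apply)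
  ultimately show ?thesis using Ad_extensional by (simp add: linear_bij_def Bij_def)
qed

lemma Ad_mult: "h \<in> Q \<Longrightarrow> k \<in> Q \<Longrightarrow> Ad n Q h \<otimes>\<^bsub>GL_of inc\<^esub> Ad n Q k = Ad n Q (h * k)"
  using Ad_linear_bij[of h] Ad_linear_bij[of k] Ad_compose Ad_extensional[of "h * k"]
  by (auto simp: GL_of_simps compose_def extensional_def)

lemma Ad_one_GL: "Ad n Q (1\<^sub>m n) = \<one>\<^bsub>GL_of inc\<^esub>"
  using Ad_one Ad_extensional[of "1\<^sub>m n"] by (auto simp: GL_of_simps extensional_def)

lemma Ad_inv: "h \<in> Q \<Longrightarrow> inv\<^bsub>GL_of inc\<^esub> (Ad n Q h) = Ad n Q (inv\<^bsub>GL n\<^esub> h)"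
  using group.inv_equality[OF GL_of_group] Ad_mult[OF Q_inv] Ad_linear_bij Q_inv Q_GL_inv Ad_one_GL
  by (simp add: GL_of_simps(1))

lemma Ad_H_subgroup: "subgroup (Ad n Q ` H) (GL_of inc)"
proof (rule group.subgroupI[OF GL_of_group])
  show "Ad n Q ` H \<subseteq> carrier (GL_of inc)" using Ad_linear_bij H_Q by (auto simp: GL_of_simps(1))
  show "Ad n Q ` H \<noteq> {}" using H_one by blast
  show "inv\<^bsub>GL_of inc\<^esub> T \<in> Ad n Q ` H" if T: "T \<in> Ad n Q ` H" for T
  proof -
    obtain h where "h \<in> H" "T = Ad n Q h" using T by blast
    then show ?thesis using Ad_inv[OF H_Q] H_inv by blast
  qed
  show "T \<otimes>\<^bsub>GL_of inc\<^esub> U \<in> Ad n Q ` H" if T: "T \<in> Ad n Q ` H" and U: "U \<in> Ad n Q ` H" for T U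
  proof -
    obtain h k where "h \<in> H" "T = Ad n Q h" "k \<in> H" "U = Ad n Q k" using T U by blast
    then show ?thesis using Ad_mult[OF H_Q H_Q] H_mult by blast
  qed
qed

text \<open>Connected components of the preorder. Conjugation by a matrix that is scalar on each
  class is trivial on the algebra, so an implementing element is determined only up to such scalars
  and is sought for each class separately.\<close>

definition cls :: "nat \<Rightarrow> nat set" where
  "cls i = {j. j < n \<and> (i, j) \<in> {(i, j). i < n \<and> j < n \<and> (rel i j \<or> rel j i)}\<^sup>*}"

lemma cls_self: "i < n \<Longrightarrow> i \<in> cls i"
  by (simp add: cls_def)

lemma cls_eq:
  assumes "i < n" "j < n" "rel i j"
  shows "cls i = cls j"
proof -
  let ?r = "{(i, j). i < n \<and> j < n \<and> (rel i j \<or> rel j i)}"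
  have "(i, j) \<in> ?r" "(j, i) \<in> ?r" using assms by auto
  then have "(i, k) \<in> ?r\<^sup>* \<longleftrightarrow> (j, k) \<in> ?r\<^sup>*" for k by (meson converse_rtrancl_into_rtrancl)
  then show ?thesis by (simp add: cls_def)
qed

lemma cls_mem: "i < n \<Longrightarrow> j \<in> cls i \<Longrightarrow> cls j = cls i"
proof -
  let ?r = "{(i, j). i < n \<and> j < n \<and> (rel i j \<or> rel j i)}"
  assume "i < n" "j \<in> cls i"
  then have "(i, j) \<in> ?r\<^sup>*" by (simp add: cls_def)
  then show ?thesis
    by (induction rule: rtrancl_induct) (use cls_eq in auto)
qed

lemma cls_c: "i < n \<Longrightarrow> j < n \<Longrightarrow> c i = c j \<Longrightarrow> cls i = cls j"
  by (rule cls_eq) (auto simp: rel_def)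

lemma cls_f:
  assumes "i < n"
  shows "cls (f i) = cls i"
proof (cases "c (f i) \<le> c i")
  case True
  then have "rel i (f i)" using rel_alt[of i "f i"] A.r_f[OF assms] A.f_less[OF assms] assms by blast
  then show ?thesis using cls_eq[OF assms A.f_less[OF assms]] by simp
next
  case False
  then have "rel (f i) i"
    using rel_alt[of "f i" i] A.r_sym[OF assms A.f_less[OF assms] A.r_f[OF assms]] A.f_less[OF assms] assms
    by simp
  then show ?thesis using cls_eq[OF A.f_less[OF assms] assms] by simp
qed

lemma cls_g:
  assumes "i < n"
  shows "cls (g i) = cls i"
proof (cases "c i \<le> c (g i)")
  case True
  then have "rel i (g i)" using rel_alt[of i "g i"] B.r_f[OF assms] B.f_less[OF assms] assms by blast
  then show ?thesis using cls_eq[OF assms B.f_less[OF assms]] by simp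
next
  case False
  then have "rel (g i) i"
    using rel_alt[of "g i" i] B.r_sym[OF assms B.f_less[OF assms] B.r_f[OF assms]] B.f_less[OF assms] assms
    by simp
  then show ?thesis using cls_eq[OF B.f_less[OF assms] assms] by simp
qed

text \<open>The linear system for the entries of an element of the stabiliser that is supported on the
  class \<open>K\<close> and implements \<open>T\<close> by conjugation.\<close>

definition solves :: "(complex mat \<Rightarrow> complex mat) \<Rightarrow> nat set \<Rightarrow> (nat \<times> nat \<Rightarrow> complex) \<Rightarrow> bool" where
  "solves T K v \<longleftrightarrow>
    (\<forall>p<n. \<forall>q<n. rel p q \<longrightarrow> (\<forall>k<n. \<forall>l<n.
       (\<Sum>m<n. T (unit_mat p q) $$ (k, m) * v (m, l)) = (if l = q then v (k, p) else 0))) \<and>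
    (\<forall>i<n. \<forall>j<n. c i \<noteq> c j \<or> i \<notin> K \<longrightarrow> v (i, j) = 0) \<and>
    (\<forall>i<n. \<forall>j<n. c i = c j \<longrightarrow> v (f i, f j) = v (i, j) \<and> v (g i, g j) = v (i, j))"

lemma entry_poly:
  assumes "p < n" "q < n" "rel p q" "k < n" "l < n"
  shows "(\<lambda>T. T (unit_mat p q) $$ (k, l)) \<in> poly_funs (end_coords inc)"
proof (rule poly_funs.coord)
  have "linear_form inc (\<lambda>A. A $$ (k, l))"
    using assms inc_carrier unfolding linear_form_def by (auto dest!: inc_carrier)
  then show "(\<lambda>T. T (unit_mat p q) $$ (k, l)) \<in> end_coords inc"
    unfolding end_coords_def using unit_mat_inc[OF assms(1-3)]
    by (intro CollectI exI[of _ "\<lambda>A. A $$ (k, l)"] exI[of _ "unit_mat p q"]) simp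
qed

lemma sum_pair_delta:
  assumes "i < n" "j < n"
  shows "(\<Sum>x\<in>{..<n} \<times> {..<n}. (if x = (i, j) then 1 else 0) * v x) = (v (i, j) :: complex)"
proof -
  have "(\<Sum>x\<in>{..<n} \<times> {..<n}. (if x = (i, j) then 1 else 0) * v x) = (\<Sum>x\<in>{..<n} \<times> {..<n}. if x = (i, j) then v x else 0)"
    by (rule sum.cong) auto
  then show ?thesis using assms by simp
qed

text \<open>The conditions are linear in \<open>v\<close> with coefficients polynomial in
  \<open>T\<close>: \<open>rA\<close>, \<open>rB\<close> and \<open>rC\<close> are the rows for the
  conjugation, the support and the invariance.\<close>

lemma solves_closed:
  assumes triv: "\<And>v k l. solves T0 K v \<Longrightarrow> k < n \<Longrightarrow> l < n \<Longrightarrow> v (k, l) = 0"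
  shows "\<exists>F \<in> poly_funs (end_coords inc). F T0 \<noteq> 0 \<and>
    (\<forall>T v k l. k < n \<longrightarrow> l < n \<longrightarrow> v (k, l) \<noteq> 0 \<longrightarrow> solves T K v \<longrightarrow> F T = 0)"
proof -
  let ?I = "{..<n} \<times> {..<n}"
  define rA where "rA = (\<lambda>(p, q, k, l) (T :: complex mat \<Rightarrow> complex mat) x.
    (if snd x = l then T (unit_mat p q) $$ (k, fst x) else 0) - (if l = q then (if x = (k, p) then 1 else 0) else (0::complex)))"
  define rB where "rB = (\<lambda>y (T :: complex mat \<Rightarrow> complex mat) (x :: nat \<times> nat). if x = y then 1 else (0::complex))"
  define rC where "rC = (\<lambda>h (i :: nat, j :: nat) (T :: complex mat \<Rightarrow> complex mat) (x :: nat \<times> nat).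
    (if x = (h i, h j) then 1 else 0) - (if x = (i, j) then 1 else (0::complex)))"
  define IA where "IA = {(p, q, k, l). p < n \<and> q < n \<and> rel p q \<and> k < n \<and> l < n}"
  define IB where "IB = {(i, j). i < n \<and> j < n \<and> (c i \<noteq> c j \<or> i \<notin> K)}"
  define IC where "IC = {(i, j). i < n \<and> j < n \<and> c i = c j}"
  let ?E = "rA ` IA \<union> rB ` IB \<union> rC f ` IC \<union> rC g ` IC"
  have "IA \<subseteq> {..<n} \<times> {..<n} \<times> {..<n} \<times> {..<n}" "IB \<subseteq> ?I" "IC \<subseteq> ?I"
    by (auto simp: IA_def IB_def IC_def)
  then have "finite IA" "finite IB" "finite IC" by (auto elim: finite_subset)
  then have finE: "finite ?E" by simp
  have sA: "(\<Sum>x\<in>?I. rA (p, q, k, l) T x * v x) =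
      (\<Sum>m<n. T (unit_mat p q) $$ (k, m) * v (m, l)) - (if l = q then v (k, p) else 0)"
    if "p < n" "q < n" "k < n" "l < n" for p q k l T v
  proof -
    have "(\<Sum>x\<in>?I. rA (p, q, k, l) T x * v x) =
       (\<Sum>x\<in>?I. (if snd x = l then T (unit_mat p q) $$ (k, fst x) * v x else 0)) -
       (\<Sum>x\<in>?I. if l = q then (if x = (k, p) then 1 else 0) * v x else 0)"
      unfolding sum_subtractf[symmetric] by (intro sum.cong HOL.refl) (auto simp: rA_def algebra_simps)
    also have "(\<Sum>x\<in>?I. (if snd x = l then T (unit_mat p q) $$ (k, fst x) * v x else 0)) =
       (\<Sum>m<n. \<Sum>j<n. if j = l then T (unit_mat p q) $$ (k, m) * v (m, l) else 0)"
      unfolding sum.cartesian_product by (intro sum.cong HOL.refl) auto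
    also have "\<dots> = (\<Sum>m<n. T (unit_mat p q) $$ (k, m) * v (m, l))" using that by simp
    also have "(\<Sum>x\<in>?I. if l = q then (if x = (k, p) then 1 else 0) * v x else 0) = (if l = q then v (k, p) else 0)"
      using sum_pair_delta[of k p v] that by (cases "l = q") auto
    finally show ?thesis .
  qed
  have sB: "(\<Sum>x\<in>?I. rB (i, j) T x * v x) = v (i, j)" if "i < n" "j < n" for i j T v
    unfolding rB_def using sum_pair_delta[OF that] .
  have sC: "(\<Sum>x\<in>?I. rC h (i, j) T x * v x) = v (h i, h j) - v (i, j)"
    if "i < n" "j < n" "h i < n" "h j < n" for h i j T v
    using sum_pair_delta[of "h i" "h j" v] sum_pair_delta[of i j v] that
    by (simp add: rC_def left_diff_distrib sum_subtractf)
  have sol: "(\<forall>a\<in>?E. (\<Sum>x\<in>?I. a T x * v x) = 0) \<longleftrightarrow> solves T K v" for T v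
  proof -
    have e1: "(\<forall>a\<in>rA ` IA. (\<Sum>x\<in>?I. a T x * v x) = 0) \<longleftrightarrow> (\<forall>p<n. \<forall>q<n. rel p q \<longrightarrow> (\<forall>k<n. \<forall>l<n.
       (\<Sum>m<n. T (unit_mat p q) $$ (k, m) * v (m, l)) = (if l = q then v (k, p) else 0)))"
      by (auto simp: IA_def sA)
    have e2: "(\<forall>a\<in>rB ` IB. (\<Sum>x\<in>?I. a T x * v x) = 0) \<longleftrightarrow>
       (\<forall>i<n. \<forall>j<n. c i \<noteq> c j \<or> i \<notin> K \<longrightarrow> v (i, j) = 0)"
      by (auto simp: IB_def sB)
    have e3: "(\<forall>a\<in>rC f ` IC. (\<Sum>x\<in>?I. a T x * v x) = 0) \<longleftrightarrow>
       (\<forall>i<n. \<forall>j<n. c i = c j \<longrightarrow> v (f i, f j) = v (i, j))"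
      by (auto simp: IC_def sC A.f_less)
    have e4: "(\<forall>a\<in>rC g ` IC. (\<Sum>x\<in>?I. a T x * v x) = 0) \<longleftrightarrow>
       (\<forall>i<n. \<forall>j<n. c i = c j \<longrightarrow> v (g i, g j) = v (i, j))"
      by (auto simp: IC_def sC B.f_less)
    show ?thesis unfolding solves_def ball_Un e1 e2 e3 e4 by meson
  qed
  have poly: "(\<lambda>T. a T x) \<in> poly_funs (end_coords inc)" if a: "a \<in> ?E" and x: "x \<in> ?I" for a x
  proof -
    have "(\<lambda>T. rA y T x) \<in> poly_funs (end_coords inc)" if y: "y \<in> IA" for y
    proof -
      obtain p q k l where "y = (p, q, k, l)" "p < n" "q < n" "rel p q" "k < n" "l < n"
        using y by (auto simp: IA_def)
      then have 1: "(\<lambda>T. if snd x = l then T (unit_mat p q) $$ (k, fst x) else 0) \<in> poly_funs (end_coords inc)"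
        using entry_poly[of p q k "fst x"] poly_funs.const[of 0] x by (cases "snd x = l") auto
      have e: "(\<lambda>T. rA y T x) = (\<lambda>T. (if snd x = l then T (unit_mat p q) $$ (k, fst x) else 0) -
          (if l = q then (if x = (k, p) then 1 else 0) else 0))"
        by (simp add: rA_def \<open>y = _\<close>)
      show ?thesis unfolding e by (rule poly_funs_diff[OF 1 poly_funs.const])
    qed
    then show ?thesis using a by (auto simp: rB_def rC_def intro: poly_funs.const split: prod.splits)
  qed
  have fI: "finite ?I" by simp
  have "\<exists>F \<in> poly_funs (end_coords inc). F T0 \<noteq> 0 \<and>
    (\<forall>T v x. x \<in> ?I \<longrightarrow> v x \<noteq> 0 \<longrightarrow> (\<forall>a\<in>?E. (\<Sum>x\<in>?I. a T x * v x) = 0) \<longrightarrow> F T = 0)"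
  proof (rule nontrivial_kernel_closed[OF finE fI], erule (1) poly)
    fix v x assume v: "\<And>a. a \<in> ?E \<Longrightarrow> (\<Sum>x\<in>?I. a T0 x * v x) = 0" and x: "x \<in> ?I"
    have "solves T0 K v" using sol v by blast
    then show "v x = 0" using triv[of v "fst x" "snd x"] x by auto
  qed
  then show ?thesis unfolding sol by (metis lessThan_iff mem_Sigma_iff)
qed


lemma conj_unit_entry:
  assumes "h \<in> carrier_mat n n" "h' \<in> carrier_mat n n" "p < n" "q < n" "k < n" "l < n"
  shows "(h * unit_mat p q * h') $$ (k, l) = h $$ (k, p) * h' $$ (q, l)"
proof -
  have "(h * unit_mat p q * h') $$ (k, l) =
      (\<Sum>j<n. \<Sum>i<n. h $$ (k, i) * unit_mat p q $$ (i, j) * h' $$ (j, l))"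
    by (rule triple_entry) (use assms in auto)
  also have "\<dots> = (\<Sum>j<n. \<Sum>i<n. if i = p then (if j = q then h $$ (k, p) * h' $$ (q, l) else 0) else 0)"
    by (intro sum.cong HOL.refl) (auto simp: unit_mat_entry)
  finally show ?thesis using assms by simp
qed

lemma H_facts:
  assumes "h \<in> H"
  shows "h \<in> carrier_mat n n" "inv\<^bsub>GL n\<^esub> h \<in> carrier_mat n n" "inv\<^bsub>GL n\<^esub> h \<in> stab" "h \<in> stab"
    "h * inv\<^bsub>GL n\<^esub> h = 1\<^sub>m n" "inv\<^bsub>GL n\<^esub> h * h = 1\<^sub>m n"
  using assms H_inv[OF assms] stab_carrier Q_GL_inv[OF H_Q[OF assms]] by auto

lemma solvesD:
  assumes "solves T K v"
  shows "p < n \<Longrightarrow> q < n \<Longrightarrow> rel p q \<Longrightarrow> k < n \<Longrightarrow> l < n \<Longrightarrow>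
      (\<Sum>m<n. T (unit_mat p q) $$ (k, m) * v (m, l)) = (if l = q then v (k, p) else 0)"
    and "i < n \<Longrightarrow> j < n \<Longrightarrow> c i \<noteq> c j \<or> i \<notin> K \<Longrightarrow> v (i, j) = 0"
    and "i < n \<Longrightarrow> j < n \<Longrightarrow> c i = c j \<Longrightarrow> v (f i, f j) = v (i, j) \<and> v (g i, g j) = v (i, j)"
  by (fact assms[unfolded solves_def, THEN conjunct1, rule_format]
      assms[unfolded solves_def, THEN conjunct2, THEN conjunct1, rule_format]
      assms[unfolded solves_def, THEN conjunct2, THEN conjunct2, rule_format])+

text \<open>Cutting \<open>h\<close> down to the rows of one class respects the equations, because
  neither \<open>rel\<close> nor equal positions nor the reflections lead out of a class.\<close>

lemma Ad_solves:
  assumes h: "h \<in> H" and i0: "i0 < n"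
  defines "v \<equiv> \<lambda>(i, j). if i \<in> cls i0 then h $$ (i, j) else 0"
  shows "solves (Ad n Q h) (cls i0) v" "\<exists>l<n. v (i0, l) \<noteq> 0"
proof -
  let ?h' = "inv\<^bsub>GL n\<^esub> h" and ?K = "cls i0"
  note hf = H_facts[OF h]
  have K: "i \<in> ?K \<longleftrightarrow> j \<in> ?K" if "cls i = cls j" "i < n" "j < n" for i j
    using cls_mem[OF i0] cls_self that by metis
  have 1: "(\<Sum>m<n. Ad n Q h (unit_mat p q) $$ (k, m) * v (m, l)) = (if l = q then v (k, p) else 0)"
    if pq: "p < n" "q < n" "rel p q" and kl: "k < n" "l < n" for p q k l
  proof -
    have "(\<Sum>m<n. Ad n Q h (unit_mat p q) $$ (k, m) * v (m, l)) =
        (\<Sum>m<n. (if q \<in> ?K then h $$ (k, p) else 0) * (?h' $$ (q, m) * h $$ (m, l)))"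
    proof (rule sum.cong[OF HOL.refl])
      fix m assume "m \<in> {..<n}"
      then have m: "m < n" by simp
      have "?h' $$ (q, m) = 0 \<or> (m \<in> ?K \<longleftrightarrow> q \<in> ?K)"
        using stab_zero[OF hf(3) pq(2) m] K[OF cls_c[OF m pq(2)] m pq(2)] by metis
      then show "Ad n Q h (unit_mat p q) $$ (k, m) * v (m, l) = (if q \<in> ?K then h $$ (k, p) else 0) * (?h' $$ (q, m) * h $$ (m, l))"
        unfolding Ad_apply[OF unit_mat_inc[OF pq]] conj_unit_entry[OF hf(1,2) pq(1,2) kl(1) m]
        by (auto simp: v_def)
    qed
    also have "\<dots> = (if q \<in> ?K then h $$ (k, p) else 0) * (?h' * h) $$ (q, l)"
      unfolding mult_mat_entry[OF hf(2,1) pq(2) kl(2)] sum_distrib_left[symmetric] ..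
    also have "\<dots> = (if l = q then (if q \<in> ?K then h $$ (k, p) else 0) else 0)"
      unfolding hf(6) using pq kl by simp
    also have "(if q \<in> ?K then h $$ (k, p) else 0) = v (k, p)"
    proof -
      have "q \<in> ?K \<longleftrightarrow> p \<in> ?K" using K[OF cls_eq[OF pq]] pq by blast
      moreover have "h $$ (k, p) = 0 \<or> (k \<in> ?K \<longleftrightarrow> p \<in> ?K)"
        using stab_zero[OF hf(4) kl(1) pq(1)] K[OF cls_c[OF kl(1) pq(1)] kl(1) pq(1)] by metis
      ultimately show ?thesis by (auto simp: v_def)
    qed
    finally show ?thesis .
  qed
  have 2: "v (i, j) = 0" if "i < n" "j < n" "c i \<noteq> c j \<or> i \<notin> ?K" for i j
    using that stab_zero[OF hf(4)] by (auto simp: v_def)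
  have 3: "v (f i, f j) = v (i, j)" "v (g i, g j) = v (i, j)" if "i < n" "j < n" "c i = c j" for i j
    using that hf(4) K[OF cls_f[OF that(1)] A.f_less[OF that(1)] that(1)]
      K[OF cls_g[OF that(1)] B.f_less[OF that(1)] that(1)]
    by (auto simp: v_def stab_def)
  show "solves (Ad n Q h) ?K v"
    unfolding solves_def by (intro conjI allI impI) (fact 1 2 3)+
  have "(\<Sum>l<n. h $$ (i0, l) * ?h' $$ (l, i0)) = 1"
    using mult_mat_entry[OF hf(1,2) i0 i0] hf(5) i0 by simp
  then have "\<exists>l<n. h $$ (i0, l) \<noteq> 0"
    by (metis (no_types, lifting) lessThan_iff mult_eq_0_iff sum.neutral zero_neq_one)
  then show "\<exists>l<n. v (i0, l) \<noteq> 0" using cls_self[OF i0] by (auto simp: v_def)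
qed

text \<open>Applying the matrix \<open>t y l0\<close> to a linear dependency of columns leaves only
  column \<open>y\<close>, multiplied by \<open>w l0\<close>. So the columns at one position are
  independent or all zero.\<close>

lemma column_zero_or_free:
  assumes T: "\<And>p q k l. p < n \<Longrightarrow> q < n \<Longrightarrow> rel p q \<Longrightarrow> k < n \<Longrightarrow> l < n \<Longrightarrow>
      (\<Sum>m<n. t p q k m * G m l) = (if l = q then G k p else 0)"
    and w: "\<And>k. k < n \<Longrightarrow> (\<Sum>l<n. G k l * w l) = (0 :: complex)"
    and supp: "\<And>l. l < n \<Longrightarrow> w l \<noteq> 0 \<Longrightarrow> c l = c y"
    and y: "y < n" and l0: "l0 < n" "w l0 \<noteq> 0" and k: "k < n"
  shows "G k y = 0"
proof -
  have rel: "rel y l0" using supp[OF l0] by (simp add: rel_def)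
  have "0 = (\<Sum>m<n. t y l0 k m * (\<Sum>l<n. G m l * w l))" using w by simp
  also have "\<dots> = (\<Sum>l<n. (\<Sum>m<n. t y l0 k m * G m l) * w l)"
    unfolding sum_distrib_left sum_distrib_right by (subst sum.swap) (simp add: mult.assoc)
  also have "\<dots> = (\<Sum>l<n. if l = l0 then G k y * w l0 else 0)"
    using T[OF y l0(1) rel k] by (intro sum.cong) auto
  also have "\<dots> = G k y * w l0" using l0 by simp
  finally show ?thesis using l0 by simp
qed

text \<open>Nonzero solutions for the classes are glued into one matrix that intertwines
  \<open>T0\<close>; the point is its invertibility. By \<open>column_zero_or_free\<close> only zero
  columns could spoil it, and these would spread over a whole class.\<close>

lemma conj_criterion:
  assumes T0: "T0 \<in> linear_bij inc"
    and supp: "\<And>p q k l. p < n \<Longrightarrow> q < n \<Longrightarrow> rel p q \<Longrightarrow> k < n \<Longrightarrow> l < n \<Longrightarrow>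
      T0 (unit_mat p q) $$ (k, l) \<noteq> 0 \<Longrightarrow> c k = c p \<and> c l = c q"
    and ex: "\<And>i. i < n \<Longrightarrow> \<exists>v k l. solves T0 (cls i) v \<and> k < n \<and> l < n \<and> v (k, l) \<noteq> 0"
  shows "T0 \<in> Ad n Q ` H"
proof -
  define s where "s K = (SOME v. solves T0 K v \<and> (\<exists>k<n. \<exists>l<n. v (k, l) \<noteq> 0))" for K
  have s: "solves T0 (cls i) (s (cls i))" "\<exists>k<n. \<exists>l<n. s (cls i) (k, l) \<noteq> 0" if "i < n" for i
  proof -
    have "\<exists>v. solves T0 (cls i) v \<and> (\<exists>k<n. \<exists>l<n. v (k, l) \<noteq> 0)" using ex[OF that] by blast
    from someI_ex[OF this] show "solves T0 (cls i) (s (cls i))" "\<exists>k<n. \<exists>l<n. s (cls i) (k, l) \<noteq> 0"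
      by (auto simp: s_def)
  qed
  have s_supp: "c k = c l \<and> cls k = cls i" if "i < n" "k < n" "l < n" "s (cls i) (k, l) \<noteq> 0" for i k l
    using solvesD(2)[OF s(1)[OF that(1)] that(2,3)] that(4) cls_mem[OF that(1)] by blast
  define G where "G k l = s (cls k) (k, l)" for k l
  have G_eq: "G k l = s (cls i) (k, l)" if "cls k = cls i" for i k l using that by (simp add: G_def)
  have G_supp: "c k = c l" if "k < n" "l < n" "G k l \<noteq> 0" for k l
    using s_supp[of k k l] that by (simp add: G_def)
  have GT: "(\<Sum>m<n. T0 (unit_mat p q) $$ (k, m) * G m l) = (if l = q then G k p else 0)"
    if pq: "p < n" "q < n" "rel p q" and kl: "k < n" "l < n" for p q k l
  proof -
    have "(\<Sum>m<n. T0 (unit_mat p q) $$ (k, m) * G m l) = (\<Sum>m<n. T0 (unit_mat p q) $$ (k, m) * s (cls q) (m, l))"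
    proof (rule sum.cong[OF HOL.refl])
      fix m assume "m \<in> {..<n}"
      then have m: "m < n" by simp
      have "T0 (unit_mat p q) $$ (k, m) = 0 \<or> cls m = cls q"
        using supp[OF pq kl(1) m] cls_c[OF m pq(2)] by blast
      then show "T0 (unit_mat p q) $$ (k, m) * G m l = T0 (unit_mat p q) $$ (k, m) * s (cls q) (m, l)"
        using G_eq by auto
    qed
    also have "\<dots> = (if l = q then s (cls q) (k, p) else 0)"
      by (rule solvesD(1)[OF s(1)[OF pq(2)] pq kl])
    also have "s (cls q) (k, p) = G k p"
    proof (cases "cls k = cls q")
      case False
      then have "s (cls q) (k, p) = 0" using s_supp[OF pq(2) kl(1) pq(1)] by blast
      moreover have "G k p = 0"
        using G_supp[OF kl(1) pq(1)] cls_c[OF kl(1) pq(1)] cls_eq[OF pq] False by auto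
      ultimately show ?thesis by simp
    qed (simp add: G_eq)
    finally show ?thesis .
  qed
  define Z where "Z = {x. x < n \<and> (\<forall>k<n. G k x = 0)}"
  have free: "x \<in> Z" if w: "\<And>k. k < n \<Longrightarrow> (\<Sum>l<n. G k l * w l) = 0"
    and ws: "\<And>l. l < n \<Longrightarrow> w l \<noteq> 0 \<Longrightarrow> c l = c x" and x: "x < n" "l0 < n" "w l0 \<noteq> 0" for w x l0
    using column_zero_or_free[where t = "\<lambda>p q k m. T0 (unit_mat p q) $$ (k, m)", OF GT w ws x] x(1)
    by (auto simp: Z_def)
  have Zc: "y \<in> Z" if "x \<in> Z" "y < n" "c x = c y" for x y
  proof (rule free[of "\<lambda>l. if l = x then 1 else 0" y x])
    fix k assume "k < n"
    then have "(\<Sum>l<n. G k l * (if l = x then 1 else 0)) = (\<Sum>l<n. if l = x then G k x else 0)"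
      by (intro sum.cong) auto
    then show "(\<Sum>l<n. G k l * (if l = x then 1 else 0)) = 0" using that \<open>k < n\<close> by (simp add: Z_def)
  qed (use that in \<open>auto simp: Z_def split: if_splits\<close>)
  \<comment> \<open>Zero columns are replaced by unit columns, to have an invertible matrix at hand
    before \<open>Z\<close> is known to be empty.\<close>
  define G' where "G' = mat n n (\<lambda>(k, l). if l \<in> Z then (if k = l then 1 else 0) else G k l)"
  have G'c: "G' \<in> carrier_mat n n" by (simp add: G'_def)
  have G's: "c k = c l" if "k < n" "l < n" "G' $$ (k, l) \<noteq> 0" for k l
    using that(3) G_supp[OF that(1,2)] that(1,2) by (auto simp: G'_def split: if_splits)
  have "det G' \<noteq> 0"
  proof
    assume "det G' = 0"
    then obtain w where w: "w \<in> carrier_vec n" "w \<noteq> 0\<^sub>v n" "G' *\<^sub>v w = 0\<^sub>v n"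
      using det_0_iff_vec_prod_zero_field[OF G'c] by blast
    then obtain x where x: "x < n" "w $ x \<noteq> 0" by (metis carrier_vecD eq_vecI index_zero_vec)
    \<comment> \<open>The dependency may be restricted to the position of \<open>x\<close> because
      \<open>G'\<close> has entries only between equal positions.\<close>
    define u where "u l = (if c l = c x then w $ l else 0)" for l
    have u: "(\<Sum>l<n. G' $$ (k, l) * u l) = 0" if k: "k < n" for k
    proof (cases "c k = c x")
      case True
      have "(\<Sum>l<n. G' $$ (k, l) * u l) = (\<Sum>l<n. G' $$ (k, l) * w $ l)"
        using G's[OF k] True by (intro sum.cong HOL.refl) (fastforce simp: u_def)
      also have "\<dots> = (G' *\<^sub>v w) $ k" using mult_mat_vec_entry[OF G'c w(1) k] by simp
      finally show ?thesis using w(3) k by simp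
    next
      case False
      then show ?thesis using G's[OF k] by (intro sum.neutral ballI) (fastforce simp: u_def)
    qed
    show False
    proof (cases "x \<in> Z")
      case True
      have "(\<Sum>l<n. G' $$ (x, l) * u l) = (\<Sum>l<n. if l = x then u x else 0)"
      proof (rule sum.cong[OF HOL.refl])
        fix l assume "l \<in> {..<n}"
        then have l: "l < n" by simp
        show "G' $$ (x, l) * u l = (if l = x then u x else 0)"
        proof (cases "c l = c x")
          case cl: True
          then have "l \<in> Z" using Zc[OF True l] by simp
          then show ?thesis using x l by (auto simp: G'_def)
        qed (use l in \<open>auto simp: u_def\<close>)
      qed
      then show False using u[OF x(1)] x by (simp add: u_def)
    next
      case False
      have z: "(\<Sum>l<n. G k l * u l) = 0" if k: "k < n" for k
      proof -
        have "(\<Sum>l<n. G k l * u l) = (\<Sum>l<n. G' $$ (k, l) * u l)"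
        proof (rule sum.cong[OF HOL.refl])
          fix l assume "l \<in> {..<n}"
          then have l: "l < n" by simp
          have "u l = 0 \<or> l \<notin> Z" using Zc[of l x] False x by (auto simp: u_def)
          then show "G k l * u l = G' $$ (k, l) * u l" using k l by (auto simp: G'_def)
        qed
        then show ?thesis using u[OF k] by simp
      qed
      have "x \<in> Z"
        by (rule free[OF z _ x(1,1)]) (use x(2) in \<open>auto simp: u_def split: if_splits\<close>)
      then show False using False by blast
    qed
  qed
  then have gl': "G' \<in> carrier (GL n)" using G'c by (simp add: GL_carrier_det)
  have down: "p \<in> Z" if "p < n" "q \<in> Z" "rel p q" for p q
  proof -
    have q: "q < n" "\<And>k. k < n \<Longrightarrow> G k q = 0" using that by (auto simp: Z_def)
    have "G k p = 0" if "k < n" for k using GT[OF \<open>p < n\<close> q(1) \<open>rel p q\<close> that q(1)] q by simp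
    then show ?thesis using that by (simp add: Z_def)
  qed
  \<comment> \<open>A zero column \<open>p\<close> related to a nonzero column \<open>q\<close>
    would make the image of a matrix unit annihilate the invertible \<open>G'\<close>, against the
    injectivity of \<open>T0\<close>.\<close>
  have up: "q \<in> Z" if "p \<in> Z" "q < n" "rel p q" for p q
  proof (rule ccontr)
    assume qZ: "q \<notin> Z"
    have p: "p < n" "\<And>k. k < n \<Longrightarrow> G k p = 0" using that by (auto simp: Z_def)
    let ?T = "T0 (unit_mat p q)"
    have Ti: "?T \<in> inc" using linear_bij_in[OF T0] unit_mat_inc p that by blast
    note Tc = inc_carrier[OF Ti]
    have "?T * G' = 0\<^sub>m n n"
    proof (rule eq_matI)
      fix k l assume "k < dim_row (0\<^sub>m n n :: complex mat)" "l < dim_col (0\<^sub>m n n :: complex mat)"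
      then have kl: "k < n" "l < n" by auto
      have "(?T * G') $$ (k, l) = (\<Sum>m<n. ?T $$ (k, m) * G m l)"
        unfolding mult_mat_entry[OF Tc G'c kl]
      proof (rule sum.cong[OF HOL.refl])
        fix m assume "m \<in> {..<n}"
        then have m: "m < n" by simp
        show "?T $$ (k, m) * G' $$ (m, l) = ?T $$ (k, m) * G m l"
        proof (cases "?T $$ (k, m) = 0 \<or> c m \<noteq> c l")
          case True
          moreover have "G' $$ (m, l) = 0" "G m l = 0" if "c m \<noteq> c l"
            using that G's[OF m kl(2)] G_supp[OF m kl(2)] by blast+
          ultimately show ?thesis by auto
        next
          case False
          then have "c l = c q" using supp[OF p(1) that(2,3) kl(1) m] by auto
          then have "l \<notin> Z" using Zc[of l q] that qZ by auto
          then show ?thesis using m kl by (simp add: G'_def)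
        qed
      qed
      also have "\<dots> = 0" using GT[OF p(1) that(2,3) kl] p(2)[OF kl(1)] by simp
      finally show "(?T * G') $$ (k, l) = 0\<^sub>m n n $$ (k, l)" using kl by simp
    qed (use Tc G'c in auto)
    then have "?T * G' * inv\<^bsub>GL n\<^esub> G' = 0\<^sub>m n n" using GL_inv(2)[OF gl'] by simp
    moreover have "?T * G' * inv\<^bsub>GL n\<^esub> G' = ?T * (G' * inv\<^bsub>GL n\<^esub> G')"
      using Tc G'c GL_inv(2)[OF gl'] by (intro assoc_mult_mat) auto
    ultimately have "?T = 0\<^sub>m n n" using GL_inv(3)[OF gl'] Tc by simp
    then have "unit_mat p q = 0\<^sub>m n n"
      using linear_bij_inj[OF T0 unit_mat_inc[OF p(1) that(2,3)] zero_inc] linear_bij_zero[OF T0] by simp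
    then have "unit_mat p q $$ (p, q) = 0" using p that by simp
    then show False using p that by (simp add: unit_mat_entry)
  qed
  have "Z = {}"
  proof (rule ccontr)
    assume "Z \<noteq> {}"
    then obtain x where x: "x \<in> Z" "x < n" by (auto simp: Z_def)
    have all: "y \<in> Z" if "y \<in> cls x" for y
    proof -
      have "(x, y) \<in> {(i, j). i < n \<and> j < n \<and> (rel i j \<or> rel j i)}\<^sup>*" using that by (simp add: cls_def)
      then show ?thesis
        by (induction rule: rtrancl_induct) (use x up down in blast)+
    qed
    obtain k l where kl: "k < n" "l < n" "s (cls x) (k, l) \<noteq> 0" using s(2)[OF x(2)] by blast
    have "cls k = cls x" "c k = c l" using s_supp[OF x(2) kl] by auto
    then have "cls l = cls x" using cls_c[OF kl(1,2)] by simp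
    then have "l \<in> cls x" using cls_self[OF kl(2)] by simp
    then have "G k l = 0" using all kl by (auto simp: Z_def)
    then show False using G_eq[OF \<open>cls k = cls x\<close>] kl by simp
  qed
  have G'G: "G' $$ (k, l) = G k l" if "k < n" "l < n" for k l using that \<open>Z = {}\<close> by (simp add: G'_def)
  have "G' \<in> stab"
    unfolding stab_def
  proof (intro CollectI conjI allI impI G'c)
    fix i j assume ij: "i < n" "j < n"
    show "G' $$ (i, j) = 0" if "c i \<noteq> c j" using G's[OF ij] that by blast
    show "G' $$ (f i, f j) = G' $$ (i, j)" if "c i = c j"
      using solvesD(3)[OF s(1)[OF ij(1)] ij that] ij cls_f[OF ij(1)]
      by (simp add: G'G A.f_less G_def)
    show "G' $$ (g i, g j) = G' $$ (i, j)" if "c i = c j"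
      using solvesD(3)[OF s(1)[OF ij(1)] ij that] ij cls_g[OF ij(1)]
      by (simp add: G'G B.f_less G_def)
  qed
  then have GH: "G' \<in> H" using gl' by blast
  note Gi = GL_inv[OF gl']
  have TG: "T0 X * G' = G' * X" if "X \<in> inc" for X
    using that
  proof (rule inc_induct)
    show "T0 (0\<^sub>m n n) * G' = G' * 0\<^sub>m n n" using linear_bij_zero[OF T0] G'c by simp
    fix X Y assume XY: "X \<in> inc" "Y \<in> inc" "T0 X * G' = G' * X" "T0 Y * G' = G' * Y"
    have c: "X \<in> carrier_mat n n" "Y \<in> carrier_mat n n" "T0 X \<in> carrier_mat n n" "T0 Y \<in> carrier_mat n n"
      using XY linear_bij_in[OF T0] inc_carrier by auto
    show "T0 (X + Y) * G' = G' * (X + Y)"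
      unfolding linear_bij_add[OF T0 XY(1,2)]
      using c G'c XY(3,4) by (simp add: add_mult_distrib_mat[of _ n n] mult_add_distrib_mat[of G' n n])
  next
    fix p q a assume pq: "p < n" "q < n" "rel p q"
    note E = unit_mat_inc[OF pq]
    have Tc: "T0 (unit_mat p q) \<in> carrier_mat n n" using linear_bij_in[OF T0 E] inc_carrier by blast
    have "T0 (unit_mat p q) * G' = G' * unit_mat p q"
    proof (rule eq_matI)
      fix k l assume "k < dim_row (G' * unit_mat p q)" "l < dim_col (G' * unit_mat p q)"
      then have kl: "k < n" "l < n" using G'c by auto
      have "(T0 (unit_mat p q) * G') $$ (k, l) = (if l = q then G k p else 0)"
        unfolding mult_mat_entry[OF Tc G'c kl] using GT[OF pq kl] kl by (simp add: G'G)
      moreover have "(G' * unit_mat p q) $$ (k, l) = (\<Sum>m<n. if m = p then (if l = q then G k p else 0) else 0)"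
        unfolding mult_mat_entry[OF G'c unit_mat_carrier(1) kl]
        using kl by (intro sum.cong) (auto simp: G'G unit_mat_entry)
      ultimately show "(T0 (unit_mat p q) * G') $$ (k, l) = (G' * unit_mat p q) $$ (k, l)" using pq by simp
    qed (use Tc G'c in auto)
    then show "T0 (a \<cdot>\<^sub>m unit_mat p q) * G' = G' * (a \<cdot>\<^sub>m unit_mat p q)"
      unfolding linear_bij_smult[OF T0 E]
      using Tc G'c by (simp add: mult_smult_assoc_mat[of _ n n] mult_smult_distrib[of _ n n _ n])
  qed
  have "T0 X = Ad n Q G' X" if X: "X \<in> inc" for X
  proof -
    have Tc: "T0 X \<in> carrier_mat n n" using linear_bij_in[OF T0 X] inc_carrier by blast
    have "Ad n Q G' X = T0 X * G' * inv\<^bsub>GL n\<^esub> G'" using TG[OF X] Ad_apply[OF X] by simp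
    also have "\<dots> = T0 X * (G' * inv\<^bsub>GL n\<^esub> G')" using Tc G'c Gi(2) by (intro assoc_mult_mat) auto
    finally show ?thesis using Gi(3) Tc by simp
  qed
  moreover have "T0 \<in> extensional inc" using T0 Bij_imp_extensional by (auto simp: linear_bij_def)
  ultimately have "T0 = Ad n Q G'" using Ad_extensional by (intro extensionalityI)
  then show ?thesis using GH by blast
qed

text \<open>A linear bijection outside the image fails in one of two ways: it moves a matrix unit
  out of its block, which an entry detects, or some class admits only the zero solution, which a
  Gram determinant detects.\<close>

lemma Ad_H_closed: "closedin (subtopology (zariski (end_coords inc)) (carrier (GL_of inc))) (Ad n Q ` H)"
proof (rule closedin_zariskiI)
  show "Ad n Q ` H \<subseteq> carrier (GL_of inc)" using Ad_linear_bij H_Q by (auto simp: GL_of_simps(1))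
  fix T0 assume "T0 \<in> carrier (GL_of inc)" and notin: "T0 \<notin> Ad n Q ` H"
  then have T0: "T0 \<in> linear_bij inc" by (simp add: GL_of_simps(1))
  show "\<exists>F \<in> poly_funs (end_coords inc). F T0 \<noteq> 0 \<and> (\<forall>T\<in>Ad n Q ` H. F T = 0)"
  proof (cases "\<exists>p q k l. p < n \<and> q < n \<and> rel p q \<and> k < n \<and> l < n \<and> T0 (unit_mat p q) $$ (k, l) \<noteq> 0 \<and> \<not> (c k = c p \<and> c l = c q)")
    case True
    then obtain p q k l where *: "p < n" "q < n" "rel p q" "k < n" "l < n" "T0 (unit_mat p q) $$ (k, l) \<noteq> 0"
      "\<not> (c k = c p \<and> c l = c q)" by blast
    have "Ad n Q h (unit_mat p q) $$ (k, l) = 0" if h: "h \<in> H" for h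
    proof -
      note hf = H_facts[OF h]
      show ?thesis
        unfolding Ad_apply[OF unit_mat_inc[OF *(1-3)]] conj_unit_entry[OF hf(1,2) *(1,2,4,5)]
        using stab_zero[OF hf(4) *(4,1)] stab_zero[OF hf(3) *(2,5)] *(7) by auto
    qed
    then show ?thesis using entry_poly[OF *(1-5)] *(6)
      by (intro bexI[of _ "\<lambda>T. T (unit_mat p q) $$ (k, l)"]) auto
  next
    case False
    then obtain i where i: "i < n" "\<not> (\<exists>v k l. solves T0 (cls i) v \<and> k < n \<and> l < n \<and> v (k, l) \<noteq> 0)"
      using conj_criterion[OF T0] notin by blast
    then obtain F where F: "F \<in> poly_funs (end_coords inc)" "F T0 \<noteq> 0"
      "\<And>T v k l. k < n \<Longrightarrow> l < n \<Longrightarrow> v (k, l) \<noteq> 0 \<Longrightarrow> solves T (cls i) v \<Longrightarrow> F T = 0"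
      using solves_closed[of T0 "cls i"] by blast
    have "F (Ad n Q h) = 0" if "h \<in> H" for h
      using Ad_solves[OF that i(1)] F(3)[OF i(1)] by blast
    then show ?thesis using F by blast
  qed
qed

lemma Ad_H_algebraic: "algebraic_subgroup inc (Ad n Q ` H)"
  unfolding algebraic_subgroup_def using Ad_H_subgroup Ad_H_closed by blast

end

section \<open>The unipotent radical is trivial\<close>

lemma mult_mat_vec_combination:
  fixes M :: "complex mat"
  assumes "M \<in> carrier_mat n n" "p \<in> carrier_vec n" "q \<in> carrier_vec n"
  shows "M *\<^sub>v (s \<cdot>\<^sub>v p + t \<cdot>\<^sub>v q) = s \<cdot>\<^sub>v (M *\<^sub>v p) + t \<cdot>\<^sub>v (M *\<^sub>v q)"
  using assms by (simp add: mult_add_distrib_mat_vec[of M n n] mult_mat_vec[of M n n])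

context fat_group
begin

text \<open>The conjugate of \<open>X\<close> by \<open>y\<close> takes \<open>u'\<close> to
  \<open>2 * 2\<close> times \<open>u\<close>; subtracting \<open>X\<close> leaves the factor 3. So
  the \<open>k\<close>-th power of \<open>Ad y - 1\<close> sends \<open>X\<close> to a matrix with
  \<open>u'\<close> mapped to \<open>3 ^ k\<close> times \<open>u\<close>, never to 0.\<close>

lemma Ad_not_unipotent:
  assumes y: "y \<in> Q" and X: "X \<in> inc"
    and u: "u \<in> carrier_vec n" "u \<noteq> 0\<^sub>v n" and u': "u' \<in> carrier_vec n"
    and Xu: "X *\<^sub>v u' = u" and yu: "y *\<^sub>v u = 2 \<cdot>\<^sub>v u" and yu': "y *\<^sub>v u' = (1 / 2) \<cdot>\<^sub>v u'"
  shows "\<not> unipotent n inc (Ad n Q y)"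
proof
  assume "unipotent n inc (Ad n Q y)"
  let ?D = "\<lambda>Y. Ad n Q y Y - Y" and ?y' = "inv\<^bsub>GL n\<^esub> y"
  obtain k where k: "(?D ^^ k) X = 0\<^sub>m n n"
    using \<open>unipotent n inc (Ad n Q y)\<close> X by (auto simp: unipotent_def)
  have yc: "y \<in> carrier_mat n n" "?y' \<in> carrier_mat n n" using Q_carrier y Q_inv by auto
  have "?y' *\<^sub>v (y *\<^sub>v u') = u'"
    using Q_GL_inv[OF y] yc u' by (subst assoc_mult_mat_vec[symmetric, of _ n n _ n]) auto
  then have "(1 / 2) \<cdot>\<^sub>v (?y' *\<^sub>v u') = u'" using yu' mult_mat_vec[OF yc(2) u'] by simp
  then have "2 \<cdot>\<^sub>v ((1 / 2) \<cdot>\<^sub>v (?y' *\<^sub>v u')) = 2 \<cdot>\<^sub>v u'" by simp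
  then have y'u': "?y' *\<^sub>v u' = 2 \<cdot>\<^sub>v u'" by (simp add: smult_smult_assoc)
  have iter: "(?D ^^ k) X \<in> inc \<and> (?D ^^ k) X *\<^sub>v u' = 3 ^ k \<cdot>\<^sub>v u" for k
  proof (induction k)
    case 0
    then show ?case using X Xu by simp
  next
    case (Suc k)
    let ?Y = "(?D ^^ k) X"
    have Y: "?Y \<in> inc" "?Y *\<^sub>v u' = 3 ^ k \<cdot>\<^sub>v u" using Suc by auto
    note Yc = inc_carrier[OF Y(1)]
    have A: "Ad n Q y ?Y \<in> inc" using Ad_in_inc[OF y Y(1)] .
    note Ac = inc_carrier[OF A]
    have e: "Ad n Q y ?Y - ?Y = Ad n Q y ?Y + (- 1) \<cdot>\<^sub>m ?Y"
      using Ac Yc by (intro eq_matI) auto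
    have "Ad n Q y ?Y *\<^sub>v u' = y *\<^sub>v (?Y *\<^sub>v (?y' *\<^sub>v u'))"
      unfolding Ad_apply[OF Y(1)] using yc Yc u' by (simp add: assoc_mult_mat_vec[of _ n n _ n])
    also have "\<dots> = 4 * 3 ^ k \<cdot>\<^sub>v u"
      unfolding y'u' using Yc u' yc u yu Y(2)
      by (simp add: mult_mat_vec[of _ n n] smult_smult_assoc)
    finally have "?D ?Y *\<^sub>v u' = 4 * 3 ^ k \<cdot>\<^sub>v u - 3 ^ k \<cdot>\<^sub>v u"
      using minus_mult_distrib_mat_vec[OF Ac Yc u'] Y(2) by simp
    also have "\<dots> = 3 ^ Suc k \<cdot>\<^sub>v u" using u by (intro eq_vecI) auto
    finally show ?case using e inc_add[OF A inc_smult[OF Y(1)]] by simp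
  qed
  have "0\<^sub>m n n *\<^sub>v u' = 0\<^sub>v n" using u' by (intro eq_vecI) auto
  then have "3 ^ k \<cdot>\<^sub>v u = 0\<^sub>v n" using iter[of k] k by simp
  moreover obtain i where "i < n" "u $ i \<noteq> 0" using u by (metis carrier_vecD eq_vecI index_zero_vec)
  ultimately show False using u(1) by (metis carrier_vecD index_smult_vec(1) index_zero_vec(1) mult_eq_0_iff power_not_zero zero_neq_numeral)
qed

text \<open>With \<open>e\<close> a basis vector that is not an eigenvector of \<open>A\<close>, and \<open>x\<close> a transvection along \<open>e\<close>,
  the commutator of \<open>A\<close> and \<open>x\<close> acts on the span of \<open>e\<close> and \<open>A e\<close> with determinant 1; the transvection is
  scaled such that the eigenvalues there are 2 and 1/2.\<close>

lemma commutator_not_unipotent: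
  assumes A: "A \<in> H" and ij: "i0 < n" "j0 < n" "i0 \<noteq> j0" "A $$ (i0, j0) \<noteq> 0"
  shows "\<exists>x\<in>H. \<not> unipotent n inc (Ad n Q (A * (x * inv\<^bsub>GL n\<^esub> A * inv\<^bsub>GL n\<^esub> x)))"
proof -
  let ?h = "inv\<^bsub>GL n\<^esub> A"
  note Af = H_facts[OF A]
  define e :: "complex vec" where "e = unit_vec n j0"
  define a where "a = A *\<^sub>v e"
  define b where "b = ?h *\<^sub>v e"
  have ec: "e \<in> carrier_vec n" "a \<in> carrier_vec n" "b \<in> carrier_vec n"
    using Af by (auto simp: e_def a_def b_def)
  have ei: "e $ i = (if i = j0 then 1 else 0)" if "i < n" for i using that ij by (simp add: e_def)
  have ai: "a $ i = A $$ (i, j0)" and bi: "b $ i = ?h $$ (i, j0)" if "i < n" for i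
    using that Af(1,2) ij by (simp_all add: a_def b_def e_def)
  have as: "c i = c j0" if "i < n" "a $ i \<noteq> 0" for i using stab_zero[OF Af(4) that(1) ij(2)] that ai by auto
  have bs: "c i = c j0" if "i < n" "b $ i \<noteq> 0" for i using stab_zero[OF Af(3) that(1) ij(2)] that bi by auto
  have ci0: "c i0 = c j0" using as[OF ij(1)] ai ij by simp
  \<comment> \<open>\<open>A\<close> does not preserve the line of \<open>e\<close>, so neither does
    its inverse.\<close>
  have "\<exists>s<n. s \<noteq> j0 \<and> b $ s \<noteq> 0"
  proof (rule ccontr)
    assume "\<not> ?thesis"
    then have z: "?h $$ (m, j0) = 0" if "m < n" "m \<noteq> j0" for m using that bi by auto
    have "(A * ?h) $$ (i, j0) = A $$ (i, j0) * ?h $$ (j0, j0)" if "i < n" for i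
    proof -
      have "(A * ?h) $$ (i, j0) = (\<Sum>m<n. if m = j0 then A $$ (i, j0) * ?h $$ (j0, j0) else 0)"
        unfolding mult_mat_entry[OF Af(1,2) that ij(2)] using z by (intro sum.cong) auto
      then show ?thesis using ij by simp
    qed
    from this[OF ij(1)] this[OF ij(2)] show False using Af(5) ij by simp
  qed
  then obtain s where s: "s < n" "s \<noteq> j0" "b $ s \<noteq> 0" by blast
  \<comment> \<open>The coordinate sums of \<open>a\<close> and of \<open>b\<close> over
    \<open>S\<close> must both be nonzero: \<open>i0\<close> serves for \<open>a\<close> and
    \<open>s\<close> for \<open>b\<close>, and if neither serves for both, each adds 0 to the sum of
    the other. Avoiding \<open>j0\<close> makes \<open>dot e\<close> vanish.\<close>
  define S where "S = (if b $ i0 \<noteq> 0 then {i0} else if a $ s \<noteq> 0 then {s} else {i0, s})"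
  have S: "m < n" "c m = c j0" "m \<noteq> j0" if "m \<in> S" for m
    using that ij s ci0 bs[OF s(1)] by (auto simp: S_def split: if_splits)
  \<comment> \<open>The weights depend on the offset only, so that the functional can be repeated on
    every interval of one owner.\<close>
  define W where "W o' = (if \<exists>m\<in>S. off m = o' then 1 else (0::complex))" for o'
  define dot where "dot v = (\<Sum>m<n. W (off m) * v $ m)" for v :: "complex vec"
  have W_in: "W (off m) = (if m \<in> S then 1 else 0)" if "m < n" "c m = c j0" for m
    using off_inj[of _ m] S that by (auto simp: W_def)
  have dot_S: "dot v = (\<Sum>m\<in>S. v $ m)" if "\<And>m. m < n \<Longrightarrow> v $ m \<noteq> 0 \<Longrightarrow> c m = c j0" for v
  proof -
    have "dot v = (\<Sum>m<n. if m \<in> S then v $ m else 0)"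
      unfolding dot_def
    proof (rule sum.cong[OF HOL.refl])
      fix m assume "m \<in> {..<n}"
      then show "W (off m) * v $ m = (if m \<in> S then v $ m else 0)"
        using W_in[of m] that[of m] S[of m] by (cases "c m = c j0") auto
    qed
    also have "\<dots> = (\<Sum>m\<in>{..<n} \<inter> S. v $ m)" by (simp add: sum.inter_restrict)
    also have "{..<n} \<inter> S = S" using S by auto
    finally show ?thesis .
  qed
  have e_supp: "c m = c j0" if "m < n" "e $ m \<noteq> 0" for m using that by (auto simp: ei split: if_splits)
  have "dot e = (\<Sum>m\<in>S. e $ m)" by (rule dot_S) (use e_supp in blast)
  then have de: "dot e = 0" using S by (auto simp: ei intro!: sum.neutral)
  have "dot a = (\<Sum>m\<in>S. a $ m)" "dot b = (\<Sum>m\<in>S. b $ m)"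
    by (rule dot_S; use as bs in blast)+
  then have \<eta>: "dot a \<noteq> 0" and \<kappa>: "dot b \<noteq> 0"
    using ij s ai[OF ij(1)] by (cases "i0 = s"; auto simp: S_def)+
  \<comment> \<open>On the span of \<open>a\<close> and \<open>e\<close> the commutator has trace
    \<open>2 - \<sigma> * \<sigma> * dot a * dot b\<close>; this choice makes it 5/2, the sum of 2
    and 1/2.\<close>
  define \<sigma> where "\<sigma> = csqrt (- 1 / (2 * dot a * dot b))"
  have "\<sigma>\<^sup>2 = - 1 / (2 * dot a * dot b)" by (simp add: \<sigma>_def)
  then have \<sigma>: "\<sigma> * \<sigma> * dot a * dot b = - 1 / 2" using \<eta> \<kappa> by (simp add: power2_eq_square field_simps)
  then have "\<sigma> \<noteq> 0" by auto
  \<comment> \<open>A matrix of square zero, since \<open>W\<close> vanishes at the offset of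
    \<open>j0\<close>. Thus \<open>x (- t)\<close> is the inverse of \<open>x t\<close>, a
    transvection along \<open>e\<close> copied to all intervals of the owner.\<close>
  define Zf where "Zf i m = (if c i = c m \<and> kap i = kap j0 \<and> off i = off j0 then W (off m) else 0)" for i m
  define x where "x t = mat n n (\<lambda>(i, m). (if i = m then 1 else 0) + t * Zf i m)" for t :: complex
  have xc: "x t \<in> carrier_mat n n" for t by (simp add: x_def)
  have xi: "x t $$ (i, m) = (if i = m then 1 else 0) + t * Zf i m" if "i < n" "m < n" for i m t
    using that by (simp add: x_def)
  have W0: "W (off j0) = 0" using W_in[OF ij(2)] S by auto
  have ZZ: "Zf i m * Zf m l = 0" for i m l using W0 by (auto simp: Zf_def)
  have xx: "x t * x (- t) = 1\<^sub>m n" for t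
  proof (rule eq_matI)
    fix i l assume "i < dim_row (1\<^sub>m n :: complex mat)" "l < dim_col (1\<^sub>m n :: complex mat)"
    then have il: "i < n" "l < n" by auto
    have "(x t * x (- t)) $$ (i, l) =
      (\<Sum>m<n. (if m = i then (if i = l then 1 else 0) - t * Zf i l else 0) + (if m = l then t * Zf i l else 0))"
      unfolding mult_mat_entry[OF xc xc il]
    proof (rule sum.cong[OF HOL.refl])
      fix m assume "m \<in> {..<n}"
      then have m: "m < n" by simp
      have "Zf i m = 0 \<or> Zf m l = 0" using ZZ[of i m l] by simp
      then show "x t $$ (i, m) * x (- t) $$ (m, l) =
        (if m = i then (if i = l then 1 else 0) - t * Zf i l else 0) + (if m = l then t * Zf i l else 0)"
        unfolding xi[OF il(1) m] xi[OF m il(2)]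
        by (cases "m = i"; cases "m = l"; elim disjE; simp add: algebra_simps)
    qed
    also have "\<dots> = 1\<^sub>m n $$ (i, l)" using il by (simp add: sum.distrib)
    finally show "(x t * x (- t)) $$ (i, l) = 1\<^sub>m n $$ (i, l)" .
  qed (use xc in auto)
  have x_stab: "x t \<in> stab" for t
    unfolding stab_def
  proof (intro CollectI conjI allI impI xc)
    fix i m assume im: "i < n" "m < n"
    show "x t $$ (i, m) = 0" if "c i \<noteq> c m" using that im by (auto simp: xi Zf_def)
    have fi: "f i = f m \<longleftrightarrow> i = m" using A.f_f im by metis
    have gi: "g i = g m \<longleftrightarrow> i = m" using B.f_f im by metis
    assume cim: "c i = c m"
    show "x t $$ (f i, f m) = x t $$ (i, m)"
      unfolding xi[OF im] xi[OF A.f_less[OF im(1)] A.f_less[OF im(2)]]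
      using im cim A.c_f_same[OF im cim] fi by (simp add: Zf_def kap_f off_f)
    show "x t $$ (g i, g m) = x t $$ (i, m)"
      unfolding xi[OF im] xi[OF B.f_less[OF im(1)] B.f_less[OF im(2)]]
      using im cim B.c_f_same[OF im cim] gi by (simp add: Zf_def kap_g off_g)
  qed
  have xH: "x t \<in> H" for t using x_stab GL_carrierI[OF xc xc xx] by blast
  have x_inv: "inv\<^bsub>GL n\<^esub> (x t) = x (- t)" for t by (rule GL_inv_eqI[OF xc xc xx])
  have xv: "x t *\<^sub>v v = 1 \<cdot>\<^sub>v v + (t * dot v) \<cdot>\<^sub>v e"
    if v: "v \<in> carrier_vec n" and supp: "\<And>m. m < n \<Longrightarrow> v $ m \<noteq> 0 \<Longrightarrow> c m = c j0" for t v
  proof (rule eq_vecI)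
    fix i assume "i < dim_vec (1 \<cdot>\<^sub>v v + (t * dot v) \<cdot>\<^sub>v e)"
    then have i: "i < n" using ec by simp
    have "(x t *\<^sub>v v) $ i = (\<Sum>m<n. (if m = i then v $ i else 0) + t * (if i = j0 then W (off m) * v $ m else 0))"
      unfolding mult_mat_vec_entry[OF xc v i]
    proof (rule sum.cong[OF HOL.refl])
      fix m assume "m \<in> {..<n}"
      then have m: "m < n" by simp
      have "Zf i m * v $ m = (if i = j0 then W (off m) * v $ m else 0)"
      proof (cases "v $ m = 0")
        case False
        then have "c m = c j0" using supp m by blast
        then show ?thesis using off_inj[OF i ij(2)] kap_c[OF i ij(2)] by (auto simp: Zf_def)
      qed simp
      then show "x t $$ (i, m) * v $ m = (if m = i then v $ i else 0) + t * (if i = j0 then W (off m) * v $ m else 0)"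
        unfolding xi[OF i m] by (auto simp: algebra_simps)
    qed
    also have "\<dots> = v $ i + t * (if i = j0 then dot v else 0)"
      using i by (simp add: sum.distrib sum_distrib_left[symmetric] dot_def)
    finally show "(x t *\<^sub>v v) $ i = (1 \<cdot>\<^sub>v v + (t * dot v) \<cdot>\<^sub>v e) $ i"
      using i ec(1) v by (simp add: ei)
  qed (use xc[of t] ec in simp)
  let ?y = "A * (x \<sigma> * ?h * x (- \<sigma>))"
  have yv: "?y *\<^sub>v v = A *\<^sub>v (x \<sigma> *\<^sub>v (?h *\<^sub>v (x (- \<sigma>) *\<^sub>v v)))" if "v \<in> carrier_vec n" for v
  proof -
    note v = that and c1 = mult_carrier_mat[OF xc[of \<sigma>] Af(2)]
    have xv: "x (- \<sigma>) *\<^sub>v v \<in> carrier_vec n" using xc v by (rule mult_mat_vec_carrier)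
    show ?thesis
      unfolding assoc_mult_mat_vec[OF Af(1) mult_carrier_mat[OF c1 xc] v]
        assoc_mult_mat_vec[OF c1 xc v] assoc_mult_mat_vec[OF xc Af(2) xv] ..
  qed
  have ha: "?h *\<^sub>v a = e" and Ab: "A *\<^sub>v b = e"
    unfolding a_def b_def using Af ec(1) by (simp_all add: assoc_mult_mat_vec[symmetric, of _ n n _ n])
  have comb_supp: "c m = c j0" if "m < n" "(s \<cdot>\<^sub>v e + t \<cdot>\<^sub>v b) $ m \<noteq> 0" for s t m
    using that e_supp[of m] bs[of m] ec by (cases "e $ m = 0"; cases "b $ m = 0") auto
  have dot_comb: "dot (s \<cdot>\<^sub>v e + t \<cdot>\<^sub>v b) = s * dot e + t * dot b" for s t
    unfolding dot_def sum_distrib_left sum.distrib[symmetric]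
    using ec by (intro sum.cong HOL.refl) (simp add: algebra_simps)
  have ya: "?y *\<^sub>v a = (3 / 2) \<cdot>\<^sub>v a + (- \<sigma> * dot a) \<cdot>\<^sub>v e"
  proof -
    have xa: "x (- \<sigma>) *\<^sub>v a = 1 \<cdot>\<^sub>v a + (- \<sigma> * dot a) \<cdot>\<^sub>v e" using xv[OF ec(2) as] .
    have 1: "?h *\<^sub>v (x (- \<sigma>) *\<^sub>v a) = 1 \<cdot>\<^sub>v e + (- \<sigma> * dot a) \<cdot>\<^sub>v b"
      unfolding xa mult_mat_vec_combination[OF Af(2) ec(2,1)] ha b_def[symmetric] ..
    have "x \<sigma> *\<^sub>v (?h *\<^sub>v (x (- \<sigma>) *\<^sub>v a)) =
        1 \<cdot>\<^sub>v (1 \<cdot>\<^sub>v e + (- \<sigma> * dot a) \<cdot>\<^sub>v b) + (\<sigma> * dot (1 \<cdot>\<^sub>v e + (- \<sigma> * dot a) \<cdot>\<^sub>v b)) \<cdot>\<^sub>v e"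
      unfolding 1 by (rule xv, use ec in simp, erule (1) comb_supp)
    also have "\<dots> = (3 / 2) \<cdot>\<^sub>v e + (- \<sigma> * dot a) \<cdot>\<^sub>v b"
    proof -
      have "\<sigma> * dot (1 \<cdot>\<^sub>v e + (- \<sigma> * dot a) \<cdot>\<^sub>v b) = 1 / 2"
        unfolding dot_comb using de \<sigma> by (simp add: algebra_simps)
      then show ?thesis using ec by (intro eq_vecI) (auto simp: algebra_simps)
    qed
    finally show ?thesis
      unfolding yv[OF ec(2)] by (simp only: mult_mat_vec_combination[OF Af(1) ec(1,3)] Ab a_def[symmetric])
  qed
  have ye: "?y *\<^sub>v e = (\<sigma> * dot b) \<cdot>\<^sub>v a + 1 \<cdot>\<^sub>v e"
  proof -
    have "x (- \<sigma>) *\<^sub>v e = e" using xv[OF ec(1) e_supp] de ec by (auto intro!: eq_vecI)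
    then have hxe: "?h *\<^sub>v (x (- \<sigma>) *\<^sub>v e) = b" by (simp add: b_def)
    have xhx: "x \<sigma> *\<^sub>v (?h *\<^sub>v (x (- \<sigma>) *\<^sub>v e)) = 1 \<cdot>\<^sub>v b + (\<sigma> * dot b) \<cdot>\<^sub>v e"
      unfolding hxe by (rule xv[OF ec(3) bs])
    have "?y *\<^sub>v e = 1 \<cdot>\<^sub>v (A *\<^sub>v b) + (\<sigma> * dot b) \<cdot>\<^sub>v (A *\<^sub>v e)"
      unfolding yv[OF ec(1)] xhx mult_mat_vec_combination[OF Af(1) ec(3,1)] ..
    then show ?thesis unfolding Ab a_def[symmetric] using ec by (auto simp: comm_add_vec[of _ n])
  qed
  \<comment> \<open>The eigenvector for \<open>r\<close>; the condition on \<open>r\<close> in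
    \<open>yw\<close> is the characteristic equation on the span of \<open>a\<close> and
    \<open>e\<close>, with roots 2 and 1/2.\<close>
  define w where "w r = (r - 1) \<cdot>\<^sub>v a + (- \<sigma> * dot a) \<cdot>\<^sub>v e" for r :: complex
  have wc: "w r \<in> carrier_vec n" for r using ec by (simp add: w_def)
  have yc: "?y \<in> carrier_mat n n" by (intro mult_carrier_mat[of _ n n _ n] Af(1,2) xc)
  have yw: "?y *\<^sub>v w r = r \<cdot>\<^sub>v w r" if r: "(r - 1) * (3 / 2) + 1 / 2 = r * (r - 1)" for r
  proof (rule eq_vecI)
    fix i assume "i < dim_vec (r \<cdot>\<^sub>v w r)"
    then have i: "i < n" using wc[of r] by simp
    have "?y *\<^sub>v w r = (r - 1) \<cdot>\<^sub>v ((3 / 2) \<cdot>\<^sub>v a + (- \<sigma> * dot a) \<cdot>\<^sub>v e) + (- \<sigma> * dot a) \<cdot>\<^sub>v ((\<sigma> * dot b) \<cdot>\<^sub>v a + 1 \<cdot>\<^sub>v e)"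
      unfolding w_def mult_mat_vec_combination[OF yc ec(2,1)] ya ye ..
    then have "(?y *\<^sub>v w r) $ i = ((r - 1) * (3 / 2) - \<sigma> * \<sigma> * dot a * dot b) * a $ i + r * (- \<sigma> * dot a) * e $ i"
      using i ec by (simp add: algebra_simps)
    also have "(r - 1) * (3 / 2) - \<sigma> * \<sigma> * dot a * dot b = r * (r - 1)" unfolding \<sigma> using r by simp
    finally show "(?y *\<^sub>v w r) $ i = (r \<cdot>\<^sub>v w r) $ i"
      using i ec by (simp add: w_def algebra_simps)
  qed (use Af(1) wc[of r] in auto)
  have w2: "?y *\<^sub>v w 2 = 2 \<cdot>\<^sub>v w 2" and wh: "?y *\<^sub>v w (1 / 2) = (1 / 2) \<cdot>\<^sub>v w (1 / 2)"
    by (rule yw; simp)+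
  have ws: "c i = c j0" if "i < n" "w r $ i \<noteq> 0" for i r
    using that e_supp[of i] as[of i] ec by (cases "e $ i = 0"; cases "a $ i = 0") (auto simp: w_def)
  have wi0: "w r $ i0 = (r - 1) * A $$ (i0, j0)" for r
    using ij ec ai[OF ij(1)] by (simp add: w_def ei)
  \<comment> \<open>A rank-one matrix taking \<open>w (1 / 2)\<close> to \<open>w 2\<close>. The
    divisor is nonzero because \<open>A $$ (i0, j0)\<close> is, and all entries join equal
    positions, so the matrix is in the algebra.\<close>
  define X where "X = mat n n (\<lambda>(i, j). if j = i0 then w 2 $ i / w (1 / 2) $ i0 else 0)"
  have Xc: "X \<in> carrier_mat n n" by (simp add: X_def)
  have "X \<in> inc"
  proof (rule incI[OF Xc])
    fix i j assume "i < n" "j < n" "X $$ (i, j) \<noteq> 0"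
    then have "j = i0" "w 2 $ i \<noteq> 0" by (auto simp: X_def split: if_splits)
    then show "rel i j" using ws[of i 2] \<open>i < n\<close> ci0 by (simp add: rel_def)
  qed
  moreover have "X *\<^sub>v w (1 / 2) = w 2"
  proof (rule eq_vecI)
    fix i assume "i < dim_vec (w 2)"
    then have i: "i < n" using wc[of 2] by simp
    have "(X *\<^sub>v w (1 / 2)) $ i = (\<Sum>m<n. if m = i0 then w 2 $ i / w (1 / 2) $ i0 * w (1 / 2) $ i0 else 0)"
      unfolding mult_mat_vec_entry[OF Xc wc i] using i by (intro sum.cong) (auto simp: X_def)
    then show "(X *\<^sub>v w (1 / 2)) $ i = w 2 $ i" using ij wi0[of "1 / 2"] by simp
  qed (use wc[of 2] Xc in simp)
  moreover have "w 2 \<noteq> 0\<^sub>v n"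
  proof
    assume "w 2 = 0\<^sub>v n"
    then have "w 2 $ i0 = 0" using ij by simp
    then show False using wi0[of 2] ij by simp
  qed
  moreover have "?y \<in> Q"
    using H_Q H_mult[OF A H_mult[OF H_mult[OF xH H_inv[OF A]] xH]] by blast
  ultimately have "\<not> unipotent n inc (Ad n Q ?y)" using Ad_not_unipotent wc w2 wh by blast
  then show ?thesis using xH[of \<sigma>] x_inv[of \<sigma>] by (intro bexI[of _ "x \<sigma>"]) auto
qed

lemma normal_commutator:
  assumes N: "U \<lhd> (GL_of inc\<lparr>carrier := Ad n Q ` H\<rparr>)" and A: "A \<in> H" "Ad n Q A \<in> U" and x: "x \<in> H"
  shows "Ad n Q (A * (x * inv\<^bsub>GL n\<^esub> A * inv\<^bsub>GL n\<^esub> x)) \<in> U"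
proof -
  let ?G = "GL_of inc\<lparr>carrier := Ad n Q ` H\<rparr>"
  interpret N: normal U ?G by fact
  have inv: "inv\<^bsub>?G\<^esub> (Ad n Q h) = Ad n Q (inv\<^bsub>GL n\<^esub> h)" if "h \<in> H" for h
    using group.m_inv_consistent[OF GL_of_group Ad_H_subgroup, of "Ad n Q h"] that Ad_inv[OF H_Q[OF that]] by simp
  have mult: "Ad n Q h \<otimes>\<^bsub>?G\<^esub> Ad n Q k = Ad n Q (h * k)" if "h \<in> H" "k \<in> H" for h k
    using Ad_mult[OF H_Q[OF that(1)] H_Q[OF that(2)]] by simp
  have "Ad n Q (inv\<^bsub>GL n\<^esub> A) \<in> U" using N.m_inv_closed[OF A(2)] inv[OF A(1)] by simp
  then have "Ad n Q x \<otimes>\<^bsub>?G\<^esub> Ad n Q (inv\<^bsub>GL n\<^esub> A) \<otimes>\<^bsub>?G\<^esub> inv\<^bsub>?G\<^esub> (Ad n Q x) \<in> U"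
    using N.inv_op_closed2[of "Ad n Q x"] x by simp
  then have "Ad n Q (x * inv\<^bsub>GL n\<^esub> A * inv\<^bsub>GL n\<^esub> x) \<in> U"
    unfolding inv[OF x] mult[OF x H_inv[OF A(1)]] mult[OF H_mult[OF x H_inv[OF A(1)]] H_inv[OF x]] .
  then have "Ad n Q A \<otimes>\<^bsub>?G\<^esub> Ad n Q (x * inv\<^bsub>GL n\<^esub> A * inv\<^bsub>GL n\<^esub> x) \<in> U"
    using subgroup.m_closed[OF N.subgroup_axioms A(2)] by blast
  then show ?thesis
    unfolding mult[OF A(1) H_mult[OF H_mult[OF x H_inv[OF A(1)]] H_inv[OF x]]] .
qed

text \<open>\<open>Ad A\<close> scales each matrix unit by a quotient of diagonal entries, and a
  unipotent scaling is the identity.\<close>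

lemma diagonal_unipotent_trivial:
  assumes A: "A \<in> H" and diag: "\<And>i j. i < n \<Longrightarrow> j < n \<Longrightarrow> i \<noteq> j \<Longrightarrow> A $$ (i, j) = 0"
    and unip: "unipotent n inc (Ad n Q A)"
  shows "Ad n Q A = \<one>\<^bsub>GL_of inc\<^esub>"
proof -
  let ?h = "inv\<^bsub>GL n\<^esub> A"
  note Af = H_facts[OF A]
  note lin = Ad_linear_bij[OF H_Q[OF A]]
  have Ah: "A $$ (i, i) * ?h $$ (i, l) = (if i = l then 1 else 0)" if "i < n" "l < n" for i l
  proof -
    have "(A * ?h) $$ (i, l) = (\<Sum>m<n. if m = i then A $$ (i, i) * ?h $$ (i, l) else 0)"
      unfolding mult_mat_entry[OF Af(1,2) that] using diag that by (intro sum.cong) auto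
    then show ?thesis using Af(5) that by simp
  qed
  have fix_unit: "Ad n Q A (unit_mat p q) = unit_mat p q" if pq: "p < n" "q < n" "rel p q" for p q
  proof -
    note E = unit_mat_inc[OF pq]
    define \<rho> where "\<rho> = A $$ (p, p) * ?h $$ (q, q)"
    have 1: "Ad n Q A (unit_mat p q) = \<rho> \<cdot>\<^sub>m unit_mat p q"
    proof (rule eq_matI)
      fix k l assume "k < dim_row (\<rho> \<cdot>\<^sub>m unit_mat p q)" "l < dim_col (\<rho> \<cdot>\<^sub>m unit_mat p q)"
      then have kl: "k < n" "l < n" by auto
      have "?h $$ (q, l) = 0" if "l \<noteq> q" using Ah[OF pq(2) kl(2)] Ah[OF pq(2,2)] that by auto
      then show "Ad n Q A (unit_mat p q) $$ (k, l) = (\<rho> \<cdot>\<^sub>m unit_mat p q) $$ (k, l)"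
        unfolding Ad_apply[OF E] conj_unit_entry[OF Af(1,2) pq(1,2) kl]
        using kl pq diag[OF kl(1) pq(1)] by (auto simp: \<rho>_def unit_mat_entry)
    qed (use inc_carrier[OF Ad_in_inc[OF H_Q[OF A] E]] in auto)
    obtain k where k: "((\<lambda>Y. Ad n Q A Y - Y) ^^ k) (unit_mat p q) = 0\<^sub>m n n"
      using unip E by (auto simp: unipotent_def)
    have "((\<lambda>Y. Ad n Q A Y - Y) ^^ k) (unit_mat p q) = (\<rho> - 1) ^ k \<cdot>\<^sub>m unit_mat p q" for k
    proof (induction k)
      case 0
      show ?case by (intro eq_matI) auto
    next
      case (Suc k)
      then show ?case
        unfolding funpow.simps comp_apply Suc linear_bij_smult[OF lin E] 1
        by (intro eq_matI) (auto simp: algebra_simps)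
    qed
    then have "((\<rho> - 1) ^ k \<cdot>\<^sub>m unit_mat p q) $$ (p, q) = 0" using k pq by simp
    then have "\<rho> = 1" using pq by (simp add: unit_mat_entry)
    then show ?thesis using 1 by (auto intro!: eq_matI)
  qed
  have "Ad n Q A X = X" if "X \<in> inc" for X
    using that
  proof (rule inc_induct)
    show "Ad n Q A (0\<^sub>m n n) = 0\<^sub>m n n" by (rule linear_bij_zero[OF lin])
    show "Ad n Q A (X + Y) = X + Y" if "X \<in> inc" "Y \<in> inc" "Ad n Q A X = X" "Ad n Q A Y = Y" for X Y
      using linear_bij_add[OF lin that(1,2)] that(3,4) by simp
    show "Ad n Q A (a \<cdot>\<^sub>m unit_mat p q) = a \<cdot>\<^sub>m unit_mat p q" if "p < n" "q < n" "rel p q" for p q a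
      using linear_bij_smult[OF lin unit_mat_inc[OF that]] fix_unit[OF that] by simp
  qed
  then show ?thesis using Ad_extensional[of A] by (auto simp: GL_of_simps extensional_def)
qed

lemma reductive_Ad_H: "reductive_subgroup n inc (Ad n Q ` H)"
  unfolding reductive_subgroup_def
proof (intro conjI allI impI Ad_H_algebraic)
  fix U assume U: "algebraic_subgroup inc U \<and> U \<lhd> GL_of inc\<lparr>carrier := Ad n Q ` H\<rparr> \<and>
    connectedin (zariski (end_coords inc)) U \<and> (\<forall>T\<in>U. unipotent n inc T)"
  then have N: "U \<lhd> GL_of inc\<lparr>carrier := Ad n Q ` H\<rparr>" and unip: "\<And>T. T \<in> U \<Longrightarrow> unipotent n inc T" by auto
  interpret N: normal U "GL_of inc\<lparr>carrier := Ad n Q ` H\<rparr>" by (rule N)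
  have "T = \<one>\<^bsub>GL_of inc\<^esub>" if T: "T \<in> U" for T
  proof -
    obtain A where A: "A \<in> H" "T = Ad n Q A" using N.subset T by auto
    have "A $$ (i, j) = 0" if ij: "i < n" "j < n" "i \<noteq> j" for i j
    proof (rule ccontr)
      assume "A $$ (i, j) \<noteq> 0"
      then obtain x where "x \<in> H" "\<not> unipotent n inc (Ad n Q (A * (x * inv\<^bsub>GL n\<^esub> A * inv\<^bsub>GL n\<^esub> x)))"
        using commutator_not_unipotent[OF A(1) ij] by blast
      then show False using normal_commutator[OF N A(1)] T A(2) unip by blast
    qed
    then show ?thesis using diagonal_unipotent_trivial[OF A(1)] unip[OF T] A(2) by blast
  qed
  moreover have "\<one>\<^bsub>GL_of inc\<^esub> \<in> U" using subgroup.one_closed[OF N.subgroup_axioms] by simp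
  ultimately show "U = {\<one>\<^bsub>GL_of inc\<^esub>}" by blast
qed

theorem maximal_reductive_stabiliser_H: "maximal_reductive_stabiliser n Q H"
proof -
  have "reductive_type n Q gamma"
    unfolding reductive_type_def group_stabiliser_eq lie by (rule reductive_Ad_H)
  then show ?thesis
    unfolding maximal_reductive_stabiliser_def strongly_quasi_reductive_def quasi_reductive_def
    using gamma_linear nilpotent_gamma group_stabiliser_eq lie_centre_semisimple lie by auto
qed

end

section \<open>The product of the attached subgroups\<close>

lemma GL_one_dim: "M \<in> carrier (GL (Suc 0)) \<longleftrightarrow> M \<in> carrier_mat (Suc 0) (Suc 0) \<and> M $$ (0, 0) \<noteq> 0"
proof -
  have "det M = M $$ (0, 0)" if "M \<in> carrier_mat (Suc 0) (Suc 0)"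
    using laplace_expansion_row[OF that, of 0] that by (simp add: cofactor_def mat_delete_def)
  then show ?thesis by (auto simp: GL_carrier_det)
qed

context seaweed_meander
begin

text \<open>Two vertices of one interval share a block of either composition, so relating them adds
  nothing; for different intervals the order of the centres is that of the vertices.\<close>

lemma rel_iff:
  assumes "i < n" "j < n"
  shows "fat.rel i j \<longleftrightarrow> i = j \<or> (j < i \<and> same_block as i j) \<or> (i < j \<and> same_block bs i j)"
proof -
  have b: "lo i \<le> i" "i \<le> hi i" "lo j \<le> j" "j \<le> hi j" using assms lo_le le_hi by auto
  consider "cen i = cen j" | "cen j < cen i" | "cen i < cen j" by linarith
  then show ?thesis
  proof cases
    case 1
    then have "same_block as i j" "same_block bs i j"
      using fat.A.r_same[OF assms] fat.B.r_same[OF assms] by auto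
    then show ?thesis using 1 by (auto simp: fat.rel_def)
  next
    case 2
    then have "j < i" using cen_less[OF assms(2,1)] b by simp
    then show ?thesis using 2 by (auto simp: fat.rel_def)
  next
    case 3
    then have "i < j" using cen_less[OF assms] b by simp
    then show ?thesis using 3 by (auto simp: fat.rel_def)
  qed
qed

sublocale incidence n fat.rel
proof
  show "fat.rel i i" if "i < n" for i using that by (simp add: fat.rel_def)
qed (rule fat.rel_trans)

lemma seaweed_eq: "seaweed n as bs = inc"
proof -
  have "(\<forall>i<n. \<forall>j<n. (j < i \<and> \<not> same_block as i j \<longrightarrow> A $$ (i, j) = 0) \<and>
      (i < j \<and> \<not> same_block bs i j \<longrightarrow> A $$ (i, j) = 0)) \<longleftrightarrow>
    (\<forall>i<n. \<forall>j<n. \<not> fat.rel i j \<longrightarrow> A $$ (i, j) = 0)" for A :: "complex mat"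
  proof (intro all_cong)
    fix i j assume "i < n" "j < n"
    then show "(j < i \<and> \<not> same_block as i j \<longrightarrow> A $$ (i, j) = 0) \<and>
      (i < j \<and> \<not> same_block bs i j \<longrightarrow> A $$ (i, j) = 0) \<longleftrightarrow> (\<not> fat.rel i j \<longrightarrow> A $$ (i, j) = 0)"
      using rel_iff[of i j] by (metis linorder_neqE_nat order_less_asym)
  qed
  then show ?thesis unfolding seaweed_def inc_def by blast
qed

lemma off_less: "x < n \<Longrightarrow> off x < Suc (len x)"
  using len_refl(3)[OF refl_al] by (simp add: less_Suc_eq_le)

lemma interval_point:
  assumes "x < n" "s < Suc (len x)"
  shows "lo x + s < n" "lo (lo x + s) = lo x" "hi (lo x + s) = hi x" "owner (lo x + s) = owner x"
    "off (lo x + s) = s" "cen (lo x + s) = cen x"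
proof -
  have "lo x \<le> lo x + s" "lo x + s \<le> hi x" using assms lo_le[OF assms(1)] le_hi[OF assms(1)] by (auto simp: len_def)
  note i = same_ivl[OF assms(1) this]
  then show "lo x + s < n" "lo (lo x + s) = lo x" "hi (lo x + s) = hi x" "owner (lo x + s) = owner x"
    "off (lo x + s) = s" "cen (lo x + s) = cen x" by (auto simp: off_def cen_def)
qed

lemma cen_same:
  assumes "x < n" "y < n" "cen x = cen y"
  shows "owner x = owner y" "lo x = lo y" "hi x = hi y" "len x = len y"
proof -
  show l: "lo x = lo y" "hi x = hi y" using cen_eq[OF assms] by auto
  then show "len x = len y" by (simp add: len_def)
  show "owner x = owner y"
    using same_ivl(1)[OF assms(1), of y] lo_le[OF assms(2)] le_hi[OF assms(2)] l by simp
qed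

lemma off_eqD: "x < n \<Longrightarrow> y < n \<Longrightarrow> cen x = cen y \<Longrightarrow> off x = off y \<Longrightarrow> x = y"
  by (metis cen_same(2) lo_off)

lemma sum_interval:
  assumes "x < n" "\<And>m. m < n \<Longrightarrow> cen m \<noteq> cen x \<Longrightarrow> F m = (0 :: complex)"
  shows "(\<Sum>m<n. F m) = (\<Sum>s<Suc (len x). F (lo x + s))"
proof -
  have "(\<Sum>m<n. F m) = (\<Sum>m \<in> {m. m < n \<and> cen m = cen x}. F m)"
    using assms(2) by (intro sum.mono_neutral_right) auto
  also have "\<dots> = (\<Sum>s<Suc (len x). F (lo x + s))"
  proof (rule sum.reindex_bij_witness[of _ "\<lambda>s. lo x + s" off])
    fix m assume "m \<in> {m. m < n \<and> cen m = cen x}"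
    then have m: "m < n" "cen m = cen x" by auto
    note c = cen_same[OF m(1) assms(1) m(2)]
    show "lo x + off m = m" using lo_off[OF m(1)] c by simp
    then show "F (lo x + off m) = F m" by simp
    show "off m \<in> {..<Suc (len x)}" using off_less[OF m(1)] c by simp
  qed (use interval_point[OF assms(1)] in auto)
  finally show ?thesis .
qed

section \<open>One matrix repeated on all intervals of a component\<close>

definition emb :: "nat set \<Rightarrow> complex mat \<Rightarrow> complex mat" where
  "emb X M = mat n n (\<lambda>(i, j). if owner i = X \<and> cen i = cen j then M $$ (off i, off j) else if i = j then 1 else 0)"

lemma emb_carrier: "emb X M \<in> carrier_mat n n"
  by (simp add: emb_def)

lemma emb_entry: "i < n \<Longrightarrow> j < n \<Longrightarrow> emb X M $$ (i, j) =
    (if owner i = X \<and> cen i = cen j then M $$ (off i, off j) else if i = j then 1 else 0)"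
  by (simp add: emb_def)

lemma maximal_owner_ex:
  assumes "maximal X"
  obtains x where "x < n" "x \<in> X" "owner x = X" "dimension n as bs X = Suc (len x)"
proof -
  have X: "X \<in> comps" using assms by (simp add: maximal_def)
  obtain x where x: "x \<in> X" using comps_nonempty[OF X] by blast
  then have "x < n" "owner x = X" using comps_comp[OF X] owner_in[OF X assms] by auto
  then show ?thesis using that x dimension_owner by metis
qed

lemma emb_mult:
  assumes X: "maximal X" and r: "r = dimension n as bs X"
    and M: "M \<in> carrier_mat r r" "N \<in> carrier_mat r r"
  shows "emb X M * emb X N = emb X (M * N)"
proof (rule eq_matI)
  obtain x where x: "x < n" "owner x = X" "dimension n as bs X = Suc (len x)"
    using maximal_owner_ex[OF X] by blast
  fix i j assume "i < dim_row (emb X (M * N))" "j < dim_col (emb X (M * N))"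
  then have ij: "i < n" "j < n" by (auto simp: emb_def)
  have prod: "(emb X M * emb X N) $$ (i, j) = (\<Sum>m<n. emb X M $$ (i, m) * emb X N $$ (m, j))"
    by (rule mult_mat_entry[OF emb_carrier emb_carrier ij])
  show "(emb X M * emb X N) $$ (i, j) = emb X (M * N) $$ (i, j)"
  proof (cases "owner i = X")
    case True
    have len: "Suc (len i) = r" using len_owner[OF ij(1) x(1)] x True r by simp
    have oi: "off i < r" using off_less[OF ij(1)] len by simp
    have "(emb X M * emb X N) $$ (i, j) = (\<Sum>s<r. emb X M $$ (i, lo i + s) * emb X N $$ (lo i + s, j))"
      unfolding prod len[symmetric]
      by (rule sum_interval[OF ij(1)]) (use ij in \<open>auto simp: emb_entry True\<close>)
    also have "\<dots> = (\<Sum>s<r. if cen i = cen j then M $$ (off i, s) * N $$ (s, off j) else 0)"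
    proof (rule sum.cong[OF HOL.refl])
      fix s assume "s \<in> {..<r}"
      then have s: "s < Suc (len i)" using len by simp
      note p = interval_point[OF ij(1) s]
      have "lo i + s \<noteq> j" if "cen i \<noteq> cen j" using p(6) that by auto
      then show "emb X M $$ (i, lo i + s) * emb X N $$ (lo i + s, j) =
          (if cen i = cen j then M $$ (off i, s) * N $$ (s, off j) else 0)"
        using ij p True by (simp add: emb_entry)
    qed
    also have "\<dots> = emb X (M * N) $$ (i, j)"
    proof (cases "cen i = cen j")
      case c: True
      have "off j < r" using off_less[OF ij(2)] cen_same(4)[OF ij c] len by simp
      then show ?thesis using mult_mat_entry[OF M oi, of "off j"] c True ij by (simp add: emb_entry)
    next
      case False
      then show ?thesis using ij by (auto simp: emb_entry)
    qed
    finally show ?thesis .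
  next
    case False
    have "(emb X M * emb X N) $$ (i, j) = (\<Sum>m<n. if m = i then emb X N $$ (i, j) else 0)"
      unfolding prod using False ij by (intro sum.cong) (auto simp: emb_entry)
    then show ?thesis using False ij by (simp add: emb_entry)
  qed
qed (simp_all add: emb_def)

lemma emb_one:
  assumes X: "maximal X"
  shows "emb X (1\<^sub>m (dimension n as bs X)) = 1\<^sub>m n"
proof (rule eq_matI)
  obtain x where x: "x < n" "owner x = X" "dimension n as bs X = Suc (len x)"
    using maximal_owner_ex[OF X] by blast
  fix i j assume "i < dim_row (1\<^sub>m n :: complex mat)" "j < dim_col (1\<^sub>m n :: complex mat)"
  then have ij: "i < n" "j < n" by auto
  have "1\<^sub>m (dimension n as bs X) $$ (off i, off j) = (if i = j then 1 else (0::complex))"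
    if o: "owner i = X" and c: "cen i = cen j"
  proof -
    have "len i = len x" "len j = len x" using len_owner[OF ij(1) x(1)] o x cen_same(4)[OF ij c] by auto
    then show ?thesis using off_less[OF ij(1)] off_less[OF ij(2)] x(3) off_eqD[OF ij c] by auto
  qed
  then show "emb X (1\<^sub>m (dimension n as bs X)) $$ (i, j) = 1\<^sub>m n $$ (i, j)"
    unfolding emb_entry[OF ij] index_one_mat(1)[OF ij]
    by (cases "owner i = X \<and> cen i = cen j") (simp_all only: if_True if_False simp_thms)
qed (simp_all add: emb_def)

lemma emb_GL:
  assumes "maximal X" "M \<in> carrier (GL (dimension n as bs X))"
  shows "emb X M \<in> carrier (GL n)"
proof (rule GL_carrierI[OF emb_carrier emb_carrier])
  note i = GL_inv[OF assms(2)]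
  show "emb X M * emb X (inv\<^bsub>GL (dimension n as bs X)\<^esub> M) = 1\<^sub>m n"
    using emb_mult[OF assms(1) HOL.refl GL_carrier_mat[OF assms(2)] i(2)] i(3) emb_one[OF assms(1)] by simp
qed

text \<open>This trades the list indices in the attached group for owners and centres, on which the
  reflections act.\<close>

lemma cycle_interval_index:
  assumes X: "cyc X" "maximal X"
  shows "(\<exists>k. 2 * k + 1 < card X \<and> {i, j} \<subseteq> {descending X ! (2 * k + 1)..descending X ! (2 * k)}) \<longleftrightarrow>
    i < n \<and> j < n \<and> owner i = X \<and> cen i = cen j"
proof
  assume "\<exists>k. 2 * k + 1 < card X \<and> {i, j} \<subseteq> {descending X ! (2 * k + 1)..descending X ! (2 * k)}"
  then obtain l u where lu: "is_int X l u" "l \<le> i" "i \<le> u" "l \<le> j" "j \<le> u"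
    unfolding is_int_descending[OF cycD(2)[OF X(1)]] by auto
  have own: "owner x = X" if "l \<le> x" "x \<le> u" for x
    using int_inside[OF lu(1) that] X by (intro owner_eqI) (auto simp: owns_def)
  have "u < n" using lu(1) cycD(3)[OF X(1)] by (auto simp: is_int_def)
  moreover have "lo x = l \<and> hi x = u" if "l \<le> x" "x \<le> u" for x
    using lo_hi_eqI[of x l u] own[OF that] X(1) lu(1) that by simp
  ultimately show "i < n \<and> j < n \<and> owner i = X \<and> cen i = cen j"
    using own lu by (simp add: cen_def)
next
  assume *: "i < n \<and> j < n \<and> owner i = X \<and> cen i = cen j"
  then have "is_int X (lo i) (hi i)" using lo_hi_cyc(1)[of i] X by simp
  then obtain k where "2 * k + 1 < card X" "lo i = descending X ! (2 * k + 1)" "hi i = descending X ! (2 * k)"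
    unfolding is_int_descending[OF cycD(2)[OF X(1)]] by blast
  moreover have "lo i \<le> i" "i \<le> hi i" "lo i \<le> j" "j \<le> hi i"
    using * lo_le[of i] le_hi[of i] lo_le[of j] le_hi[of j] cen_same(2,3)[of i j] by simp_all
  ultimately show "\<exists>k. 2 * k + 1 < card X \<and> {i, j} \<subseteq> {descending X ! (2 * k + 1)..descending X ! (2 * k)}"
    by (intro exI[of _ k]) auto
qed

lemma cycle_group_eq:
  assumes X: "cyc X" "maximal X" and r: "r = dimension n as bs X"
  shows "cycle_group n r X = emb X ` carrier (GL r)"
proof (rule equalityI; rule subsetI)
  obtain x where x: "x < n" "owner x = X" "dimension n as bs X = Suc (len x)"
    using maximal_owner_ex[OF X(2)] by blast
  note index = cycle_interval_index[OF X]
  have off_r: "off i < r" if "i < n" "owner i = X" for i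
    using off_less[OF that(1)] len_owner[OF that(1) x(1)] x that r by simp
  {
    fix A assume "A \<in> cycle_group n r X"
    then obtain M where A: "A \<in> carrier_mat n n" and M: "M \<in> carrier (GL r)"
      and 1: "\<forall>k. 2 * k + 1 < card X \<longrightarrow> (\<forall>p<r. \<forall>q<r.
        A $$ (descending X ! (2 * k + 1) + p, descending X ! (2 * k + 1) + q) = M $$ (p, q))"
      and 2: "\<forall>p<n. \<forall>q<n.
        \<not> (\<exists>k. 2 * k + 1 < card X \<and> {p, q} \<subseteq> {descending X ! (2 * k + 1)..descending X ! (2 * k)}) \<longrightarrow>
        A $$ (p, q) = (if p = q then 1 else 0)"
      unfolding cycle_group_def mem_Collect_eq by (elim conjE bexE)
    note 1 = 1[rule_format] and 2 = 2[rule_format]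
    have "A = emb X M"
    proof (rule eq_matI)
      fix i j assume "i < dim_row (emb X M)" "j < dim_col (emb X M)"
      then have ij: "i < n" "j < n" by (auto simp: emb_def)
      show "A $$ (i, j) = emb X M $$ (i, j)"
      proof (cases "owner i = X \<and> cen i = cen j")
        case True
        then have "is_int X (lo i) (hi i)" using lo_hi_cyc(1)[OF ij(1)] X by simp
        then obtain k where k: "2 * k + 1 < card X" "lo i = descending X ! (2 * k + 1)"
          unfolding is_int_descending[OF cycD(2)[OF X(1)]] by blast
        have o: "owner j = X" "lo j = lo i" using cen_same[OF ij] True by auto
        have "A $$ (lo i + off i, lo i + off j) = M $$ (off i, off j)"
          using 1[OF k(1) off_r[OF ij(1)] off_r[OF ij(2) o(1)]] True k(2) by simp
        then show ?thesis using lo_off[OF ij(1)] lo_off[OF ij(2)] o True ij by (simp add: emb_entry)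
      next
        case False
        then have "\<not> (\<exists>k. 2 * k + 1 < card X \<and> {i, j} \<subseteq> {descending X ! (2 * k + 1)..descending X ! (2 * k)})"
          unfolding index by blast
        from 2[OF ij this] show ?thesis unfolding emb_entry[OF ij] if_not_P[OF False] .
      qed
    qed (use A in \<open>auto simp: emb_def\<close>)
    then show "A \<in> emb X ` carrier (GL r)" using M by blast
  }
  fix A assume "A \<in> emb X ` carrier (GL r)"
  then obtain M where M: "M \<in> carrier (GL r)" "A = emb X M" by blast
  show "A \<in> cycle_group n r X"
    unfolding cycle_group_def
  proof (intro CollectI conjI bexI[OF _ M(1)] allI impI)
    show "A \<in> carrier_mat n n" using M emb_carrier by simp
    fix k p q assume k: "2 * k + 1 < card X" and pq: "p < r" "q < r"
    let ?l = "descending X ! (2 * k + 1)" and ?u = "descending X ! (2 * k)"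
    have i: "is_int X ?l ?u" unfolding is_int_descending[OF cycD(2)[OF X(1)]] using k by blast
    then have l: "?l < n" "?l \<le> ?u" using cycD(3)[OF X(1)] by (auto simp: is_int_def)
    have "owner ?l = X" using int_inside[OF i, of ?l] l X by (intro owner_eqI) (auto simp: owns_def)
    moreover from this have "lo ?l = ?l" using lo_hi_eqI[of ?l ?l ?u] X(1) i l by simp
    moreover have "Suc (len ?l) = r" using len_owner[OF l(1) x(1)] calculation x r by simp
    ultimately show "A $$ (?l + p, ?l + q) = M $$ (p, q)"
      using interval_point[OF l(1), of p] interval_point[OF l(1), of q] pq M by (simp add: emb_entry)
  next
    fix p q assume pq: "p < n" "q < n"
      and "\<not> (\<exists>k. 2 * k + 1 < card X \<and> {p, q} \<subseteq> {descending X ! (2 * k + 1)..descending X ! (2 * k)})"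
    then have "\<not> (owner p = X \<and> cen p = cen q)" unfolding index by blast
    then show "A $$ (p, q) = (if p = q then 1 else 0)" using pq M by (auto simp: emb_entry)
  qed
qed

text \<open>The intervals of a segment are points, so equal centres mean equal vertices, all offsets
  are 0, and only a 1 by 1 matrix is repeated.\<close>

lemma segment_group_eq:
  assumes X: "\<not> cyc X" "maximal X"
  shows "segment_group n X = emb X ` carrier (GL (Suc 0))"
proof -
  have XC: "X \<in> comps" using X by (simp add: maximal_def)
  have own: "owner i = X \<longleftrightarrow> i \<in> X" if "i < n" for i
    using owner_in[OF XC X(2)] lo_hi_not_cyc(3)[OF that] X(1) by metis
  define D :: "complex \<Rightarrow> complex mat" where
    "D z = mat n n (\<lambda>(p, q). if p = q then if p \<in> X then z else 1 else 0)" for z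
  have e: "emb X M = D (M $$ (0, 0))" for M
    unfolding D_def
  proof (rule eq_matI)
    fix i j assume "i < dim_row (mat n n (\<lambda>(p, q). if p = q then if p \<in> X then M $$ (0, 0) else 1 else 0))"
      "j < dim_col (mat n n (\<lambda>(p, q). if p = q then if p \<in> X then M $$ (0, 0) else 1 else 0))"
    then have ij: "i < n" "j < n" by auto
    have "off i = 0 \<and> (cen i = cen j \<longrightarrow> i = j)" if "owner i = X"
      using lo_hi_not_cyc[OF ij(1)] lo_hi_not_cyc[OF ij(2)] cen_same[OF ij] that X(1) by (auto simp: off_def)
    then show "emb X M $$ (i, j) = mat n n (\<lambda>(p, q). if p = q then if p \<in> X then M $$ (0, 0) else 1 else 0) $$ (i, j)"
      using ij own[OF ij(1)] by (auto simp: emb_entry)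
  qed (simp_all add: emb_def)
  have "(\<lambda>M. M $$ (0, 0)) ` carrier (GL (Suc 0)) = {z. z \<noteq> 0}"
  proof (rule equalityI; rule subsetI)
    fix z :: complex assume "z \<in> {z. z \<noteq> 0}"
    then have "mat (Suc 0) (Suc 0) (\<lambda>_. z) \<in> carrier (GL (Suc 0))" "z = mat (Suc 0) (Suc 0) (\<lambda>_. z) $$ (0, 0)"
      by (auto simp: GL_one_dim)
    then show "z \<in> (\<lambda>M. M $$ (0, 0)) ` carrier (GL (Suc 0))" by blast
  qed (auto simp: GL_one_dim)
  moreover have "segment_group n X = D ` {z. z \<noteq> 0}"
    unfolding segment_group_def D_def by blast
  moreover have "emb X ` carrier (GL (Suc 0)) = D ` (\<lambda>M. M $$ (0, 0)) ` carrier (GL (Suc 0))"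
    unfolding image_image e ..
  ultimately show ?thesis by simp
qed

lemma attached_group_eq:
  assumes X: "maximal X"
  shows "attached_group n as bs X = emb X ` carrier (GL (dimension n as bs X))"
proof (cases "cyc X")
  case True
  then show ?thesis using cycle_group_eq[OF True X] by (simp add: attached_group_def cycles_eq)
next
  case False
  then show ?thesis using segment_group_eq[OF False X] by (simp add: attached_group_def cycles_eq dimension_def)
qed

text \<open>Different components own disjoint sets of vertices, so the factors differ from the
  identity on different blocks and the product can be read off blockwise, in any order.\<close>

lemma emb_product:
  assumes "distinct Xs"
  shows "foldr (*) (map (\<lambda>X. emb X (G X)) Xs) (1\<^sub>m n) =
    mat n n (\<lambda>(i, j). if owner i \<in> set Xs \<and> cen i = cen j then G (owner i) $$ (off i, off j) else if i = j then 1 else 0)"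
    (is "_ = ?P Xs")
  using assms
proof (induction Xs)
  case Nil
  show ?case by (intro eq_matI) auto
next
  case (Cons X Xs)
  have Pc: "?P Xs \<in> carrier_mat n n" by simp
  have "foldr (*) (map (\<lambda>X. emb X (G X)) (X # Xs)) (1\<^sub>m n) = emb X (G X) * ?P Xs"
    using Cons by simp
  also have "\<dots> = ?P (X # Xs)"
  proof (rule eq_matI)
    fix i j assume "i < dim_row (?P (X # Xs))" "j < dim_col (?P (X # Xs))"
    then have ij: "i < n" "j < n" by auto
    have "(emb X (G X) * ?P Xs) $$ (i, j) = (\<Sum>m<n. emb X (G X) $$ (i, m) * ?P Xs $$ (m, j))"
      by (rule mult_mat_entry[OF emb_carrier Pc ij])
    also have "\<dots> = (if owner i = X then \<Sum>m<n. if m = j then emb X (G X) $$ (i, j) else 0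
        else \<Sum>m<n. if m = i then ?P Xs $$ (i, j) else 0)"
    proof (cases "owner i = X")
      case True
      have "emb X (G X) $$ (i, m) * ?P Xs $$ (m, j) = (if m = j then emb X (G X) $$ (i, j) else 0)" if m: "m < n" for m
      proof (cases "cen i = cen m")
        case c: True
        then have "owner m = X" using cen_same(1)[OF ij(1) m] True by simp
        then have "?P Xs $$ (m, j) = (if m = j then 1 else 0)" using Cons.prems m ij by simp
        then show ?thesis by simp
      next
        case False
        then show ?thesis using m ij by (auto simp: emb_entry)
      qed
      then show ?thesis using True by simp
    next
      case False
      have "emb X (G X) $$ (i, m) * ?P Xs $$ (m, j) = (if m = i then ?P Xs $$ (i, j) else 0)" if m: "m < n" for m
        using False m ij by (simp add: emb_entry)
      then show ?thesis using False by simp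
    qed
    also have "\<dots> = ?P (X # Xs) $$ (i, j)" using ij by (auto simp: emb_entry)
    finally show "(emb X (G X) * ?P Xs) $$ (i, j) = ?P (X # Xs) $$ (i, j)" .
  qed (simp_all add: emb_def)
  finally show ?case .
qed

end

section \<open>The product of the attached groups is the stabiliser\<close>

locale seaweed_group = seaweed_meander +
  fixes Q :: "complex mat set"
  assumes Q: "connected_linear_algebraic_group n Q" and lie_Q: "lie_algebra n Q = seaweed n as bs"

sublocale seaweed_group \<subseteq> G: fat_group n cen "fat (reflect as)" "fat (reflect bs)" "same_block as" "same_block bs" Q owner off
proof (intro fat_group.intro fat.fat_meander_axioms fat_group_axioms.intro)
  show "connected_incidence_group n fat.rel Q"
    using Q lie_Q seaweed_eq
    by unfold_locales (auto simp: connected_linear_algebraic_group_def)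
  show "owner x = owner y" if "x < n" "y < n" "cen x = cen y" for x y using cen_same(1)[OF that] .
  show "x = y" if "x < n" "y < n" "cen x = cen y" "off x = off y" for x y using off_eqD[OF that] .
qed (fact fat_props(2,5)[OF refl_al] fat_props(2,5)[OF refl_be])+

context seaweed_group
begin

lemma emb_stab:
  assumes X: "maximal X" and M: "M \<in> carrier (GL (dimension n as bs X))"
  shows "emb X M \<in> G.H"
proof
  show "emb X M \<in> carrier (GL n)" by (rule emb_GL[OF X M])
  show "emb X M \<in> G.stab"
    unfolding G.stab_def
  proof (intro CollectI conjI allI impI emb_carrier)
    fix i j assume ij: "i < n" "j < n"
    show "emb X M $$ (i, j) = 0" if "cen i \<noteq> cen j" using that ij by (auto simp: emb_entry)
    have *: "emb X M $$ (fat h i, fat h j) = emb X M $$ (i, j)" if c: "cen i = cen j" and R: "refl h r" for h r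
    proof -
      interpret F: reflection_blocks n cen "fat h" r by (rule reflection_blocks_fat[OF R])
      have "fat h i = fat h j \<longleftrightarrow> i = j" using F.f_f ij by metis
      then show ?thesis
        using ij F.f_less[OF ij(1)] F.f_less[OF ij(2)] F.c_f_same[OF ij c] c
          fat_props[OF R ij(1)] fat_props[OF R ij(2)] by (simp add: emb_entry)
    qed
    show "emb X M $$ (fat (reflect as) i, fat (reflect as) j) = emb X M $$ (i, j)"
      "emb X M $$ (fat (reflect bs) i, fat (reflect bs) j) = emb X M $$ (i, j)" if "cen i = cen j"
      using *[OF that refl_al] *[OF that refl_be] by auto
  qed
qed

text \<open>The fat reflections keep offsets and preserve entries of \<open>A\<close>, so the
  vertices at which the entry has the given value form a stable set, and
  \<open>fat_connected\<close> reaches the interval of \<open>x\<close>.\<close>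

lemma stab_block:
  assumes A: "A \<in> G.stab" and x: "x < n" and ij: "i < n" "j < n" "cen i = cen j" "owner i = owner x"
  shows "A $$ (i, j) = A $$ (lo x + off i, lo x + off j)"
proof -
  let ?S = "{y. y < n \<and> owner y = owner x \<and> A $$ (y, lo y + off j) = A $$ (i, j)}"
  have len: "off j < Suc (len y)" if "y < n" "owner y = owner x" for y
    using off_less[OF ij(2)] len_owner[OF that(1) ij(1)] cen_same(4)[OF ij(1-3)] that(2) ij(4) by simp
  have step: "fat h ` ?S \<subseteq> ?S" if R: "refl h r"
    and inv: "\<And>k l. k < n \<Longrightarrow> l < n \<Longrightarrow> cen k = cen l \<Longrightarrow> A $$ (fat h k, fat h l) = A $$ (k, l)" for h r
  proof clarify
    fix y assume y: "y < n" "owner y = owner x" "A $$ (y, lo y + off j) = A $$ (i, j)"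
    let ?z = "lo y + off j"
    note z = interval_point[OF y(1) len[OF y(1,2)]]
    note fy = fat_props[OF R y(1)] and fz = fat_props[OF R z(1)]
    have "lo (fat h y) + off j = fat h ?z"
      using lo_off[OF fz(1)] fy fz z by simp
    then show "fat h y < n \<and> owner (fat h y) = owner x \<and> A $$ (fat h y, lo (fat h y) + off j) = A $$ (i, j)"
      using fy(1,2) y inv[OF y(1) z(1)] z(6) by simp
  qed
  have sx: "off i < Suc (len x)" using off_less[OF ij(1)] len_owner[OF ij(1) x ij(4)] by simp
  note p = interval_point[OF x sx]
  have "lo x + off i \<in> ?S"
  proof (rule fat_connected[OF ij(1) p(1)])
    show "i \<in> ?S" using ij cen_same(2)[OF ij(1-3)] lo_off[OF ij(2)] by simp
    show "fat (reflect as) ` ?S \<subseteq> ?S" by (rule step[OF refl_al]) (use A in \<open>auto simp: G.stab_def\<close>)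
    show "fat (reflect bs) ` ?S \<subseteq> ?S" by (rule step[OF refl_be]) (use A in \<open>auto simp: G.stab_def\<close>)
    show "owner i = owner (lo x + off i)" "off i = off (lo x + off i)" using p ij by simp_all
  qed auto
  then show ?thesis using p(2) by simp
qed

lemma meander_group_eq: "meander_group n as bs = G.H"
proof (rule equalityI; rule subsetI)
  fix A assume "A \<in> meander_group n as bs"
  then obtain h Xs where A: "A = foldr (*) (map h Xs) (1\<^sub>m n)"
    and Xs: "set Xs = {X. maximal X}" and h: "\<And>X. X \<in> set Xs \<Longrightarrow> h X \<in> attached_group n as bs X"
    unfolding meander_group_def maximal_components_eq by blast
  have "h X \<in> G.H" if "X \<in> set Xs" for X
    using h[OF that] attached_group_eq[of X] emb_stab[of X] that Xs by auto
  then have "foldr (*) (map h Xs) (1\<^sub>m n) \<in> G.H"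
    by (induction Xs) (use G.H_one G.H_mult in auto)
  then show "A \<in> G.H" using A by simp
next
  fix A assume A: "A \<in> G.H"
  note Af = G.H_facts[OF A]
  \<comment> \<open>Any vertex of the owner will do, since the blocks along a path are equal; it
    selects the interval from which the block is read off.\<close>
  define rep where "rep X = (SOME x. x < n \<and> owner x = X)" for X
  have rep: "rep (owner x) < n" "owner (rep (owner x)) = owner x" if "x < n" for x
    using someI[of "\<lambda>y. y < n \<and> owner y = owner x" x] that by (auto simp: rep_def)
  define blk where "blk B X = mat (dimension n as bs X) (dimension n as bs X)
    (\<lambda>(p, q). B $$ (lo (rep X) + p, lo (rep X) + q))" for B :: "complex mat" and X
  have blk_GL: "blk A X \<in> carrier (GL (dimension n as bs X))" if X: "maximal X" for X
  proof -
    obtain x where x: "x < n" "owner x = X" using maximal_owner_ex[OF X] by blast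
    let ?x = "rep X" and ?h = "inv\<^bsub>GL n\<^esub> A"
    have y: "?x < n" "owner ?x = X" using rep[OF x(1)] x(2) by auto
    have r: "dimension n as bs X = Suc (len ?x)" using dimension_owner[OF y(1)] y(2) by simp
    \<comment> \<open>\<open>A\<close> vanishes between different intervals, so restricting the
      product of \<open>A\<close> and its inverse to one interval gives the product of the
      restrictions.\<close>
    have "blk A X * blk ?h X = 1\<^sub>m (dimension n as bs X)"
    proof (rule eq_matI)
      fix p q assume "p < dim_row (1\<^sub>m (dimension n as bs X) :: complex mat)"
        "q < dim_col (1\<^sub>m (dimension n as bs X) :: complex mat)"
      then have pq: "p < Suc (len ?x)" "q < Suc (len ?x)" using r by auto
      note P = interval_point[OF y(1) pq(1)] and Q' = interval_point[OF y(1) pq(2)]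
      have "(blk A X * blk ?h X) $$ (p, q) =
          (\<Sum>s<Suc (len ?x). A $$ (lo ?x + p, lo ?x + s) * ?h $$ (lo ?x + s, lo ?x + q))"
        using mult_mat_entry[of "blk A X" "Suc (len ?x)" "Suc (len ?x)" "blk ?h X" "Suc (len ?x)" p q] pq r
        by (simp add: blk_def del: sum.lessThan_Suc)
      also have "\<dots> = (\<Sum>m<n. A $$ (lo ?x + p, m) * ?h $$ (m, lo ?x + q))"
        by (rule sum_interval[OF y(1), symmetric]) (use G.stab_zero[OF Af(4) P(1)] P(6) in simp)
      also have "\<dots> = (A * ?h) $$ (lo ?x + p, lo ?x + q)"
        using mult_mat_entry[OF Af(1,2) P(1) Q'(1)] by simp
      finally show "(blk A X * blk ?h X) $$ (p, q) = 1\<^sub>m (dimension n as bs X) $$ (p, q)"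
        using Af(5) P(1) Q'(1) pq r by simp
    qed (simp_all add: blk_def)
    then show ?thesis by (intro GL_carrierI[of _ _ "blk ?h X"]) (auto simp: blk_def)
  qed
  have "finite {X. maximal X}"
    by (rule finite_subset[of _ comps]) (auto simp: maximal_def comps_def)
  then obtain Xs where Xs: "set Xs = {X. maximal X}" "distinct Xs" using finite_distinct_list by blast
  have "A = foldr (*) (map (\<lambda>X. emb X (blk A X)) Xs) (1\<^sub>m n)"
    unfolding emb_product[OF Xs(2)]
  proof (rule eq_matI)
    fix i j assume "i < dim_row (mat n n (\<lambda>(i, j). if owner i \<in> set Xs \<and> cen i = cen j then blk A (owner i) $$ (off i, off j) else if i = j then 1 else 0))"
      "j < dim_col (mat n n (\<lambda>(i, j). if owner i \<in> set Xs \<and> cen i = cen j then blk A (owner i) $$ (off i, off j) else if i = j then 1 else 0))"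
    then have ij: "i < n" "j < n" by auto
    have own: "owner i \<in> set Xs" using maximal_owner[OF ij(1)] Xs by simp
    have "A $$ (i, j) = blk A (owner i) $$ (off i, off j)" if c: "cen i = cen j"
      using stab_block[OF Af(4) rep(1)[OF ij(1)] ij c] rep(2)[OF ij(1)] dimension_owner[OF ij(1)]
        off_less[OF ij(1)] off_less[OF ij(2)] cen_same(4)[OF ij c] by (simp add: blk_def)
    moreover have "A $$ (i, j) = 0 \<and> i \<noteq> j" if "cen i \<noteq> cen j" using G.stab_zero[OF Af(4) ij that] that by auto
    ultimately show "A $$ (i, j) = mat n n (\<lambda>(i, j). if owner i \<in> set Xs \<and> cen i = cen j then blk A (owner i) $$ (off i, off j) else if i = j then 1 else 0) $$ (i, j)"
      using ij own by auto
  qed (use Af(1) in auto)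
  moreover have "\<forall>X\<in>set Xs. emb X (blk A X) \<in> attached_group n as bs X"
    using attached_group_eq blk_GL Xs by auto
  ultimately show "A \<in> meander_group n as bs"
    unfolding meander_group_def maximal_components_eq using Xs by blast
qed

end

theorem theorem5p3:
  fixes n :: nat and as bs :: "nat list" and Q :: "complex mat set"
  assumes "n > 0"
    and "composition n as" and "composition n bs"
    and "connected_linear_algebraic_group n Q"
    and "lie_algebra n Q = seaweed n as bs"
  shows "maximal_reductive_stabiliser n Q (meander_group n as bs)"
proof -
  interpret seaweed_group n as bs Q by unfold_locales (fact assms)+
  show ?thesis unfolding meander_group_eq by (rule G.maximal_reductive_stabiliser_H)
qed

end
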